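(* Let $H$ be a subgroup of $PL_o(I)$. Assume that $H$ has an orbital $(a,b)$ and that some element of $H$ approaches one of the endpoints $a$ or $b$ in $(a,b)$ but does not approach the other endpoint in $(a,b)$. Then $H$ contains a subgroup isomorphic to Thompson's group $F$.
   Context: $I=[0,1]$. $PL_o(I)$ is the group of piecewise linear (finitely many changes of slope), orientation preserving self homeomorphisms of $I$, under composition. Functions are written to the right of their arguments and composition proceeds from left to right. Thompson's group $F$ is the group with presentation $\langle g_0,g_1 \mid g_1^{g_0g_0}=g_1^{g_0g_1},\ g_1^{g_0g_0g_0}=g_1^{g_0g_0g_1}\rangle$, where $x^y=y^{-1}xy$. Let $H$ be a subgroup of $PL_o(I)$. The fixed point set of $H$ is the set of points of $I$ fixed by all $h\in H$; the support of $H$ is its complement in $I$. For $x$ in the support of $H$, the orbital of $x$ under $H$ is the convex hull of the orbit $\{xh\mid h\in H\}$; the orbitals of $H$ are exactly the connected components of the support of $H$ (open intervals). The orbitals of an element $h$ are the orbitals of the cyclic group $\langle h\rangle$. If $h\in H$ and $A$ is an orbital of $H$ with an endpoint $e$, then $h$ approaches $e$ in $A$ if some orbital $B$ of $h$ lies in $A$ and has $e$ as an endpoint. *)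

theory Defs
  imports "HOL-Analysis.Analysis" "HOL-Algebra.Generated_Groups"
begin

section \<open>Piecewise linear homeomorphisms of the unit interval\<close>

abbreviation unit_Icc :: "real set" where
  "unit_Icc \<equiv> {0..1}"

definition linear_on_Icc :: "(real \<Rightarrow> real) \<Rightarrow> real \<Rightarrow> real \<Rightarrow> bool" where
  "linear_on_Icc f x y \<longleftrightarrow> (\<exists>m c. \<forall>z\<in>{x..y}. f z = m * z + c)"

text \<open>The finite set \<open>P\<close> contains the points at which the slope may change.\<close>

definition piecewise_linear :: "(real \<Rightarrow> real) \<Rightarrow> bool" where
  "piecewise_linear f \<longleftrightarrow>
     (\<exists>P. finite P \<and>
        (\<forall>x y. 0 \<le> x \<and> x \<le> y \<and> y \<le> 1 \<and> P \<inter> {x<..<y} = {} \<longrightarrow> linear_on_Icc f x y))"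

text \<open>
  Elements are functions on the unit interval, represented extensionally (\<open>undefined\<close> outside).
  Products are read from left to right: \<open>f \<otimes> g\<close> applies \<open>f\<close> first.
\<close>

definition PLo :: "(real \<Rightarrow> real) monoid" where
  "PLo = \<lparr>carrier = {f \<in> extensional unit_Icc.
                       (\<exists>g. homeomorphism unit_Icc unit_Icc f g) \<and>
                       strict_mono_on unit_Icc f \<and> piecewise_linear f},
          mult = (\<lambda>f g. compose unit_Icc g f),
          one = (\<lambda>x\<in>unit_Icc. x)\<rparr>"

section \<open>Orbitals\<close>

definition fixed_points :: "(real \<Rightarrow> real) set \<Rightarrow> real set" where
  "fixed_points H = {x \<in> unit_Icc. \<forall>h\<in>H. h x = x}"

definition support :: "(real \<Rightarrow> real) set \<Rightarrow> real set" where
  "support H = unit_Icc - fixed_points H"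

definition orbital_of :: "(real \<Rightarrow> real) set \<Rightarrow> real \<Rightarrow> real set" where
  "orbital_of H x = convex hull {h x | h. h \<in> H}"

definition orbitals :: "(real \<Rightarrow> real) set \<Rightarrow> real set set" where
  "orbitals H = {orbital_of H x | x. x \<in> support H}"

definition orbitals_elt :: "(real \<Rightarrow> real) \<Rightarrow> real set set" where
  "orbitals_elt h = orbitals (generate PLo {h})"

definition endpoint :: "real \<Rightarrow> real set \<Rightarrow> bool" where
  "endpoint e A \<longleftrightarrow> (\<exists>a b. a < b \<and> A = {a<..<b} \<and> (e = a \<or> e = b))"

text \<open>
  Intended for \<open>h\<close> in a subgroup of \<open>PLo\<close> having \<open>A\<close> as an orbital, and for \<open>e\<close> an endpoint of \<open>A\<close>.
\<close>

definition approaches_in :: "(real \<Rightarrow> real) \<Rightarrow> real \<Rightarrow> real set \<Rightarrow> bool" where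
  "approaches_in h e A \<longleftrightarrow> (\<exists>B\<in>orbitals_elt h. B \<subseteq> A \<and> endpoint e B)"

section \<open>Group presentations and Thompson's group\<close>

text \<open>
  In a word, the letter \<open>(x, True)\<close> stands for the generator \<open>x\<close> and \<open>(x, False)\<close> for its inverse.
\<close>

type_synonym 'g word = "('g \<times> bool) list"

definition word_inv :: "'g word \<Rightarrow> 'g word" where
  "word_inv w = map (\<lambda>(x, e). (x, \<not> e)) (rev w)"

definition word_conj :: "'g word \<Rightarrow> 'g word \<Rightarrow> 'g word" where
  "word_conj x y = word_inv y @ x @ y"

inductive word_eq :: "('g word \<times> 'g word) set \<Rightarrow> 'g word \<Rightarrow> 'g word \<Rightarrow> bool"
  for R :: "('g word \<times> 'g word) set"
where
  word_eq_refl: "word_eq R u u"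
| word_eq_sym: "word_eq R u v \<Longrightarrow> word_eq R v u"
| word_eq_trans: "word_eq R u v \<Longrightarrow> word_eq R v w \<Longrightarrow> word_eq R u w"
| word_eq_append: "word_eq R u u' \<Longrightarrow> word_eq R v v' \<Longrightarrow> word_eq R (u @ v) (u' @ v')"
| word_eq_cancel: "word_eq R [(x, e), (x, \<not> e)] []"
| word_eq_rel: "(u, v) \<in> R \<Longrightarrow> word_eq R u v"

definition word_class :: "('g word \<times> 'g word) set \<Rightarrow> 'g word \<Rightarrow> 'g word set" where
  "word_class R u = {v. word_eq R u v}"

text \<open>The group with generating set the whole type \<open>'g\<close> and relations \<open>u = v\<close> for \<open>(u, v) \<in> R\<close>.\<close>

definition presented_group :: "('g word \<times> 'g word) set \<Rightarrow> 'g word set monoid" where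
  "presented_group R =
     \<lparr>carrier = range (word_class R),
      mult = (\<lambda>A B. {w. \<exists>u\<in>A. \<exists>v\<in>B. word_eq R (u @ v) w}),
      one = word_class R []\<rparr>"

datatype thompson_gen = Gen0 | Gen1

definition g0 :: "thompson_gen word" where "g0 = [(Gen0, True)]"
definition g1 :: "thompson_gen word" where "g1 = [(Gen1, True)]"

definition thompson_F :: "thompson_gen word set monoid" where
  "thompson_F = presented_group
     {(word_conj g1 (g0 @ g0), word_conj g1 (g0 @ g1)),
      (word_conj g1 (g0 @ g0 @ g0), word_conj g1 (g0 @ g0 @ g1))}"

section \<open>The structures above are groups\<close>

lemma presented_mult:
  "word_class R u \<otimes>\<^bsub>presented_group R\<^esub> word_class R v = word_class R (u @ v)"
  unfolding presented_group_def word_class_def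
  by (auto intro: word_eq_append word_eq_trans word_eq_refl)

lemma word_class_eqI: "word_eq R u v \<Longrightarrow> word_class R u = word_class R v"
  unfolding word_class_def by (auto intro: word_eq_trans word_eq_sym)

lemma word_inv_left: "word_eq R (word_inv w @ w) []"
proof (induction w)
  case Nil
  show ?case by (simp add: word_inv_def word_eq_refl)
next
  case (Cons p w)
  obtain x e where p: "p = (x, e)" by (cases p)
  have "word_eq R [(x, \<not> e), (x, e)] []"
    using word_eq_cancel[of R x "\<not> e"] by simp
  then have "word_eq R (word_inv w @ ([(x, \<not> e), (x, e)] @ w)) (word_inv w @ ([] @ w))"
    by (intro word_eq_append word_eq_refl)
  then show ?case
    using Cons.IH by (auto simp: word_inv_def p intro: word_eq_trans)
qed

lemma group_presented_group: "group (presented_group R)"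
proof (rule groupI)
  fix A assume "A \<in> carrier (presented_group R)"
  then obtain u where u: "A = word_class R u" by (auto simp: presented_group_def)
  have "word_class R (word_inv u) \<otimes>\<^bsub>presented_group R\<^esub> A = word_class R []"
    unfolding u presented_mult by (intro word_class_eqI word_inv_left)
  then show "\<exists>B\<in>carrier (presented_group R). B \<otimes>\<^bsub>presented_group R\<^esub> A = \<one>\<^bsub>presented_group R\<^esub>"
    by (auto simp: presented_group_def)
  show "\<one>\<^bsub>presented_group R\<^esub> \<otimes>\<^bsub>presented_group R\<^esub> A = A"
    using presented_mult[of R "[]" u] by (simp add: u presented_group_def)
next
  fix A B C
  assume "A \<in> carrier (presented_group R)" "B \<in> carrier (presented_group R)"
    "C \<in> carrier (presented_group R)"
  then obtain u v w where "A = word_class R u" "B = word_class R v" "C = word_class R w"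
    by (auto simp: presented_group_def)
  then show "A \<otimes>\<^bsub>presented_group R\<^esub> B \<otimes>\<^bsub>presented_group R\<^esub> C =
             A \<otimes>\<^bsub>presented_group R\<^esub> (B \<otimes>\<^bsub>presented_group R\<^esub> C)"
    by (simp add: presented_mult)
next
  fix A B assume "A \<in> carrier (presented_group R)" "B \<in> carrier (presented_group R)"
  then obtain u v where "A = word_class R u" "B = word_class R v"
    by (auto simp: presented_group_def)
  then have "A \<otimes>\<^bsub>presented_group R\<^esub> B = word_class R (u @ v)" by (simp add: presented_mult)
  then show "A \<otimes>\<^bsub>presented_group R\<^esub> B \<in> carrier (presented_group R)"
    by (simp add: presented_group_def)
qed (simp add: presented_group_def)

lemma group_thompson_F: "group thompson_F"
  unfolding thompson_F_def by (rule group_presented_group)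

lemma piecewise_linear_cong:
  assumes "\<And>x. x \<in> unit_Icc \<Longrightarrow> f x = g x" "piecewise_linear f"
  shows "piecewise_linear g"
proof -
  have "linear_on_Icc f x y = linear_on_Icc g x y" if "0 \<le> x" "y \<le> 1" for x y
    using that assms(1) unfolding linear_on_Icc_def by simp
  then show ?thesis using assms(2) unfolding piecewise_linear_def by metis
qed

lemma piecewise_linear_compose:
  assumes f: "strict_mono_on unit_Icc f" "f ` unit_Icc = unit_Icc" "piecewise_linear f"
    and g: "piecewise_linear g"
  shows "piecewise_linear (\<lambda>x. g (f x))"
proof -
  obtain P where P: "finite P"
    "\<And>x y. 0 \<le> x \<Longrightarrow> x \<le> y \<Longrightarrow> y \<le> 1 \<Longrightarrow> P \<inter> {x<..<y} = {} \<Longrightarrow> linear_on_Icc f x y"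
    using f(3) unfolding piecewise_linear_def by metis
  obtain Q where Q: "finite Q"
    "\<And>x y. 0 \<le> x \<Longrightarrow> x \<le> y \<Longrightarrow> y \<le> 1 \<Longrightarrow> Q \<inter> {x<..<y} = {} \<Longrightarrow> linear_on_Icc g x y"
    using g unfolding piecewise_linear_def by metis
  define h where "h = inv_into unit_Icc f"
  have mono: "f x \<le> f y" if "x \<in> unit_Icc" "y \<in> unit_Icc" "x \<le> y" for x y
    using f(1) that by (metis order_le_less strict_mono_onD)
  have inv: "h y \<in> unit_Icc" "f (h y) = y" if "y \<in> unit_Icc" for y
    using that f(2) unfolding h_def by (metis inv_into_into, metis f_inv_into_f)
  have "linear_on_Icc (\<lambda>x. g (f x)) x y"
    if xy: "0 \<le> x" "x \<le> y" "y \<le> 1" "(P \<union> h ` Q) \<inter> {x<..<y} = {}" for x y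
  proof -
    have fxy: "f x \<in> unit_Icc" "f y \<in> unit_Icc" "f x \<le> f y"
      using f(2) xy mono[of x y] by auto
    have "Q \<inter> {f x<..<f y} = {}"
    proof (rule ccontr)
      assume "Q \<inter> {f x<..<f y} \<noteq> {}"
      then obtain q where q: "q \<in> Q" "f x < q" "q < f y" by auto
      then have qI: "q \<in> unit_Icc" using fxy by auto
      have "x < h q" using mono[of "h q" x] inv[OF qI] q xy by fastforce
      moreover have "h q < y" using mono[of y "h q"] inv[OF qI] q xy by fastforce
      ultimately show False using q xy(4) by auto
    qed
    then have "linear_on_Icc g (f x) (f y)" using Q(2) fxy by auto
    then obtain m c where mc: "\<And>z. z \<in> {f x..f y} \<Longrightarrow> g z = m * z + c"
      unfolding linear_on_Icc_def by auto
    have "P \<inter> {x<..<y} = {}" using xy(4) by blast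
    then obtain m' c' where mc': "\<And>z. z \<in> {x..y} \<Longrightarrow> f z = m' * z + c'"
      using P(2)[of x y] xy unfolding linear_on_Icc_def by auto
    have "g (f z) = (m * m') * z + (m * c' + c)" if z: "z \<in> {x..y}" for z
    proof -
      have "f z \<in> {f x..f y}" using mono[of x z] mono[of z y] z xy by auto
      then show ?thesis using mc mc'[OF z] by (simp add: algebra_simps)
    qed
    then show ?thesis unfolding linear_on_Icc_def by blast
  qed
  moreover have "finite (P \<union> h ` Q)" using P Q by auto
  ultimately show ?thesis unfolding piecewise_linear_def by blast
qed

lemma piecewise_linear_inverse:
  assumes f: "strict_mono_on unit_Icc f" "piecewise_linear f"
    and g: "g ` unit_Icc = unit_Icc" "\<And>y. y \<in> unit_Icc \<Longrightarrow> f (g y) = y"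
  shows "piecewise_linear g"
proof -
  obtain P where P: "finite P"
    "\<And>x y. 0 \<le> x \<Longrightarrow> x \<le> y \<Longrightarrow> y \<le> 1 \<Longrightarrow> P \<inter> {x<..<y} = {} \<Longrightarrow> linear_on_Icc f x y"
    using f(2) unfolding piecewise_linear_def by metis
  have mono: "x < y \<longleftrightarrow> f x < f y" if "x \<in> unit_Icc" "y \<in> unit_Icc" for x y
    using strict_mono_on_less[OF f(1)] that by simp
  have gI: "g y \<in> unit_Icc" if "y \<in> unit_Icc" for y using g(1) that by blast
  have gmono: "g x < g y \<longleftrightarrow> x < y" if "x \<in> unit_Icc" "y \<in> unit_Icc" for x y
    using mono[OF gI[OF that(1)] gI[OF that(2)]] g(2) that by simp
  have "linear_on_Icc g x y"
    if xy: "0 \<le> x" "x \<le> y" "y \<le> 1" "f ` P \<inter> {x<..<y} = {}" for x y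
  proof (cases "x = y")
    case True
    then show ?thesis unfolding linear_on_Icc_def by (intro exI[of _ 0] exI[of _ "g x"]) simp
  next
    case False
    then have lt: "x < y" using xy by simp
    have I: "x \<in> unit_Icc" "y \<in> unit_Icc" using xy by auto
    have gxy: "g x < g y" using gmono[OF I] lt by simp
    have "P \<inter> {g x<..<g y} = {}"
    proof (rule ccontr)
      assume "P \<inter> {g x<..<g y} \<noteq> {}"
      then obtain p where p: "p \<in> P" "g x < p" "p < g y" by auto
      then have pI: "p \<in> unit_Icc" using gI[OF I(1)] gI[OF I(2)] by auto
      have "x < f p" "f p < y"
        using mono[OF gI[OF I(1)] pI] mono[OF pI gI[OF I(2)]] g(2) I p by auto
      then show False using p xy(4) by auto
    qed
    then obtain m c where mc: "\<And>z. z \<in> {g x..g y} \<Longrightarrow> f z = m * z + c"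
      using P(2)[of "g x" "g y"] gI[OF I(1)] gI[OF I(2)] gxy unfolding linear_on_Icc_def by auto
    have eq: "z = m * g z + c" if z: "z \<in> {x..y}" for z
    proof -
      have zI: "z \<in> unit_Icc" using z xy by auto
      have "g z \<in> {g x..g y}"
        using gmono[OF zI I(1)] gmono[OF I(2) zI] z by auto
      then show ?thesis using mc g(2)[OF zI] by metis
    qed
    have "m \<noteq> 0" using eq[of x] eq[of y] lt by auto
    then have "g z = (1 / m) * z + (- c / m)" if "z \<in> {x..y}" for z
      using eq[OF that] by (simp add: field_simps)
    then show ?thesis unfolding linear_on_Icc_def by blast
  qed
  moreover have "finite (f ` P)" using P by auto
  ultimately show ?thesis unfolding piecewise_linear_def by blast
qed

lemma group_PLo: "group PLo"
proof (rule groupI)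
  show "\<one>\<^bsub>PLo\<^esub> \<in> carrier PLo"
  proof -
    have "homeomorphism unit_Icc unit_Icc (\<lambda>x\<in>unit_Icc. x) (\<lambda>x\<in>unit_Icc. x)"
      by (rule homeomorphism_cong[OF homeomorphism_ident]) auto
    moreover have "piecewise_linear (\<lambda>x. x)"
      unfolding piecewise_linear_def linear_on_Icc_def
      by (intro exI[of _ "{}"] allI impI conjI exI[of _ 1] exI[of _ 0]) auto
    then have "piecewise_linear (\<lambda>x\<in>unit_Icc. x)"
      by (rule piecewise_linear_cong[rotated]) auto
    ultimately show ?thesis
      unfolding PLo_def by (auto simp: strict_mono_on_def)
  qed
next
  fix f g assume fg: "f \<in> carrier PLo" "g \<in> carrier PLo"
  then obtain f' g' where h: "homeomorphism unit_Icc unit_Icc f f'"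
    "homeomorphism unit_Icc unit_Icc g g'" by (auto simp: PLo_def)
  have im: "f ` unit_Icc = unit_Icc" using h(1) by (simp add: homeomorphism_def)
  have mono: "strict_mono_on unit_Icc f" "strict_mono_on unit_Icc g"
    and pl: "piecewise_linear f" "piecewise_linear g" using fg by (auto simp: PLo_def)
  have "homeomorphism unit_Icc unit_Icc (g \<circ> f) (f' \<circ> g')"
    using homeomorphism_compose[OF h] by simp
  then have "homeomorphism unit_Icc unit_Icc (compose unit_Icc g f) (f' \<circ> g')"
    by (rule homeomorphism_cong) (auto simp: compose_def)
  moreover have "piecewise_linear (compose unit_Icc g f)"
    by (rule piecewise_linear_cong[OF _ piecewise_linear_compose[OF mono(1) im pl]])
       (simp add: compose_def)
  moreover have "strict_mono_on unit_Icc (compose unit_Icc g f)"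
  proof (rule strict_mono_onI)
    fix r s assume rs: "r \<in> unit_Icc" "s \<in> unit_Icc" "r < s"
    then have "f r < f s" "f r \<in> unit_Icc" "f s \<in> unit_Icc"
      using strict_mono_onD[OF mono(1)] im by blast+
    then show "compose unit_Icc g f r < compose unit_Icc g f s"
      using strict_mono_onD[OF mono(2)] rs by (simp add: compose_def)
  qed
  ultimately show "f \<otimes>\<^bsub>PLo\<^esub> g \<in> carrier PLo"
    by (auto simp: PLo_def compose_def)
next
  fix f g h assume "f \<in> carrier PLo" "g \<in> carrier PLo" "h \<in> carrier PLo"
  then have "f \<in> unit_Icc \<rightarrow> unit_Icc" by (auto simp: PLo_def homeomorphism_def)
  then show "f \<otimes>\<^bsub>PLo\<^esub> g \<otimes>\<^bsub>PLo\<^esub> h = f \<otimes>\<^bsub>PLo\<^esub> (g \<otimes>\<^bsub>PLo\<^esub> h)"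
    by (simp add: PLo_def compose_assoc)
next
  fix f assume f: "f \<in> carrier PLo"
  then have "f \<in> unit_Icc \<rightarrow> unit_Icc" "f \<in> extensional unit_Icc"
    by (auto simp: PLo_def homeomorphism_def)
  then show "\<one>\<^bsub>PLo\<^esub> \<otimes>\<^bsub>PLo\<^esub> f = f"
    by (simp add: PLo_def compose_Id)
  obtain f' where f': "homeomorphism unit_Icc unit_Icc f f'" using f by (auto simp: PLo_def)
  define g where "g = restrict f' unit_Icc"
  have gext: "g \<in> extensional unit_Icc" by (simp add: g_def)
  have mono: "strict_mono_on unit_Icc f" and pl: "piecewise_linear f"
    using f by (auto simp: PLo_def)
  have hg: "homeomorphism unit_Icc unit_Icc g f"
    by (rule homeomorphism_cong[OF homeomorphism_symD[OF f']]) (auto simp: g_def)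
  then have im: "g ` unit_Icc = unit_Icc" and fg: "\<And>y. y \<in> unit_Icc \<Longrightarrow> f (g y) = y"
    by (auto simp: homeomorphism_def)
  have "strict_mono_on unit_Icc g"
  proof (rule strict_mono_onI)
    fix r s assume rs: "r \<in> unit_Icc" "s \<in> unit_Icc" "r < s"
    then have "g r \<in> unit_Icc" "g s \<in> unit_Icc" using im by blast+
    then show "g r < g s"
      using strict_mono_on_less[OF mono] fg rs by metis
  qed
  then have "g \<in> carrier PLo"
    using hg piecewise_linear_inverse[OF mono pl im fg] gext by (auto simp: PLo_def)
  moreover have "g \<otimes>\<^bsub>PLo\<^esub> f = \<one>\<^bsub>PLo\<^esub>"
    using fg by (auto simp: PLo_def compose_def fun_eq_iff)
  ultimately show "\<exists>g\<in>carrier PLo. g \<otimes>\<^bsub>PLo\<^esub> f = \<one>\<^bsub>PLo\<^esub>" by blast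
qed

end

theory Submission
  imports Defs
begin

text \<open>Let \<open>k \<in> H\<close> approach \<open>b\<close> but not \<open>a\<close> in the orbital \<open>(a, b)\<close>: it is the identity near \<open>a\<close> and has no
fixed point near \<open>b\<close>, where we may assume that it moves points up. Let \<open>k\<close> be the identity on \<open>(a, c]\<close>, and pick
\<open>h \<in> H\<close> that moves \<open>c\<close> past the last fixed point of \<open>k\<close> in \<open>(a, b)\<close>. Near \<open>b\<close> all elements of \<open>H\<close>
are linear with fixed point \<open>b\<close>, so they commute there; hence \<open>k\<^sup>n\<close> and its conjugate by \<open>h\<close> coincide near
\<open>b\<close>, and for large \<open>n\<close> this makes the commutators that define \<open>F\<close> vanish on \<open>(a, b)\<close>, because
the elements concerned have disjoint supports (\<open>two_chain_F_pair\<close>). Moreover the two elements do not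
commute, and any noncommuting pair that satisfies the two relations generates a copy of \<open>F\<close>
(\<open>inj_on_F\<close>; this is the fact that all proper quotients of \<open>F\<close> are abelian).

The difficulty is that the relations may fail outside \<open>(a, b)\<close>; they have to be repaired without destroying
them on the orbital with endpoint \<open>b\<close> of the group \<open>G\<close> generated by \<open>f = k\<close> or \<open>k\<inverse>\<close> and \<open>h\<close>. Because the maps are piecewise linear,
\<open>G\<close> has only finitely many orbitals (\<open>finite_joint_orbitals\<close>), and the behaviour of \<open>f\<close> near the two ends sorts them into three types.

\<^item> \<open>F_type\<close>: \<open>f\<close> is the identity near one end and attracts towards the other, as on the
  given orbital. The construction above works on all these orbitals at once, with an element of \<open>G\<close> in the role of \<open>h\<close>.

\<^item> \<open>inert\<close>: \<open>f\<close> is the identity near both ends. If \<open>h\<close> moves the support of \<open>f\<close> off itself, then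
  the pair of the construction commutes there, and commutators in the pair are trivial.

\<^item> \<open>removable\<close>: all others. There \<open>f\<close> repels from some end, or it attracts to both ends; because of this, a power \<open>\<psi>\<close>
  of a suitable conjugate of \<open>f\<close> moves a given compact subset of the orbital off itself, while it is the identity on given compact
  subsets of the orbitals of \<open>F_type\<close>. If \<open>s\<close> and \<open>t\<close> are supported in these compact sets, then \<open>[s, t\<^sup>\<psi>]\<close> equals
  \<open>[s, t]\<close> on the orbitals of \<open>F_type\<close> and is trivial on the removable orbital.

To apply the last item, one replaces a pair with the relations of \<open>F\<close> by another one which consists of commutators;
the elements \<open>x\<^sub>1x\<^sub>3\<inverse>\<close> and \<open>x\<^sub>2x\<^sub>3\<inverse>\<close> of \<open>F\<close> serve this purpose (\<open>shrink_F_pair\<close>). Killing the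
removable orbitals one after the other gives a pair with the relations of \<open>F\<close> on all orbitals, hence
globally (\<open>F_pair_on_orbitals\<close>).

Both constructions need one element of \<open>G\<close> that moves points of several orbitals far away
simultaneously, although \<open>G\<close> need not be a product of its actions on the orbitals. This is obtained
from the dynamics of \<open>f\<close> itself (\<open>simultaneous_union\<close>) and, on inert orbitals, from the freedom to choose the
direction of the movement (\<open>simultaneous_oriented\<close>).

In the formal text groups are written additively, with \<open>u + v\<close> for \<open>u\<close> followed by \<open>v\<close>: the class
\<open>group_add\<close> does not assume commutativity.\<close>

section \<open>Groups generated by a pair with the relations of \<open>F\<close>\<close>

text \<open>Terms are kept free of subtraction, so that associativity normalises sums of \<open>x\<close> and \<open>- x\<close>.\<close>

declare add_uminus_conv_diff [simp del]

definition cj :: "'a::group_add \<Rightarrow> 'a \<Rightarrow> 'a" where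
  "cj x y = - y + x + y"

lemma cj_add: "cj (a + b) c = cj a c + cj b c"
  by (simp add: cj_def add.assoc)

lemma cj_minus: "cj (- a) c = - cj a c"
  by (simp add: cj_def add.assoc minus_add)

lemma cj_cj: "cj (cj a b) c = cj a (b + c)"
  by (simp add: cj_def add.assoc minus_add)

lemma cj_cj_swap: "cj (cj a b) c = cj (cj a c) (cj b c)"
  by (simp add: cj_def add.assoc minus_add)

lemma cj_inject [simp]: "cj a c = cj b c \<longleftrightarrow> a = b"
  by (simp add: cj_def add.assoc)

lemma cj_0 [simp]: "cj 0 c = 0" "cj a 0 = a"
  by (simp_all add: cj_def)

lemma add_eq_add_cj: "a + b = b + cj a b"
  by (simp add: cj_def add.assoc)

lemma cj_eq_self_iff: "cj a b = a \<longleftrightarrow> a + b = b + a"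
proof -
  have "cj a b = a \<longleftrightarrow> b + cj a b = b + a" by simp
  then show ?thesis by (simp add: cj_def add.assoc)
qed

lemma cj_self [simp]: "cj a a = a"
  by (simp add: cj_eq_self_iff)

lemma cj_eq_cj_iff: "cj a b = cj a c \<longleftrightarrow> a + (b + - c) = (b + - c) + a"
proof -
  have "cj a b = cj a c \<longleftrightarrow> cj (cj a b) (- c) = cj (cj a c) (- c)" by simp
  also have "\<dots> \<longleftrightarrow> cj a (b + - c) = a" by (simp add: cj_cj)
  finally show ?thesis by (simp add: cj_eq_self_iff)
qed

text \<open>The conditions are the two relations of the presentation of \<open>F\<close>, with \<open>x\<close> for \<open>g\<^sub>0\<close> and \<open>y\<close> for \<open>g\<^sub>1\<close>.\<close>

definition F_pair :: "'a::group_add \<Rightarrow> 'a \<Rightarrow> bool" where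
  "F_pair x y \<longleftrightarrow> cj y (x + x) = cj y (x + y) \<and> cj y (x + x + x) = cj y (x + x + y)"

text \<open>The usual infinite generating sequence of \<open>F\<close>, in which the relations take the uniform shape
\<open>x\<^sub>n\<close> conjugated by \<open>x\<^sub>i\<close> is \<open>x\<^sub>n\<^sub>+\<^sub>1\<close> for \<open>i < n\<close>.\<close>

fun xseq :: "'a::group_add \<Rightarrow> 'a \<Rightarrow> nat \<Rightarrow> 'a" where
  "xseq x y 0 = x"
| "xseq x y (Suc 0) = y"
| "xseq x y (Suc (Suc n)) = cj (xseq x y (Suc n)) x"

lemma xseq_Suc: "n > 0 \<Longrightarrow> xseq x y (Suc n) = cj (xseq x y n) x"
  by (cases n) auto

lemma F_pair_alt:
  "F_pair x y \<longleftrightarrow>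
     cj (xseq x y 2) y = xseq x y 3 \<and> cj (xseq x y 3) y = xseq x y 4"
  by (auto simp: F_pair_def eval_nat_numeral cj_cj add.assoc)

text \<open>The two relations are the cases \<open>n = 2, 3\<close>. Conjugating earlier cases by \<open>x\<^sub>0\<close> shows that \<open>x\<^sub>n\<close> for \<open>n \<ge> 4\<close> is
\<open>x\<^sub>n\<^sub>-\<^sub>1\<close> conjugated by \<open>x\<^sub>2\<close>; so conjugation by \<open>x\<^sub>0\<close> and by \<open>x\<^sub>1\<close> agree on \<open>x\<^sub>n\<close> because they agree on these two.\<close>

lemma xseq_conj_1:
  assumes "F_pair x y" "n \<ge> 2"
  shows "cj (xseq x y n) y = xseq x y (Suc n)"
  using assms(2)
proof (induction n rule: less_induct)
  case (less n)
  let ?x = "xseq x y"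
  show ?case
  proof (cases "n \<le> 3")
    case True
    then have "n = 2 \<or> n = 3" using less.prems by auto
    then show ?thesis using assms(1) by (auto simp: F_pair_alt simp flip: numeral_2_eq_2 numeral_3_eq_3)
  next
    case False
    then obtain m where m: "n = Suc (Suc m)" "m \<ge> 2"
      by (intro that[of "n - 2"]) auto
    have IH2: "cj (?x 2) y = cj (?x 2) x"
      using less.IH[of 2] m by (simp add: eval_nat_numeral)
    have IHm: "cj (?x m) y = ?x (Suc m)" using less.IH m by simp
    have IHSm: "cj (?x (Suc m)) y = cj (?x (Suc m)) x"
      using less.IH[of "Suc m"] m by (simp add: xseq_Suc)
    have n: "?x n = cj (?x (Suc m)) (?x 2)"
    proof -
      have "?x n = cj (cj (?x m) y) x" unfolding IHm using m by (simp add: xseq_Suc)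
      also have "\<dots> = cj (cj (?x m) x) (cj y x)" by (rule cj_cj_swap)
      finally show ?thesis using m by (simp add: xseq_Suc eval_nat_numeral)
    qed
    have "cj (?x n) y = cj (cj (?x (Suc m)) y) (cj (?x 2) y)"
      unfolding n by (rule cj_cj_swap)
    also have "\<dots> = cj (?x n) x"
      unfolding IH2 IHSm n by (rule cj_cj_swap [symmetric])
    finally show ?thesis using m by (simp add: xseq_Suc)
  qed
qed

lemma xseq_conj:
  assumes "F_pair x y" "i < n"
  shows "cj (xseq x y n) (xseq x y i) = xseq x y (Suc n)"
  using assms(2)
proof (induction i arbitrary: n)
  case 0
  then show ?case by (simp add: xseq_Suc)
next
  case (Suc i)
  show ?case
  proof (cases "i = 0")
    case True
    then show ?thesis using xseq_conj_1[OF assms(1), of n] Suc.prems by simp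
  next
    case False
    obtain m where m: "n = Suc m" "i < m" using Suc.prems by (cases n) auto
    have "cj (xseq x y n) (xseq x y (Suc i)) = cj (cj (xseq x y m) (xseq x y i)) x"
      using m False by (simp add: xseq_Suc cj_cj_swap[symmetric])
    then show ?thesis using Suc.IH[OF m(2)] m by (simp add: xseq_Suc)
  qed
qed

lemma xseq_swap:
  assumes "F_pair x y" "i < n"
  shows "xseq x y n + xseq x y i = xseq x y i + xseq x y (Suc n)"
  using add_eq_add_cj[of "xseq x y n" "xseq x y i"] xseq_conj[OF assms] by simp

text \<open>Coinciding \<open>x\<^sub>k\<close> and \<open>x\<^sub>k\<^sub>+\<^sub>t\<close> act in the same way on \<open>x\<^sub>k\<^sub>+\<^sub>t\<close>; this forces \<open>x\<^sub>k\<^sub>+\<^sub>t\<^sub>+\<^sub>1 = x\<^sub>k\<^sub>+\<^sub>t\<close>, which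
descends to \<open>x\<^sub>2 = x\<^sub>1\<close> by conjugation with \<open>x\<^sub>0\<inverse>\<close>.\<close>

lemma xseq_repeat_imp_commute:
  assumes "F_pair x y" "k > 0" "t > 0" "xseq x y (k + t) = xseq x y k"
  shows "x + y = y + x"
proof -
  have down: "x + y = y + x" if "xseq x y (Suc (Suc n)) = xseq x y (Suc n)" for n
    using that
  proof (induction n)
    case 0
    then show ?case by (simp add: cj_eq_self_iff)
  next
    case (Suc n)
    then show ?case by (metis cj_inject xseq.simps(3))
  qed
  have "xseq x y (Suc (k + t)) = cj (xseq x y (k + t)) (xseq x y k)"
    using xseq_conj[OF assms(1), of k "k + t"] assms by simp
  also have "\<dots> = xseq x y (k + t)" using assms(4) by simp
  finally show ?thesis using down[of "k + t - 1"] assms by simp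
qed

text \<open>Values of positive words in the generators \<open>x\<^sub>n\<close>. Every element of the group is a quotient of two of them
(\<open>gen2_fraction\<close>).\<close>

definition pos :: "'a::group_add \<Rightarrow> 'a \<Rightarrow> nat list \<Rightarrow> 'a" where
  "pos x y P = sum_list (map (xseq x y) P)"

lemma pos_simps [simp]:
  "pos x y [] = 0" "pos x y (k # P) = xseq x y k + pos x y P"
  "pos x y (P @ Q) = pos x y P + pos x y Q"
  by (simp_all add: pos_def)

lemma cj_pos:
  assumes "F_pair x y" "\<forall>k\<in>set P. i < k"
  shows "cj (pos x y P) (xseq x y i) = pos x y (map Suc P)"
  using assms(2) by (induction P) (simp_all add: cj_add xseq_conj[OF assms(1)])

lemma cj_replicate: "cj (xseq x y i) (pos x y (replicate a i)) = xseq x y i"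
  by (induction a) (simp_all flip: cj_cj)

lemma cj_xseq_replicate:
  assumes "F_pair x y" "i < k"
  shows "cj (xseq x y k) (pos x y (replicate a i)) = xseq x y (k + a)"
  using assms(2)
proof (induction a arbitrary: k)
  case (Suc a)
  then show ?case
    by (simp add: xseq_conj[OF assms(1)] Suc.IH[of "Suc k"] flip: cj_cj)
qed simp

text \<open>Letters of least index can be moved to the front at the cost of raising the indices of the letters that they pass.
The last two conclusions are the bookkeeping for the induction in \<open>inj_on_F\<close>.\<close>

lemma pos_pull_out:
  assumes "F_pair x y" "\<forall>k\<in>set P. i \<le> k"
  shows "\<exists>a P'. pos x y P = pos x y (replicate a i @ P') \<and> (\<forall>k\<in>set P'. i < k) \<and>
           a + length P' = length P \<and> (i \<in> set P \<longrightarrow> a > 0)"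
  using assms(2)
proof (induction P)
  case Nil
  then show ?case by (intro exI[of _ 0] exI[of _ "[]"]) simp
next
  case (Cons k P)
  then obtain a P' where IH: "pos x y P = pos x y (replicate a i @ P')" "\<forall>k\<in>set P'. i < k"
     "a + length P' = length P" "i \<in> set P \<longrightarrow> a > 0" by auto
  show ?case
  proof (cases "k = i")
    case True
    then show ?thesis using IH
      by (intro exI[of _ "Suc a"] exI[of _ P']) simp
  next
    case False
    then have "i < k" using Cons.prems by auto
    then have "xseq x y k + pos x y (replicate a i) = pos x y (replicate a i) + xseq x y (k + a)"
      using cj_xseq_replicate[OF assms(1), of i k a] add_eq_add_cj by metis
    then have "pos x y (k # P) = pos x y (replicate a i @ ((k + a) # P'))"
      using IH(1) by (simp add: add.assoc [symmetric])
    then show ?thesis using IH \<open>i < k\<close> False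
      by (intro exI[of _ a] exI[of _ "(k + a) # P'"]) simp
  qed
qed

text \<open>If \<open>x\<close> and \<open>y\<close> do not commute, then no positive power of \<open>x\<^sub>i\<close> lies in the subgroup generated by the later generators. The reason is that
conjugations by different early generators shift the later ones in the same way: for
\<open>i = 0\<close> this makes \<open>x\<^sub>0\<^sup>a\<close> commute with \<open>x\<^sub>1\<close>, for \<open>i = 1\<close> it gives \<open>x\<^sub>1\<^sup>a = x\<^sub>2\<^sup>a\<close>, and in both cases
two generators coincide. Larger \<open>i\<close> reduce to smaller ones by conjugation with \<open>x\<^sub>0\<inverse>\<close>.\<close>

lemma no_power_in_tail:
  assumes F: "F_pair x y" and "a > 0"
    and "\<forall>k\<in>set P. i < k" "\<forall>k\<in>set Q. i < k"
    and "pos x y (replicate a i) + pos x y P = pos x y Q"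
  shows "x + y = y + x"
  using assms(3-5)
proof (induction i arbitrary: P Q rule: less_induct)
  case (less i)
  let ?x = "xseq x y"
  let ?g = "pos x y (replicate a i)"
  have gQP: "?g = pos x y Q + - pos x y P"
    using less.prems(3) by (metis add.assoc add.right_neutral right_minus)
  have shift: "cj (pos x y Q' + - pos x y P') (?x j) = pos x y (map Suc Q') + - pos x y (map Suc P')"
    if "\<forall>k\<in>set P'. j < k" "\<forall>k\<in>set Q'. j < k" for P' Q' j
    using that by (simp add: cj_add cj_minus cj_pos[OF F])
  have gi: "cj ?g (?x i) = ?g"
    by (induction a) (simp_all add: cj_add)
  consider "i = 0" | "i = 1" | j where "i = Suc (Suc j)" by (metis One_nat_def not0_implies_Suc)
  then show ?case
  proof cases
    case 1
    define P1 Q1 where "P1 = map Suc P" and "Q1 = map Suc Q"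
    have g1: "?g = pos x y Q1 + - pos x y P1"
      using gi shift[of P i Q] less.prems gQP by (simp add: P1_def Q1_def)
    have "cj ?g (?x 1) = cj ?g (?x 0)"
      unfolding g1 using less.prems 1 by (subst (1 2) shift) (auto simp: P1_def Q1_def)
    then have "cj ?g y = ?g" using gi 1 by simp
    then have "cj y ?g = y" by (simp add: cj_eq_self_iff)
    then have "?x (1 + a) = ?x 1" using cj_xseq_replicate[OF F, of i 1 a] 1 by simp
    then show ?thesis using xseq_repeat_imp_commute[OF F, of 1 a] \<open>a > 0\<close> by simp
  next
    case 2
    have "cj ?g (?x 1) = cj ?g (?x 0)"
      unfolding gQP using less.prems 2 by (subst (1 2) shift) auto
    then have g: "?g = cj ?g x" using gi 2 by simp
    also have "\<dots> = pos x y (replicate a 2)"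
      using cj_pos[OF F, of "replicate a 1" 0] 2 by (simp add: eval_nat_numeral)
    finally have "?x (2 + a) = cj (?x 2) (pos x y (replicate a 2))"
      using cj_xseq_replicate[OF F, of i 2 a] 2 by simp
    also have "\<dots> = ?x 2" by (simp add: cj_replicate)
    finally show ?thesis using xseq_repeat_imp_commute[OF F, of 2 a] \<open>a > 0\<close> by simp
  next
    case 3
    define P' Q' where "P' = map (\<lambda>k. k - 1) P" and "Q' = map (\<lambda>k. k - 1) Q"
    have PQ: "P = map Suc P'" "Q = map Suc Q'"
      using less.prems 3 by (auto simp: P'_def Q'_def intro!: map_idI[symmetric])
    have gt: "\<forall>k\<in>set P'. Suc j < k" "\<forall>k\<in>set Q'. Suc j < k"
      using less.prems 3 by (auto simp: PQ)
    have conjs: "cj (pos x y R) x = pos x y (map Suc R)" if "\<forall>k\<in>set R. 0 < k" for R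
      using cj_pos[OF F, of R 0] that by simp
    have "cj (pos x y (replicate a (Suc j)) + pos x y P') x = cj (pos x y Q') x"
      using less.prems(3) gt
      unfolding cj_add 3 PQ by (subst (1 2 3) conjs) auto
    then show ?thesis using less.IH[of "Suc j" P' Q'] 3 gt by simp
  qed
qed

text \<open>The subgroup generated by \<open>x\<close> and \<open>y\<close>. Letters are added on the left only, as in the recursion for words; closure
under the group operations is derived in \<open>homeo_group_gen2\<close>.\<close>

inductive_set gen2 :: "'a::group_add \<Rightarrow> 'a \<Rightarrow> 'a set" for x y where
  gen2_0: "0 \<in> gen2 x y"
| gen2_x: "w \<in> gen2 x y \<Longrightarrow> x + w \<in> gen2 x y"
| gen2_y: "w \<in> gen2 x y \<Longrightarrow> y + w \<in> gen2 x y"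
| gen2_mx: "w \<in> gen2 x y \<Longrightarrow> - x + w \<in> gen2 x y"
| gen2_my: "w \<in> gen2 x y \<Longrightarrow> - y + w \<in> gen2 x y"

lemma minus_add_swap:
  fixes a :: "'a::group_add"
  assumes "a + b = b + c" shows "- b + a = c + - b"
proof -
  have "- b + (a + b) + - b = - b + (b + c) + - b" using assms by simp
  then show ?thesis by (simp add: add.assoc)
qed

lemma minus_add_swap':
  fixes a :: "'a::group_add"
  assumes "a + b = b + c" shows "- a + b = b + - c"
proof -
  have "- a + (a + b) + - c = - a + (b + c) + - c" using assms by simp
  then show ?thesis by (simp add: add.assoc)
qed

lemma minus_xseq_pos:
  assumes F: "F_pair x y"
  shows "\<exists>P' Q'. - xseq x y i + pos x y P = pos x y P' + - pos x y Q'"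
proof (induction P arbitrary: i)
  case Nil
  show ?case by (intro exI[of _ "[]"] exI[of _ "[i]"]) simp
next
  case (Cons k P)
  let ?x = "xseq x y"
  consider "k = i" | "k > i" | "k < i" by linarith
  then show ?case
  proof cases
    case 1
    then show ?thesis by (intro exI[of _ P] exI[of _ "[]"]) simp
  next
    case 2
    have *: "- ?x i + ?x k = ?x (Suc k) + - ?x i"
      using minus_add_swap[OF xseq_swap[OF F 2]] .
    obtain P' Q' where "- ?x i + pos x y P = pos x y P' + - pos x y Q'" using Cons by blast
    then have "- ?x i + pos x y (k # P) = pos x y (Suc k # P') + - pos x y Q'"
      using * by (simp add: add.assoc [symmetric]) (simp add: add.assoc)
    then show ?thesis by blast
  next
    case 3
    have *: "- ?x i + ?x k = ?x k + - ?x (Suc i)"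
      using minus_add_swap'[OF xseq_swap[OF F 3]] .
    obtain P' Q' where "- ?x (Suc i) + pos x y P = pos x y P' + - pos x y Q'" using Cons by blast
    then have "- ?x i + pos x y (k # P) = pos x y (k # P') + - pos x y Q'"
      using * by (simp add: add.assoc [symmetric]) (simp add: add.assoc)
    then show ?thesis by blast
  qed
qed

lemma gen2_fraction:
  assumes F: "F_pair x y" and "w \<in> gen2 x y"
  shows "\<exists>P Q. w = pos x y P + - pos x y Q"
proof -
  have plus: "\<exists>P' Q'. xseq x y i + (pos x y P + - pos x y Q) = pos x y P' + - pos x y Q'" for i P Q
    by (intro exI[of _ "i # P"] exI[of _ Q]) (simp add: add.assoc)
  have minus: "\<exists>P' Q'. - xseq x y i + (pos x y P + - pos x y Q) = pos x y P' + - pos x y Q'" for i P Q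
  proof -
    obtain P' Q' where "- xseq x y i + pos x y P = pos x y P' + - pos x y Q'"
      using minus_xseq_pos[OF F] by blast
    then have "- xseq x y i + (pos x y P + - pos x y Q) = pos x y P' + - pos x y (Q @ Q')"
      by (simp add: add.assoc [symmetric] minus_add) 
    then show ?thesis by blast
  qed
  from assms(2) show ?thesis
  proof (induction rule: gen2.induct)
    case gen2_0
    show ?case by (intro exI[of _ "[]"]) simp
  next
    case (gen2_x w) then show ?case using plus[of 0] by auto
  next
    case (gen2_y w) then show ?case using plus[of 1] by auto
  next
    case (gen2_mx w) then show ?case using minus[of 0] by auto
  next
    case (gen2_my w) then show ?case using minus[of 1] by auto
  qed
qed

locale additive_hom =
  fixes \<theta> :: "'b::group_add \<Rightarrow> 'a::group_add"
  assumes add: "\<theta> (u + v) = \<theta> u + \<theta> v"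
begin

lemma zero: "\<theta> 0 = 0"
  using add[of 0 0] by (metis add.right_neutral add_left_imp_eq)

lemma minus: "\<theta> (- u) = - \<theta> u"
  using add[of "- u" u] by (simp add: zero minus_unique eq_neg_iff_add_eq_0)

lemma cj: "\<theta> (cj u v) = cj (\<theta> u) (\<theta> v)"
  by (simp add: cj_def add minus)

lemma F_pair: "F_pair u v \<Longrightarrow> F_pair (\<theta> u) (\<theta> v)"
  unfolding F_pair_def by (metis cj add)

lemma xseq: "\<theta> (xseq u v n) = xseq (\<theta> u) (\<theta> v) n"
  by (induction u v n rule: xseq.induct) (simp_all add: cj)

lemma pos: "\<theta> (pos u v P) = pos (\<theta> u) (\<theta> v) P"
  by (induction P) (simp_all add: zero add xseq)

end

text \<open>Every proper quotient of \<open>F\<close> is abelian. Write \<open>w\<close> as a quotient of positive words \<open>P\<close> and \<open>Q\<close> with equal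
images. Let \<open>i\<close> be the least index that occurs. If only one of the two words contains it, then a power of \<open>x\<^sub>i\<close> lies
in the tail of the image, which is impossible by \<open>no_power_in_tail\<close>; otherwise a common first letter
can be cancelled.\<close>

lemma (in additive_hom) inj_on_F:
  assumes F: "F_pair u v" and nc: "\<theta> u + \<theta> v \<noteq> \<theta> v + \<theta> u"
    and w: "w \<in> gen2 u v" "\<theta> w = 0"
  shows "w = 0"
proof -
  note F' = F_pair[OF F]
  have key: "pos u v P = pos u v Q" if "\<theta> (pos u v P) = \<theta> (pos u v Q)" for P Q
    using that
  proof (induction "length P + length Q" arbitrary: P Q rule: less_induct)
    case less
    show ?case
    proof (cases "P = [] \<and> Q = []")
      case False
      define i where "i = Min (set P \<union> set Q)"
      have i: "i \<in> set P \<union> set Q" "\<forall>k\<in>set P. i \<le> k" "\<forall>k\<in>set Q. i \<le> k"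
        using False unfolding i_def by (intro Min_in) auto
      obtain a P' where P: "pos u v P = pos u v (replicate a i @ P')" "\<forall>k\<in>set P'. i < k"
        "a + length P' = length P" "i \<in> set P \<longrightarrow> a > 0"
        using pos_pull_out[OF F i(2)] by blast
      obtain b Q' where Q: "pos u v Q = pos u v (replicate b i @ Q')" "\<forall>k\<in>set Q'. i < k"
        "b + length Q' = length Q" "i \<in> set Q \<longrightarrow> b > 0"
        using pos_pull_out[OF F i(3)] by blast
      have eq: "pos (\<theta> u) (\<theta> v) (replicate a i @ P') = pos (\<theta> u) (\<theta> v) (replicate b i @ Q')"
        using less.prems P(1) Q(1) by (simp only: pos)
      have ab: "a > 0" "b > 0"
        using i(1) P(4) Q(4) nc no_power_in_tail[OF F', of a P' i Q'] no_power_in_tail[OF F', of b Q' i P']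
          P(2) Q(2) eq
        by (cases "a = 0"; cases "b = 0"; force)+
      then obtain a' b' where ab': "a = Suc a'" "b = Suc b'" by (metis gr0_implies_Suc)
      have "pos u v (replicate a' i @ P') = pos u v (replicate b' i @ Q')"
        using less.hyps[of "replicate a' i @ P'" "replicate b' i @ Q'"] eq P(3) Q(3) ab'
        by (simp add: pos add add.assoc)
      then show ?thesis using P(1) Q(1) ab' by (simp add: add.assoc)
    qed simp
  qed
  obtain P Q where PQ: "w = pos u v P + - pos u v Q" using gen2_fraction[OF F w(1)] by blast
  then have "\<theta> (pos u v P) = \<theta> (pos u v Q)"
    using w(2) by (simp add: add minus eq_neg_iff_add_eq_0 [symmetric])
  then show ?thesis using key[of P Q] PQ by simp
qed

section \<open>A copy of \<open>F\<close> inside its commutator subgroup\<close>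

text \<open>The elements \<open>x\<^sub>1x\<^sub>3\<inverse>\<close> and \<open>x\<^sub>2x\<^sub>3\<inverse>\<close> again satisfy the relations of \<open>F\<close>. In the usual model of \<open>F\<close> they generate a
copy of \<open>F\<close> on a smaller interval. Each of them is a commutator (\<open>shrink_comm\<close>).\<close>

definition shrink0 :: "'a::group_add \<Rightarrow> 'a \<Rightarrow> 'a" where
  "shrink0 x y = y + - xseq x y 3"
definition shrink1 :: "'a::group_add \<Rightarrow> 'a \<Rightarrow> 'a" where
  "shrink1 x y = xseq x y 2 + - xseq x y 3"

definition comm :: "'a::group_add \<Rightarrow> 'a \<Rightarrow> 'a" where
  "comm a b = - a + cj a b"

lemma shrink_comm:
  "shrink0 x y = comm (- y) (x + x)" "shrink1 x y = comm (- cj y x) x"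
  by (simp_all add: shrink0_def shrink1_def comm_def cj_minus eval_nat_numeral cj_cj)

lemma shrink_F_pair:
  assumes F: "F_pair x y"
  shows "F_pair (shrink0 x y) (shrink1 x y)"
proof -
  let ?x = "xseq x y"
  let ?g = "?x 1 + - ?x 2" let ?k = "?x 2 + - ?x 3"
  \<comment> \<open>The subgroup generated by \<open>x\<^sub>3, x\<^sub>4, \<dots>\<close>. Conjugation by \<open>x\<^sub>1\<close> and by \<open>x\<^sub>2\<close> shifts all its generators
    by one, so \<open>g = x\<^sub>1x\<^sub>2\<inverse>\<close> centralises it; both relations for the pair \<open>(gk, k)\<close> say that \<open>g\<close> commutes with
    an element of it.\<close>
  define T where "T = {w. \<exists>P Q. w = pos x y P + - pos x y Q \<and> (\<forall>k\<in>set P \<union> set Q. k \<ge> 3)}"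
  have shift: "cj (pos x y P + - pos x y Q) (?x i) = pos x y (map Suc P) + - pos x y (map Suc Q)"
    if "\<forall>k\<in>set P \<union> set Q. i < k" for P Q i
    using that by (simp add: cj_add cj_minus cj_pos[OF F])
  have g: "cj w ?g = w" if wT: "w \<in> T" for w
  proof -
    obtain P Q where w: "w = pos x y P + - pos x y Q" "\<forall>k\<in>set P \<union> set Q. k \<ge> 3"
      using wT unfolding T_def by auto
    have "1 < k \<and> 2 < k" if "k \<in> set P \<union> set Q" for k
      using bspec[OF w(2) that] by linarith
    then have "cj w (?x 1) = cj w (?x 2)"
      unfolding w(1) using shift[of P Q 1] shift[of P Q 2] by metis
    then show ?thesis unfolding cj_eq_cj_iff cj_eq_self_iff .
  qed
  have sh0: "shrink0 x y = ?g + ?k" and sh1: "shrink1 x y = ?k"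
    by (simp_all add: shrink0_def shrink1_def add.assoc)
  have x3: "?x 3 = cj (?x 2) (?x 1)" using xseq_conj[OF F, of 1 2] by (simp add: eval_nat_numeral)
  have x4: "?x 4 = cj (?x 3) (?x 1)" using xseq_conj[OF F, of 1 3] by (simp add: eval_nat_numeral)
  have x45: "?x 5 = cj (?x 4) (?x 2)" using xseq_conj[OF F, of 2 4] by (simp add: eval_nat_numeral)
  have c1: "cj ?k (?g + ?k) = ?x 3 + ?x 3 + - ?x 4 + - ?x 3"
  proof -
    have "cj ?k (?x 1) = ?x 3 + - ?x 4" by (simp only: cj_add cj_minus x3 x4)
    then have "cj ?k (?x 1 + - ?x 3) = cj (?x 3 + - ?x 4) (- ?x 3)" by (simp only: cj_cj [symmetric])
    moreover have "?g + ?k = ?x 1 + - ?x 3" by (simp add: add.assoc)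
    ultimately show ?thesis by (simp add: cj_def add.assoc)
  qed
  have T1: "cj ?k (?g + ?k) \<in> T"
    unfolding T_def c1
    by (rule CollectI, intro exI[of _ "[3,3]"] exI[of _ "[3,4]"]) (simp add: add.assoc minus_add)
  have "cj (cj ?k (?g + ?k)) (?g + ?k) = cj (?x 3 + ?x 3 + - ?x 4 + - ?x 3) ?k"
    by (metis T1 c1 cj_cj g)
  also have "\<dots> = cj (?x 4 + ?x 4 + - ?x 5 + - ?x 4) (- ?x 3)"
  proof -
    have a: "cj (?x 3) (?x 2) = ?x 4" "cj (?x 4) (?x 2) = ?x 5"
      using xseq_conj[OF F, of 2 3] xseq_conj[OF F, of 2 4] by (simp_all add: eval_nat_numeral)
    show ?thesis by (simp only: cj_cj [symmetric] cj_add cj_minus a)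
  qed
  finally have T2: "cj (cj ?k (?g + ?k)) (?g + ?k) \<in> T"
    unfolding T_def
    by (intro CollectI, intro exI[of _ "[3,4,4]"] exI[of _ "[3,4,5]"])
       (simp add: cj_def add.assoc minus_add)
  have rel: "cj w (?g + ?k) = cj w ?k" if "w \<in> T" for w
    using g[OF that] by (simp only: cj_cj [symmetric])
  show ?thesis
    unfolding F_pair_def sh0 sh1
    using rel[OF T1] rel[OF T2] by (simp only: cj_cj [symmetric])
qed

lemma shrink_noncommute:
  assumes F: "F_pair x y" and c: "shrink0 x y + shrink1 x y = shrink1 x y + shrink0 x y"
  shows "x + y = y + x"
proof -
  let ?x = "xseq x y"
  have a: "- ?x 3 + ?x 2 = ?x 2 + - ?x 4" and b: "- ?x 3 + ?x 1 = ?x 1 + - ?x 4"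
    using minus_add_swap'[OF xseq_swap[OF F, of 2 3]] minus_add_swap'[OF xseq_swap[OF F, of 1 3]]
    by simp_all
  have "?x 1 + (- ?x 3 + ?x 2) + - ?x 3 = ?x 2 + (- ?x 3 + ?x 1) + - ?x 3"
    using c by (simp add: shrink0_def shrink1_def add.assoc)
  then have "?x 1 + ?x 2 = ?x 2 + ?x 1"
    unfolding a b by (simp add: add.assoc [symmetric])
  then have "cj (?x 2) (?x 1) = ?x 2" by (simp add: cj_eq_self_iff)
  then have "?x 3 = ?x 2" using xseq_conj[OF F, of 1 2] by (simp add: eval_nat_numeral)
  then show ?thesis using xseq_repeat_imp_commute[OF F, of 2 1] by simp
qed

section \<open>Increasing homeomorphisms of the line\<close>

typedef homeo = "{f :: real \<Rightarrow> real. strict_mono f \<and> surj f}"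
  morphisms app Homeo
  by (rule exI[of _ id]) (simp add: strict_mono_def)

lemma app_less [simp]: "app f x < app f y \<longleftrightarrow> x < y"
  using app[of f] by (simp add: strict_mono_less)

lemma app_le [simp]: "app f x \<le> app f y \<longleftrightarrow> x \<le> y"
  using app[of f] by (simp add: strict_mono_less_eq)

lemma app_eq [simp]: "app f x = app f y \<longleftrightarrow> x = y"
  using app[of f] by (simp add: strict_mono_eq)

lemma homeo_eqI: "(\<And>x. app f x = app g x) \<Longrightarrow> f = g"
  by (metis app_inject ext)

lemma app_Homeo: "strict_mono f \<Longrightarrow> surj f \<Longrightarrow> app (Homeo f) = f"
  by (simp add: Homeo_inverse)

instantiation homeo :: group_add
begin

definition "0 = Homeo id"
definition "f + g = Homeo (app g \<circ> app f)"
definition "- f = Homeo (inv_into UNIV (app f))"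
definition "f - g = f + - (g :: homeo)"

lemma app_0 [simp]: "app 0 x = x"
  unfolding zero_homeo_def by (subst app_Homeo) (simp_all add: strict_mono_def)

lemma app_add [simp]: "app (f + g) x = app g (app f x)"
  unfolding plus_homeo_def
  using app[of f] app[of g]
  by (subst app_Homeo) (auto simp: strict_mono_def surj_def, metis)

lemma app_uminus: "app (- f) = inv_into UNIV (app f)"
  unfolding uminus_homeo_def
proof (rule app_Homeo)
  have f: "surj (app f)" using app[of f] by simp
  show "surj (inv_into UNIV (app f))" using app[of f] by (simp add: bij_betw_def strict_mono_imp_inj_on bij_imp_bij_inv[unfolded bij_betw_def])
  show "strict_mono (inv_into UNIV (app f))"
    by (rule strict_monoI) (metis app_less f surj_f_inv_f)
qed

lemma app_uminus_app [simp]: "app (- f) (app f x) = x"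
  unfolding app_uminus by (simp add: inj_def)

lemma app_app_uminus [simp]: "app f (app (- f) x) = x"
  unfolding app_uminus using app[of f] by (simp add: surj_f_inv_f)

instance
  by standard (auto intro!: homeo_eqI simp: minus_homeo_def)

end

lemma app_uminus_eq_iff: "app (- f) x = y \<longleftrightarrow> app f y = x"
  by (metis app_uminus_app app_app_uminus)

lemma app_uminus_less_iff: "app (- f) x < y \<longleftrightarrow> x < app f y"
  by (metis app_less app_app_uminus)

lemma less_app_uminus_iff: "y < app (- f) x \<longleftrightarrow> app f y < x"
  by (metis app_less app_app_uminus)

lemma app_cj: "app (cj u v) x = app v (app u (app (- v) x))"
  by (simp add: cj_def)

primrec nmul :: "nat \<Rightarrow> 'a::group_add \<Rightarrow> 'a" where
  "nmul 0 f = 0"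
| "nmul (Suc n) f = f + nmul n f"

lemma nmul_Suc_right: "nmul (Suc n) f = nmul n f + f"
proof (induction n)
  case (Suc n)
  have "nmul (Suc (Suc n)) f = f + nmul (Suc n) f" by (rule nmul.simps)
  also have "\<dots> = nmul (Suc n) f + f" by (subst Suc) (simp add: add.assoc)
  finally show ?case .
qed simp

lemma cj_nmul: "cj (nmul n f) g = nmul n (cj f g)"
  by (induction n) (simp_all add: cj_add)

lemma app_nmul_fix: "app u x = x \<Longrightarrow> app (nmul n u) x = x"
  by (induction n) simp_all

lemma app_nmul_ge: "app u m \<ge> m \<Longrightarrow> app (nmul n u) m \<ge> m"
proof (induction n)
  case (Suc n)
  have "app (nmul n u) m \<le> app (nmul n u) (app u m)" using Suc.prems by simp
  then show ?case using Suc by (simp del: app_le)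
qed simp

text \<open>An orbit that does not get close to \<open>r\<close> would converge to a fixed point of \<open>u\<close> in \<open>[d, r)\<close>.\<close>

lemma escape:
  assumes up: "\<forall>x\<in>{d..<r}. app u x > x" and r: "app u r = r" and x: "d \<le> x" "x < r" and y: "y < r"
  shows "\<exists>N. \<forall>n\<ge>N. app (nmul n u) x > y"
proof -
  let ?s = "\<lambda>n. app (nmul n u) x"
  have lt: "?s n < r" for n using x(2) app_nmul_fix[OF r] by (metis app_less)
  have ge: "?s n \<ge> x" for n using up x by (intro app_nmul_ge) (auto intro: less_imp_le)
  have step: "?s (Suc n) = app u (?s n)" for n by (simp only: nmul_Suc_right app_add)
  have "?s n \<le> ?s (Suc n)" for n
    unfolding step using up lt[of n] ge[of n] x by (simp add: less_imp_le)
  then have mono: "incseq ?s" by (rule incseq_SucI)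
  have "\<exists>N. ?s N > y"
  proof (rule ccontr)
    assume "\<not> ?thesis"
    then have le: "?s n \<le> y" for n by (simp add: not_less)
    have bdd: "bdd_above (range ?s)" by (rule bdd_aboveI2) (rule le)
    define L where "L = Sup (range ?s)"
    have "?s n \<le> L" for n unfolding L_def by (rule cSUP_upper[OF _ bdd]) simp
    moreover have "L \<le> y" unfolding L_def by (rule cSUP_least) (auto simp: le)
    ultimately have L: "d \<le> L" "L < r" using ge[of 0] x y by (smt (verit))+
    then have "app (- u) L < L" using up by (simp add: app_uminus_less_iff)
    then obtain n where "app (- u) L < ?s n"
      unfolding L_def using less_cSUP_iff[OF _ bdd] by auto
    then have "L < ?s (Suc n)" unfolding step by (simp add: app_uminus_less_iff)
    with \<open>?s (Suc n) \<le> L\<close> show False by simp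
  qed
  then obtain N where "?s N > y" by blast
  then have "\<forall>n\<ge>N. ?s n > y" using mono by (meson incseqD less_le_trans)
  then show ?thesis by blast
qed

lemma disjoint_supports_commute:
  fixes u v :: homeo
  assumes "\<And>x. app u x = x \<or> app v x = x"
  shows "u + v = v + u"
proof (rule homeo_eqI)
  fix x
  have "app u (app v x) = app v x \<or> app v x = x" using assms[of "app v x"] by auto
  moreover have "app v (app u x) = app u x \<or> app u x = x" using assms[of "app u x"] by auto
  ultimately show "app (u + v) x = app (v + u) x" using assms[of x] by auto
qed

definition supp_in :: "real \<Rightarrow> real \<Rightarrow> homeo \<Rightarrow> bool" where
  "supp_in j k u \<longleftrightarrow> (\<forall>x. app u x \<noteq> x \<longrightarrow> j \<le> x \<and> x \<le> k)"

lemma supp_in_add: "supp_in j k u \<Longrightarrow> supp_in j k v \<Longrightarrow> supp_in j k (u + v)"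
  unfolding supp_in_def by (metis app_add)

lemma supp_in_minus: "supp_in j k u \<Longrightarrow> supp_in j k (- u)"
  unfolding supp_in_def by (metis app_uminus_eq_iff)

lemma supp_in_cj: "supp_in j k u \<Longrightarrow> supp_in (app v j) (app v k) (cj u v)"
  unfolding supp_in_def app_cj by (metis app_app_uminus app_le)

lemma supp_in_disjoint_commute:
  assumes "supp_in j k u" "supp_in j' k' v" "k < j' \<or> k' < j"
  shows "u + v = v + u"
  using assms by (intro disjoint_supports_commute) (auto simp: supp_in_def; fastforce)

text \<open>Put \<open>g = u\<^sup>n\<close> and let \<open>h\<close> be its conjugate by \<open>b\<close>. They agree above some point \<open>e'\<close> that does not
depend on \<open>n\<close>, and \<open>h\<close> is trivial below \<open>b c > d\<close>. As soon as \<open>u\<^sup>n\<close> moves \<open>b c\<close> beyond \<open>e'\<close>, the support of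
\<open>gh\<inverse>\<close> lies below \<open>e'\<close> and the supports of the conjugates of \<open>h\<close> by \<open>g\<close> and \<open>g\<^sup>2\<close> lie above it; both
relations of \<open>F\<close> say that such elements commute.\<close>

lemma two_chain_F_pair:
  fixes u b :: homeo
  assumes low: "\<forall>x\<le>c. app u x = x"
    and up: "\<forall>x\<in>{d..<r}. app u x > x" and high: "\<forall>x\<ge>r. app u x = x"
    and b: "app b r = r" "d < app b c" "c < r"
    and germ: "\<forall>x\<in>{e..<r}. app (u + b) x = app (b + u) x" "e < r"
    and dr: "d < r"
  shows "\<exists>N. \<forall>n\<ge>N. F_pair (nmul n u) (cj (nmul n u) b) \<and>
           nmul n u + cj (nmul n u) b \<noteq> cj (nmul n u) b + nmul n u"
proof -
  define c' where "c' = app b c"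
  \<comment> \<open>The conjugate of \<open>u\<close> by \<open>b\<close> agrees with \<open>u\<close> above \<open>b e\<close>; the maximum with \<open>d\<close> makes \<open>[e', r)\<close> invariant under \<open>u\<close>.\<close>
  define e' where "e' = max (app b e) d"
  define v where "v = cj u b"
  have c': "d < c'" "c' < r" using b by (auto simp: c'_def) (metis app_less b(1))
  have e': "d \<le> e'" "e' < r" using germ(2) b(1) dr by (auto simp: e'_def) (metis app_less)
  have ur: "app u r = r" using high by simp
  have v_low: "app v x = x" if "x \<le> c'" for x
  proof -
    have "app (- b) x \<le> c" using that unfolding c'_def by (metis app_le app_app_uminus)
    then show ?thesis using low by (simp add: v_def app_cj)
  qed
  have v_eq: "app v x = app u x" if "x \<ge> e'" for x
  proof (cases "x < r")
    case True
    have "app (- b) x < r" using True b(1) by (metis app_less app_app_uminus)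
    moreover have "e \<le> app (- b) x" using that unfolding e'_def by (metis app_le app_app_uminus max.bounded_iff)
    ultimately have "app (u + b) (app (- b) x) = app (b + u) (app (- b) x)" using germ by auto
    then show ?thesis by (simp add: v_def app_cj)
  next
    case False
    then have "app (- b) x \<ge> r" using b(1) by (metis app_le app_app_uminus not_less)
    then show ?thesis using high False by (simp add: v_def app_cj)
  qed
  have nv_eq: "app (nmul n v) x = app (nmul n u) x" if "x \<ge> e'" for n x
    using that
  proof (induction n arbitrary: x)
    case (Suc n)
    have "app u x \<ge> x" using up high Suc.prems e' by (cases "x < r") (auto intro: less_imp_le)
    then show ?case using Suc by (simp add: v_eq)
  qed simp
  obtain N where N: "\<forall>n\<ge>N. app (nmul n u) c' > e'"
    using escape[OF up ur, of c' e'] c' e' by auto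
  have "F_pair (nmul n u) (cj (nmul n u) b) \<and>
           nmul n u + cj (nmul n u) b \<noteq> cj (nmul n u) b + nmul n u" if n: "n \<ge> max N 1" for n
  proof -
    define g h where "g = nmul n u" and "h = cj (nmul n u) b"
    have h: "h = nmul n v" by (simp add: h_def v_def cj_nmul)
    have gc': "app g c' > e'" using N n by (simp add: g_def)
    have g_up: "app g x > x" if "x \<in> {d..<r}" for x
    proof -
      obtain m where m: "n = Suc m" using n by (cases n) auto
      have "app u x > x" using up that by auto
      moreover have "app (nmul m u) x \<ge> x" using calculation by (intro app_nmul_ge) simp
      ultimately show ?thesis unfolding g_def m by simp (meson app_less le_less_trans)
    qed
    have s: "app (g + - h) x = x" if "x \<ge> e'" for x
      using nv_eq[OF that, of n] by (simp add: g_def h app_uminus_eq_iff)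
    have h_low: "app h x = x" if "x \<le> c'" for x
      unfolding h using v_low[OF that] by (rule app_nmul_fix)
    have k: "app (cj h g) x = x" if "x \<le> app g c'" for x
    proof -
      have "app (- g) x \<le> c'" using that by (metis app_le app_app_uminus)
      then show ?thesis by (simp add: app_cj h_low)
    qed
    have gr: "app g r = r" unfolding g_def by (rule app_nmul_fix[OF ur])
    have "app g c' < r" using c'(2) gr by (metis app_less)
    then have "app g (app g c') > app g c'" by (simp add: g_up c'(1) c'(2) less_imp_le)
    then have gg: "app g (app g c') \<ge> e'" using gc' by linarith
    have kk: "app (cj (cj h g) g) x = x" if "x \<le> app g (app g c')" for x
    proof -
      have "app (- g) x \<le> app g c'" using that by (metis app_le app_app_uminus)
      then have "app (cj h g) (app (- g) x) = app (- g) x" by (rule k)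
      then show ?thesis by (simp add: app_cj[of "cj h g"])
    qed
    have 1: "cj h g + (g + - h) = (g + - h) + cj h g"
    proof (rule disjoint_supports_commute)
      fix x show "app (cj h g) x = x \<or> app (g + - h) x = x"
        using k[of x] s[of x] gc' by linarith
    qed
    have 2: "cj (cj h g) g + (g + - h) = (g + - h) + cj (cj h g) g"
    proof (rule disjoint_supports_commute)
      fix x show "app (cj (cj h g) g) x = x \<or> app (g + - h) x = x"
        using kk[of x] s[of x] gg by linarith
    qed
    have F: "F_pair g h"
      using iffD2[OF cj_eq_cj_iff 1] iffD2[OF cj_eq_cj_iff 2]
      unfolding F_pair_def cj_cj add.assoc by blast
    have "g + h \<noteq> h + g"
    proof
      assume "g + h = h + g"
      then have "cj h g = h" by (simp add: cj_eq_self_iff)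
      then have "app h e' = e'" using k[of e'] gc' by simp
      moreover have "app h e' = app g e'" using nv_eq[of e' n] by (simp add: h g_def)
      ultimately show False using g_up[of e'] e' by simp
    qed
    with F show ?thesis by (simp add: g_def h_def)
  qed
  then show ?thesis by blast
qed

section \<open>Actions on orbitals and simultaneous movement\<close>

text \<open>Reflection exchanges the two ends of an orbital, so that statements about left ends follow
from those about right ends.\<close>

definition flip :: "homeo \<Rightarrow> homeo" where
  "flip u = Homeo (\<lambda>x. - app u (- x))"

lemma app_flip [simp]: "app (flip u) x = - app u (- x)"
proof -
  have "surj (\<lambda>x. - app u (- x))"
    by (rule surjI[of _ "\<lambda>y. - app (- u) (- y)"]) simp
  then show ?thesis
    unfolding flip_def by (subst app_Homeo) (simp_all add: strict_mono_def)
qed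

lemma flip_add: "flip (u + v) = flip u + flip v"
  by (rule homeo_eqI) simp

lemma flip_flip [simp]: "flip (flip u) = u"
  by (rule homeo_eqI) simp

text \<open>An action \<open>(\<rho>, l, r)\<close> describes how a group of homeomorphisms acts on an orbital \<open>(l, r)\<close>. The map \<open>\<rho>\<close> is the
restriction to the orbital or, for the mirror image, the restriction followed by a reflection. Movements are
always directed to the right end \<open>hi\<close>; the choice between an action and its mirror image
is the choice of an end of the orbital.\<close>

type_synonym action = "(homeo \<Rightarrow> homeo) \<times> real \<times> real"

definition rep :: "action \<Rightarrow> homeo \<Rightarrow> homeo" where "rep t = fst t"
definition lo :: "action \<Rightarrow> real" where "lo t = fst (snd t)"
definition hi :: "action \<Rightarrow> real" where "hi t = snd (snd t)"

abbreviation ivl :: "action \<Rightarrow> real set" where "ivl t \<equiv> {lo t<..<hi t}"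

definition mirror :: "action \<Rightarrow> action" where
  "mirror t = (\<lambda>g. flip (rep t g), - hi t, - lo t)"

lemma mirror_simps [simp]:
  "rep (mirror t) g = flip (rep t g)" "lo (mirror t) = - hi t" "hi (mirror t) = - lo t"
  by (simp_all add: mirror_def rep_def lo_def hi_def)

lemma mirror_mirror [simp]: "mirror (mirror t) = t"
proof -
  have "mirror (mirror t) = (\<lambda>g. rep t g, lo t, hi t)"
    unfolding mirror_def[of "mirror t"] by simp
  then show ?thesis by (simp add: rep_def lo_def hi_def)
qed

text \<open>The following three predicates describe the behaviour at the right end; that at the left end
is expressed through \<open>mirror\<close>.\<close>

definition attracts :: "homeo \<Rightarrow> action \<Rightarrow> bool" where
  "attracts f t \<longleftrightarrow> (\<exists>d\<in>ivl t. \<forall>x\<in>{d..<hi t}. app (rep t f) x > x)"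

definition repels :: "homeo \<Rightarrow> action \<Rightarrow> bool" where
  "repels f t \<longleftrightarrow> (\<exists>d\<in>ivl t. \<forall>x\<in>{d..<hi t}. app (rep t f) x < x)"

definition neutral :: "homeo \<Rightarrow> action \<Rightarrow> bool" where
  "neutral f t \<longleftrightarrow> (\<exists>d\<in>ivl t. \<forall>x\<in>{d..<hi t}. app (rep t f) x = x)"

text \<open>Forward iterates of \<open>f\<close> keep a point away from the left end.\<close>

definition no_descent :: "homeo \<Rightarrow> action \<Rightarrow> bool" where
  "no_descent f t \<longleftrightarrow> (\<forall>x\<in>ivl t. \<exists>m\<in>ivl t. m \<le> x \<and> m \<le> app (rep t f) m)"

lemma not_neut: assumes "attracts f t \<or> repels f t" shows "\<not> neutral f t"
proof
  assume "neutral f t"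
  then obtain d where d: "d \<in> ivl t" "\<forall>x\<in>{d..<hi t}. app (rep t f) x = x"
    by (auto simp: neutral_def)
  obtain e where e: "e \<in> ivl t" "\<forall>x\<in>{e..<hi t}. app (rep t f) x \<noteq> x"
    using assms unfolding attracts_def repels_def by (metis less_irrefl)
  have "max d e \<in> {d..<hi t}" "max d e \<in> {e..<hi t}" using d e by auto
  then show False using d e by blast
qed

lemma no_descentI:
  assumes "neutral f (mirror t) \<or> repels f (mirror t)"
  shows "no_descent f t"
  unfolding no_descent_def
proof
  fix x assume x: "x \<in> ivl t"
  obtain d where d: "d \<in> ivl (mirror t)"
    "\<forall>y\<in>{d..<hi (mirror t)}. app (rep (mirror t) f) y \<le> y"
    using assms unfolding neutral_def repels_def by (metis less_imp_le order_refl)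
  define m where "m = min x (- d)"
  have "- m \<in> {d..<hi (mirror t)}" using x d by (auto simp: m_def)
  with d have "app (rep (mirror t) f) (- m) \<le> - m" by blast
  then have "m \<le> app (rep t f) m" by simp
  moreover have "m \<in> ivl t" "m \<le> x" using x d by (auto simp: m_def)
  ultimately show "\<exists>m\<in>ivl t. m \<le> x \<and> m \<le> app (rep t f) m" by blast
qed

locale homeo_group =
  fixes G :: "homeo set"
  assumes G_0 [simp, intro]: "0 \<in> G"
    and G_add [simp, intro]: "u \<in> G \<Longrightarrow> v \<in> G \<Longrightarrow> u + v \<in> G"
    and G_minus [simp, intro]: "u \<in> G \<Longrightarrow> - u \<in> G"
begin

lemma G_cj [simp, intro]: "u \<in> G \<Longrightarrow> v \<in> G \<Longrightarrow> cj u v \<in> G"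
  by (simp add: cj_def)

lemma G_comm [simp, intro]: "u \<in> G \<Longrightarrow> v \<in> G \<Longrightarrow> comm u v \<in> G"
  by (simp add: comm_def)

lemma G_nmul [simp, intro]: "u \<in> G \<Longrightarrow> nmul n u \<in> G"
  by (induction n) auto

text \<open>The last two conditions say that the germs at each of the two ends form an abelian group. Piecewise linearity enters
the dynamical part of the proof through them, through the trichotomy of the behaviour at an end, and through the
finiteness of the number of orbitals.\<close>

definition orbital_action :: "action \<Rightarrow> bool" where
  "orbital_action t \<longleftrightarrow> lo t < hi t \<and>
     (\<forall>u\<in>G. \<forall>v\<in>G. rep t (u + v) = rep t u + rep t v) \<and>
     (\<forall>u\<in>G. \<forall>x. x \<notin> ivl t \<longrightarrow> app (rep t u) x = x) \<and>
     (\<forall>x\<in>ivl t. \<forall>y\<in>ivl t. \<exists>u\<in>G. app (rep t u) x > y) \<and>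
     (\<forall>u\<in>G. \<forall>v\<in>G. \<exists>q\<in>ivl t. \<forall>x\<in>{q..<hi t}. app (rep t (u + v)) x = app (rep t (v + u)) x) \<and>
     (\<forall>u\<in>G. \<forall>v\<in>G. \<exists>q\<in>ivl t. \<forall>x\<in>{lo t<..q}. app (rep t (u + v)) x = app (rep t (v + u)) x)"

lemma act_ivl: "orbital_action t \<Longrightarrow> lo t < hi t"
  by (simp add: orbital_action_def)

lemma rep_add: "orbital_action t \<Longrightarrow> u \<in> G \<Longrightarrow> v \<in> G \<Longrightarrow> rep t (u + v) = rep t u + rep t v"
  by (simp add: orbital_action_def)

lemma rep_0: "orbital_action t \<Longrightarrow> rep t 0 = 0"
  using rep_add[of t 0 0] by (metis G_0 add.right_neutral add_left_imp_eq)

lemma rep_minus: "orbital_action t \<Longrightarrow> u \<in> G \<Longrightarrow> rep t (- u) = - rep t u"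
  using rep_add[of t "- u" u] by (simp add: rep_0 eq_neg_iff_add_eq_0)

lemma rep_cj: "orbital_action t \<Longrightarrow> u \<in> G \<Longrightarrow> v \<in> G \<Longrightarrow> rep t (cj u v) = cj (rep t u) (rep t v)"
  by (simp add: cj_def rep_add rep_minus)

lemma rep_comm: "orbital_action t \<Longrightarrow> u \<in> G \<Longrightarrow> v \<in> G \<Longrightarrow> rep t (comm u v) = comm (rep t u) (rep t v)"
  by (simp add: comm_def rep_add rep_minus rep_cj)

lemma rep_nmul: "orbital_action t \<Longrightarrow> u \<in> G \<Longrightarrow> rep t (nmul n u) = nmul n (rep t u)"
  by (induction n) (simp_all add: rep_0 rep_add)

lemmas rep_simps = rep_0 rep_add rep_minus rep_cj rep_comm rep_nmul

lemma rep_outside: "orbital_action t \<Longrightarrow> u \<in> G \<Longrightarrow> x \<notin> ivl t \<Longrightarrow> app (rep t u) x = x"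
  by (simp add: orbital_action_def)

lemma rep_ivl: 
  assumes "orbital_action t" "u \<in> G"
  shows "app (rep t u) x \<in> ivl t \<longleftrightarrow> x \<in> ivl t"
proof -
  have "app (rep t u) (lo t) = lo t" "app (rep t u) (hi t) = hi t"
    using rep_outside[OF assms] by auto
  then show ?thesis by (metis app_less greaterThanLessThan_iff)
qed

lemma act_trans:
  assumes "orbital_action t" "x \<in> ivl t" "y \<in> ivl t"
  shows "\<exists>u\<in>G. app (rep t u) x > y"
  using assms by (simp add: orbital_action_def)

lemma act_mirror:
  assumes t: "orbital_action t"
  shows "orbital_action (mirror t)"
  unfolding orbital_action_def
proof (intro conjI ballI allI impI)
  show "lo (mirror t) < hi (mirror t)" using act_ivl[OF t] by simp
next
  fix u v assume "u \<in> G" "v \<in> G"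
  then show "rep (mirror t) (u + v) = rep (mirror t) u + rep (mirror t) v"
    using t by (simp add: rep_add flip_add)
next
  fix u x assume "u \<in> G" "x \<notin> ivl (mirror t)"
  then show "app (rep (mirror t) u) x = x" 
    using rep_outside[OF t, of u "- x"] by auto
next
  fix x y assume "x \<in> ivl (mirror t)" "y \<in> ivl (mirror t)"
  then obtain u where "u \<in> G" "app (rep t u) (- y) > - x"
    using act_trans[OF t, of "- y" "- x"] by auto
  then show "\<exists>u\<in>G. y < app (rep (mirror t) u) x"
    using app_uminus_less_iff[of "rep t u" "- x" "- y"]
    by (intro bexI[of _ "- u"]) (simp_all add: rep_minus[OF t])
next
  fix u v assume "u \<in> G" "v \<in> G"
  then obtain q where "q \<in> ivl t" "\<forall>x\<in>{lo t<..q}. app (rep t (u + v)) x = app (rep t (v + u)) x"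
    using t unfolding orbital_action_def by meson
  then show "\<exists>q\<in>ivl (mirror t). \<forall>x\<in>{q..<hi (mirror t)}.
    app (rep (mirror t) (u + v)) x = app (rep (mirror t) (v + u)) x"
    by (intro bexI[of _ "- q"]) auto
next
  fix u v assume "u \<in> G" "v \<in> G"
  then obtain q where "q \<in> ivl t" "\<forall>x\<in>{q..<hi t}. app (rep t (u + v)) x = app (rep t (v + u)) x"
    using t unfolding orbital_action_def by meson
  then show "\<exists>q\<in>ivl (mirror t). \<forall>x\<in>{lo (mirror t)<..q}.
    app (rep (mirror t) (u + v)) x = app (rep (mirror t) (v + u)) x"
    by (intro bexI[of _ "- q"]) auto
qed

definition compact_supp :: "action \<Rightarrow> homeo \<Rightarrow> bool" where
  "compact_supp t u \<longleftrightarrow> (\<exists>j\<in>ivl t. \<exists>k\<in>ivl t. supp_in j k (rep t u))"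

text \<open>Near the right end the germs of \<open>u\<close> and \<open>v\<close> commute.\<close>

lemma comm_neutral:
  assumes t: "orbital_action t" and uv: "u \<in> G" "v \<in> G"
  shows "\<exists>q\<in>ivl t. \<forall>x\<ge>q. app (rep t (comm u v)) x = x"
proof -
  obtain q where q: "q \<in> ivl t" "\<forall>x\<in>{q..<hi t}. app (rep t (u + v)) x = app (rep t (v + u)) x"
    using t uv unfolding orbital_action_def by meson
  define q' where "q' = app (rep t (v + u)) q"
  have "app (rep t (comm u v)) x = x" if x: "x \<ge> q'" for x
  proof (cases "x < hi t")
    case True
    define y where "y = app (- rep t (v + u)) x"
    have xy: "x = app (rep t (v + u)) y" by (simp add: y_def)
    have "q \<le> y" using x unfolding q'_def xy by simp
    moreover have "y < hi t"
      using True rep_outside[OF t, of "v + u" "hi t"] uv unfolding xy by (metis app_less G_add greaterThanLessThan_iff less_irrefl)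
    ultimately have "app (rep t (u + v)) y = x" using q unfolding xy by simp
    moreover have "comm u v = - (v + u) + (u + v)"
      by (simp add: comm_def cj_def minus_add add.assoc)
    ultimately show ?thesis using uv y_def by (simp only: rep_simps[OF t] G_add G_minus app_add)
  next
    case False
    then show ?thesis using rep_outside[OF t, of "comm u v" x] uv by simp
  qed
  moreover have "q' \<in> ivl t" using rep_ivl[OF t, of "v + u" q] q uv by (simp add: q'_def)
  ultimately show ?thesis by blast
qed

lemma csupp_comm:
  assumes t: "orbital_action t" and uv: "u \<in> G" "v \<in> G"
  shows "compact_supp t (comm u v)"
proof -
  obtain k where k: "k \<in> ivl t" "\<forall>x\<ge>k. app (rep t (comm u v)) x = x"
    using comm_neutral[OF assms] by blast
  obtain j where j: "j \<in> ivl (mirror t)" "\<forall>x\<ge>j. app (rep (mirror t) (comm u v)) x = x"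
    using comm_neutral[OF act_mirror[OF t] uv] by blast
  have "supp_in (- j) k (rep t (comm u v))"
    unfolding supp_in_def
  proof (intro allI impI)
    fix x assume "app (rep t (comm u v)) x \<noteq> x"
    then have "\<not> - x \<ge> j" "\<not> x \<ge> k" using k j(2)[rule_format, of "- x"] by auto
    then show "- j \<le> x \<and> x \<le> k" by auto
  qed
  then show ?thesis using k j unfolding compact_supp_def by (intro bexI[of _ "- j"] bexI[of _ k]) auto
qed

definition good :: "action set \<Rightarrow> (action \<Rightarrow> real) \<Rightarrow> (action \<Rightarrow> real) \<Rightarrow> homeo \<Rightarrow> bool" where
  "good P p q \<theta> \<longleftrightarrow> \<theta> \<in> G \<and> (\<forall>t\<in>P. app (rep t \<theta>) (p t) > q t)"

definition on_ivl :: "action set \<Rightarrow> (action \<Rightarrow> real) \<Rightarrow> bool" where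
  "on_ivl P p \<longleftrightarrow> (\<forall>t\<in>P. p t \<in> ivl t)"

text \<open>A substitute for independence of the actions in \<open>P\<close>, which may well be conjugate to each other: a single element of
the group can still move points of all orbitals arbitrarily close to the right ends.\<close>

definition simultaneous :: "action set \<Rightarrow> bool" where
  "simultaneous P \<longleftrightarrow> (\<forall>p q. on_ivl P p \<and> on_ivl P q \<longrightarrow> (\<exists>\<theta>. good P p q \<theta>))"

lemma simultaneous_empty: "simultaneous {}"
  by (auto simp: simultaneous_def good_def)

lemma simultaneous_single: "orbital_action t \<Longrightarrow> simultaneous {t}"
  using act_trans[of t] unfolding simultaneous_def good_def on_ivl_def by blast

text \<open>First move the points of the orbitals in \<open>P\<close> into the region where \<open>f\<close> attracts to the right end, and then
apply a high power of \<open>f\<close>. In the orbitals of \<open>Q\<close> the points stay above a bound that does not depend on the power; so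
an element \<open>g\<close> that moves these bounds beyond the targets can be chosen before the power. If
the power is high enough, then \<open>g\<close> does not spoil what was achieved in \<open>P\<close>.\<close>

lemma simultaneous_union:
  assumes P: "finite P" "\<forall>t\<in>P. orbital_action t" "simultaneous P" "\<forall>t\<in>P. attracts f t"
    and Q: "\<forall>t\<in>Q. orbital_action t" "simultaneous Q" "\<forall>t\<in>Q. no_descent f t"
    and f: "f \<in> G"
  shows "simultaneous (P \<union> Q)"
  unfolding simultaneous_def
proof (intro allI impI)
  fix p q assume pq: "on_ivl (P \<union> Q) p \<and> on_ivl (P \<union> Q) q"
  have "\<forall>t\<in>P. \<exists>d. d \<in> ivl t \<and> (\<forall>x\<in>{d..<hi t}. app (rep t f) x > x)"
    using P(4) unfolding attracts_def by blast
  then obtain d where d: "\<forall>t\<in>P. d t \<in> ivl t \<and> (\<forall>x\<in>{d t..<hi t}. app (rep t f) x > x)"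
    by (elim bchoice[elim_format] exE)
  obtain \<theta> where \<theta>: "good P p d \<theta>"
    using P(3) d pq unfolding simultaneous_def on_ivl_def by blast
  have \<theta>G: "\<theta> \<in> G" using \<theta> by (simp add: good_def)
  have "\<forall>t\<in>Q. \<exists>m. m \<in> ivl t \<and> m \<le> app (rep t \<theta>) (p t) \<and> m \<le> app (rep t f) m"
  proof
    fix t assume t: "t \<in> Q"
    then have "app (rep t \<theta>) (p t) \<in> ivl t"
      using rep_ivl[of t \<theta>] Q(1) \<theta>G pq by (simp add: on_ivl_def)
    then show "\<exists>m. m \<in> ivl t \<and> m \<le> app (rep t \<theta>) (p t) \<and> m \<le> app (rep t f) m"
      using Q(3) t unfolding no_descent_def by blast
  qed
  then obtain m where m: "\<forall>t\<in>Q. m t \<in> ivl t \<and> m t \<le> app (rep t \<theta>) (p t) \<and> m t \<le> app (rep t f) (m t)"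
    by (elim bchoice[elim_format] exE)
  obtain g where g: "good Q m q g"
    using Q(2) m pq unfolding simultaneous_def on_ivl_def by blast
  have gG: "g \<in> G" using g by (simp add: good_def)
  have "\<forall>\<^sub>F n in sequentially. \<forall>t\<in>P. app (nmul n (rep t f)) (app (rep t \<theta>) (p t)) > app (- rep t g) (q t)"
  proof (intro eventually_ball_finite P(1) ballI)
    fix t assume t: "t \<in> P"
    then have a: "orbital_action t" using P(2) by blast
    have "app (rep t \<theta>) (p t) \<in> ivl t" using rep_ivl[OF a \<theta>G] pq t by (simp add: on_ivl_def)
    moreover have "app (- rep t g) (q t) \<in> ivl t"
      using rep_ivl[OF a, of "- g" "q t"] gG pq t by (simp add: on_ivl_def rep_simps[OF a])
    moreover have "app (rep t \<theta>) (p t) > d t" using \<theta> t by (simp add: good_def)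
    ultimately show "\<forall>\<^sub>F n in sequentially. app (nmul n (rep t f)) (app (rep t \<theta>) (p t)) > app (- rep t g) (q t)"
      unfolding eventually_sequentially
      using d t rep_outside[OF a f, of "hi t"] by (intro escape[of "d t" "hi t"]) auto
  qed
  then obtain n where n: "\<forall>t\<in>P. app (nmul n (rep t f)) (app (rep t \<theta>) (p t)) > app (- rep t g) (q t)"
    by (auto simp: eventually_sequentially)
  have "good (P \<union> Q) p q (\<theta> + nmul n f + g)"
    unfolding good_def
  proof (intro conjI ballI)
    show "\<theta> + nmul n f + g \<in> G" using \<theta>G gG f by simp
    fix t assume "t \<in> P \<union> Q"
    then consider "t \<in> P" | "t \<in> Q" by blast
    then show "app (rep t (\<theta> + nmul n f + g)) (p t) > q t"
    proof cases
      case 1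
      then have a: "orbital_action t" using P(2) by blast
      show ?thesis
        using n 1 \<theta>G gG f by (simp add: rep_simps[OF a] app_uminus_less_iff)
    next
      case 2
      then have a: "orbital_action t" using Q(1) by blast
      have "m t \<le> app (nmul n (rep t f)) (m t)" using m 2 by (intro app_nmul_ge) auto
      also have "\<dots> \<le> app (nmul n (rep t f)) (app (rep t \<theta>) (p t))" using m 2 by simp
      finally have "app (rep t g) (m t) \<le> app (rep t g) \<dots>" by simp
      moreover have "app (rep t g) (m t) > q t" using g 2 by (simp add: good_def)
      ultimately show ?thesis using \<theta>G gG f by (simp add: rep_simps[OF a] del: app_le)
    qed
  qed
  then show "\<exists>\<theta>. good (P \<union> Q) p q \<theta>" by blast
qed

lemma simultaneous_all_attracts:
  assumes "finite P" "\<forall>t\<in>P. orbital_action t" "\<forall>t\<in>P. attracts f t" "\<forall>t\<in>P. no_descent f t" "f \<in> G"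
  shows "simultaneous P"
  using assms
proof (induction P rule: finite_induct)
  case (insert t P)
  have "simultaneous (P \<union> {t})"
    using insert by (intro simultaneous_union[of _ f] simultaneous_single) auto
  then show ?case by simp
qed (simp add: simultaneous_empty)

text \<open>A uniform bound for one new orbital is enough, because transitivity on that orbital allows
preceding and following the movement by fixed elements of the group.\<close>

lemma simultaneous_insertI:
  assumes t: "orbital_action t" and x: "x \<in> ivl t" and m: "m \<in> ivl t" and P: "\<forall>s\<in>P. orbital_action s"
    and H: "\<And>p q. on_ivl P p \<Longrightarrow> on_ivl P q \<Longrightarrow> \<exists>\<theta>. good P p q \<theta> \<and> app (rep t \<theta>) x \<ge> m"
  shows "simultaneous (insert t P)"
  unfolding simultaneous_def
proof (intro allI impI)
  fix p q assume pq: "on_ivl (insert t P) p \<and> on_ivl (insert t P) q"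
  obtain u where u: "u \<in> G" "app (rep t u) (p t) > x"
    using act_trans[OF t, of "p t" x] pq x by (auto simp: on_ivl_def)
  obtain v where v: "v \<in> G" "app (rep t v) m > q t"
    using act_trans[OF t, of m "q t"] pq m by (auto simp: on_ivl_def)
  have "on_ivl P (\<lambda>s. app (rep s u) (p s))" "on_ivl P (\<lambda>s. app (rep s (- v)) (q s))"
    using pq u v P rep_ivl unfolding on_ivl_def by simp_all
  then obtain \<theta> where \<theta>: "good P (\<lambda>s. app (rep s u) (p s)) (\<lambda>s. app (rep s (- v)) (q s)) \<theta>"
     "app (rep t \<theta>) x \<ge> m" using H by blast
  have \<theta>G: "\<theta> \<in> G" using \<theta> by (simp add: good_def)
  have "good (insert t P) p q (u + \<theta> + v)"
    unfolding good_def
  proof (intro conjI ballI)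
    show "u + \<theta> + v \<in> G" using \<theta>G u v by simp
    fix s assume "s \<in> insert t P"
    then consider "s = t" | "s \<in> P" by blast
    then show "app (rep s (u + \<theta> + v)) (p s) > q s"
    proof cases
      case 1
      have "app (rep t \<theta>) x < app (rep t \<theta>) (app (rep t u) (p t))" using u by simp
      then have "m \<le> app (rep t \<theta>) (app (rep t u) (p t))" using \<theta>(2) by linarith
      then have "app (rep t v) m \<le> app (rep t v) (app (rep t \<theta>) (app (rep t u) (p t)))" by simp
      then show ?thesis using v u \<theta>G 1 by (simp add: rep_simps[OF t] del: app_le)
    next
      case 2
      then have a: "orbital_action s" using P by blast
      have "app (rep s (- v)) (q s) < app (rep s \<theta>) (app (rep s u) (p s))"
        using \<theta>(1) 2 by (simp add: good_def)
      then show ?thesis using v u \<theta>G by (simp add: rep_simps[OF a] app_uminus_less_iff)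
    qed
  qed
  then show "\<exists>\<theta>. good (insert t P) p q \<theta>" by blast
qed

lemma good_mono:
  assumes "good P p q \<theta>" "\<forall>t\<in>P. p t \<le> p' t \<and> q' t \<le> q t"
  shows "good P p' q' \<theta>"
  using assms unfolding good_def by (meson app_le le_less_trans less_le_trans)

lemma good_mirror:
  assumes P: "\<forall>t\<in>P. orbital_action t"
    and g: "good P (\<lambda>s. - q (mirror s)) (\<lambda>s. - p (mirror s)) \<theta>"
  shows "good (mirror ` P) p q (- \<theta>)"
proof -
  have G: "\<theta> \<in> G" using g by (simp add: good_def)
  have "app (rep (mirror s) (- \<theta>)) (p (mirror s)) > q (mirror s)" if s: "s \<in> P" for s
  proof -
    have a: "orbital_action s" using P s by blast
    have "app (rep s \<theta>) (- q (mirror s)) > - p (mirror s)" using g s by (simp add: good_def)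
    then have "app (- rep s \<theta>) (- p (mirror s)) < - q (mirror s)" by (simp add: app_uminus_less_iff)
    then show ?thesis using G by (simp add: rep_simps[OF a])
  qed
  then show ?thesis using G by (simp add: good_def)
qed

text \<open>In each orbital one can choose an end such that points can be moved towards all chosen ends simultaneously. For
a new orbital \<open>t\<close>, suppose that neither of its ends can be added to the previous choice \<open>P\<close>. Then the elements that are good
for \<open>P\<close> move some \<open>x\<close> down and some \<open>y > x\<close> up, so their inverses, which are good for the opposite ends of the
orbitals in \<open>P\<close>, do not move \<open>x\<close> down. This allows adding \<open>t\<close> to the opposite choice.\<close>

lemma simultaneous_oriented:
  assumes "finite Z" "\<forall>t\<in>Z. orbital_action t"
  shows "\<exists>P. simultaneous P \<and> P \<subseteq> Z \<union> mirror ` Z \<and> Z \<subseteq> P \<union> mirror ` P"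
  using assms
proof (induction Z rule: finite_induct)
  case empty
  then show ?case using simultaneous_empty by blast
next
  case (insert t Z)
  then obtain P where P: "simultaneous P" "P \<subseteq> Z \<union> mirror ` Z" "Z \<subseteq> P \<union> mirror ` P" by auto
  have t: "orbital_action t" using insert by simp
  have aP: "\<forall>s\<in>P. orbital_action s" using P(2) insert.prems act_mirror by auto
  have "simultaneous (insert t P) \<or> simultaneous (insert (mirror t) P) \<or> simultaneous (insert t (mirror ` P))"
  proof (rule ccontr)
    assume neg: "\<not> ?thesis"
    define x where "x = (lo t + hi t) / 2"
    have x: "x \<in> ivl t" using act_ivl[OF t] by (simp add: x_def)
    define y where "y = (x + hi t) / 2"
    have y: "y \<in> ivl t" "x < y" using x by (auto simp: y_def)
    obtain p q where pq: "on_ivl P p" "on_ivl P q"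
      "\<And>\<theta>. good P p q \<theta> \<Longrightarrow> app (rep t \<theta>) x < x"
      using simultaneous_insertI[OF t x x aP] neg by (meson not_le)
    have my: "- y \<in> ivl (mirror t)" using y by simp
    have "\<not> simultaneous (insert (mirror t) P)" using neg by blast
    then obtain p' q' where pq': "on_ivl P p'" "on_ivl P q'"
      "\<And>\<theta>. good P p' q' \<theta> \<Longrightarrow> \<not> app (rep (mirror t) \<theta>) (- y) \<ge> - y"
      using simultaneous_insertI[OF act_mirror[OF t] my my aP] by meson
    have "simultaneous (insert t (mirror ` P))"
    proof (rule simultaneous_insertI[OF t x x])
      show "\<forall>s\<in>mirror ` P. orbital_action s" using aP act_mirror by auto
      fix p0 q0 assume pq0: "on_ivl (mirror ` P) p0" "on_ivl (mirror ` P) q0"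
      define p1 where "p1 = (\<lambda>s. min (- q0 (mirror s)) (min (p s) (p' s)))"
      define q1 where "q1 = (\<lambda>s. max (- p0 (mirror s)) (max (q s) (q' s)))"
      have "on_ivl P p1" "on_ivl P q1"
        using pq pq' pq0 unfolding on_ivl_def p1_def q1_def by (auto simp: min_def max_def)
      then obtain \<theta> where \<theta>: "good P p1 q1 \<theta>" using P(1) unfolding simultaneous_def by blast
      have G: "\<theta> \<in> G" using \<theta> by (simp add: good_def)
      have "good P p q \<theta>" "good P p' q' \<theta>"
        by (rule good_mono[OF \<theta>], auto simp: p1_def q1_def min_le_iff_disj le_max_iff_disj)+
      then have 1: "app (rep t \<theta>) x < x" "app (rep t \<theta>) y > y" using pq(3)[of \<theta>] pq'(3)[of \<theta>] by auto
      have "good P (\<lambda>s. - q0 (mirror s)) (\<lambda>s. - p0 (mirror s)) \<theta>"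
        by (rule good_mono[OF \<theta>]) (simp add: p1_def q1_def)
      then have "good (mirror ` P) p0 q0 (- \<theta>)" by (rule good_mirror[OF aP])
      moreover have "app (rep t (- \<theta>)) x \<ge> x"
        using 1 G by (simp add: rep_simps[OF t] less_app_uminus_iff less_imp_le)
      ultimately show "\<exists>\<theta>. good (mirror ` P) p0 q0 \<theta> \<and> x \<le> app (rep t \<theta>) x" by blast
    qed
    then show False using neg by blast
  qed
  moreover have "mirror ` mirror ` P = P" by (force simp: image_iff)
  ultimately show ?case
  proof (elim disjE)
    assume "simultaneous (insert t P)"
    then show ?thesis using P by (intro exI[of _ "insert t P"]) auto
  next
    assume "simultaneous (insert (mirror t) P)"
    then show ?thesis using P by (intro exI[of _ "insert (mirror t) P"]) auto
  next
    assume "simultaneous (insert t (mirror ` P))"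
    moreover have "mirror ` P \<subseteq> Z \<union> mirror ` Z" using P(2) by force
    ultimately show ?thesis using P(3) \<open>mirror ` mirror ` P = P\<close>
      by (intro exI[of _ "insert t (mirror ` P)"]) auto
  qed
qed

end

section \<open>Removing the obstructions on the other orbitals\<close>

lemma supp_in_mono: "supp_in j k u \<Longrightarrow> j' \<le> j \<Longrightarrow> k \<le> k' \<Longrightarrow> supp_in j' k' u"
  unfolding supp_in_def by fastforce

lemma comm_eq_0_iff: "comm a b = 0 \<longleftrightarrow> a + b = b + a"
proof -
  have "comm a b = 0 \<longleftrightarrow> a + comm a b = a" by (metis add.right_neutral add_left_imp_eq)
  then show ?thesis by (simp add: comm_def cj_eq_self_iff)
qed

lemma additive_flip: "additive_hom flip"
  by standard (rule flip_add)

lemma F_pair_flip [simp]: "F_pair (flip u) (flip v) \<longleftrightarrow> F_pair u v"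
  by (metis additive_flip additive_hom.F_pair flip_flip)

lemma F_pair_0: "F_pair 0 (0 :: 'a::group_add)"
  by (simp add: F_pair_def)

context homeo_group
begin

lemma neut_low:
  assumes t: "orbital_action t" and u: "u \<in> G" and n: "neutral u (mirror t)"
  shows "\<exists>c\<in>ivl t. \<forall>x\<le>c. app (rep t u) x = x"
proof -
  obtain d where d: "d \<in> ivl (mirror t)" "\<forall>y\<in>{d..<hi (mirror t)}. app (rep (mirror t) u) y = y"
    using n by (auto simp: neutral_def)
  have "app (rep t u) x = x" if "x \<le> - d" for x
  proof (cases "x > lo t")
    case True
    then show ?thesis using d(2)[rule_format, of "- x"] that by simp
  next
    case False
    then show ?thesis using rep_outside[OF t u] by auto
  qed
  then show ?thesis using d(1) by (intro bexI[of _ "- d"]) auto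
qed

lemma neut_high:
  assumes t: "orbital_action t" and u: "u \<in> G" and n: "neutral u t"
  shows "\<exists>c\<in>ivl t. \<forall>x\<ge>c. app (rep t u) x = x"
proof -
  obtain c where c: "c \<in> ivl (mirror t)" "\<forall>x\<le>c. app (rep (mirror t) u) x = x"
    using neut_low[OF act_mirror[OF t] u] n by auto
  have "app (rep t u) x = x" if "x \<ge> - c" for x
    using c(2)[rule_format, of "- x"] that by simp
  then show ?thesis using c(1) by (intro bexI[of _ "- c"]) auto
qed

lemma csupp_common:
  assumes "compact_supp t u" "compact_supp t v"
  shows "\<exists>j\<in>ivl t. \<exists>k\<in>ivl t. supp_in j k (rep t u) \<and> supp_in j k (rep t v)"
proof -
  obtain j k j' k' where *: "j \<in> ivl t" "k \<in> ivl t" "supp_in j k (rep t u)"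
    "j' \<in> ivl t" "k' \<in> ivl t" "supp_in j' k' (rep t v)"
    using assms unfolding compact_supp_def by blast
  then have "supp_in (min j j') (max k k') (rep t u)" "supp_in (min j j') (max k k') (rep t v)"
    by (auto elim!: supp_in_mono)
  moreover have "min j j' \<in> ivl t" "max k k' \<in> ivl t" using * by (auto simp: min_def max_def)
  ultimately show ?thesis by blast
qed

end

text \<open>\<open>T\<close> stands for the set of all orbitals of \<open>G\<close>, each in one of its two orientations.\<close>

locale orbital_system = homeo_group +
  fixes f :: homeo and T :: "action set"
  assumes f_in [simp, intro]: "f \<in> G" and finite_T: "finite T"
    and act_T: "t \<in> T \<Longrightarrow> orbital_action t"
    and germ_cases: "t \<in> T \<union> mirror ` T \<Longrightarrow> attracts f t \<or> repels f t \<or> neutral f t"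
    and mirror_notin: "t \<in> T \<Longrightarrow> mirror t \<notin> T"
begin

text \<open>\<open>F_type\<close> and \<open>removable\<close> contain actions in the orientation that the arguments need: \<open>F_type\<close> is oriented such that
\<open>f\<close> attracts to the right end, and \<open>removable\<close> such that \<open>f\<close> approaches the right end.\<close>

definition "oriented = T \<union> mirror ` T"
definition "F_type = {t \<in> oriented. attracts f t \<and> neutral f (mirror t)}"
definition "inert = {t \<in> T. neutral f t \<and> neutral f (mirror t)}"
definition "removable = {t \<in> oriented. repels f t \<or> attracts f t \<and> attracts f (mirror t)}"

lemma act_S: "t \<in> oriented \<Longrightarrow> orbital_action t"
  using act_T act_mirror unfolding oriented_def by blast

lemma finite_S: "finite oriented"
  using finite_T by (simp add: oriented_def)

lemma orbital_types:
  assumes "t \<in> T"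
  shows "t \<in> inert \<or> t \<in> F_type \<or> mirror t \<in> F_type \<or> t \<in> removable \<or> mirror t \<in> removable"
  using germ_cases[of t] germ_cases[of "mirror t"] assms
  by (auto simp: inert_def F_type_def removable_def oriented_def)

lemma F_type_simultaneous: "simultaneous F_type"
  using act_S finite_S
  by (intro simultaneous_all_attracts[of _ f]) (auto simp: F_type_def intro: no_descentI)

text \<open>On inert orbitals \<open>f\<close> has compact support, so \<open>simultaneous_union\<close> combines the movement towards the attracting
ends with that towards the ends provided by \<open>simultaneous_oriented\<close>.\<close>

lemma displacing_element:
  assumes "on_ivl F_type c" "on_ivl F_type d" "on_ivl inert p" "on_ivl inert q"
  shows "\<exists>h\<in>G. (\<forall>t\<in>F_type. app (rep t h) (c t) > d t) \<and>
           (\<forall>t\<in>inert. app (rep t h) (p t) > q t \<or> app (rep t h) (q t) < p t)"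
proof -
  have "finite inert" "\<forall>t\<in>inert. orbital_action t"
    using finite_T act_T by (auto simp: inert_def)
  then obtain P where P: "simultaneous P" "P \<subseteq> inert \<union> mirror ` inert" "inert \<subseteq> P \<union> mirror ` P"
    using simultaneous_oriented by meson
  have neutral: "neutral f t \<and> neutral f (mirror t)" if "t \<in> P" for t
    using that P(2) by (auto simp: inert_def)
  have PS: "P \<subseteq> oriented" using P(2) by (auto simp: inert_def oriented_def)
  have "simultaneous (F_type \<union> P)"
    using act_S finite_S PS neutral P(1)
    by (intro simultaneous_union[of _ f] F_type_simultaneous) (auto simp: F_type_def intro: no_descentI)
  \<comment> \<open>On the mirror image of an inert orbital the endpoints of \<open>[p, q]\<close> appear reflected.\<close>
  define p' where "p' = (\<lambda>t. if t \<in> F_type then c t else if t \<in> inert then p t else - q (mirror t))"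
  define q' where "q' = (\<lambda>t. if t \<in> F_type then d t else if t \<in> inert then q t else - p (mirror t))"
  have "on_ivl (F_type \<union> P) p'" "on_ivl (F_type \<union> P) q'"
    using assms P(2) unfolding on_ivl_def p'_def q'_def by auto
  then obtain h where h: "good (F_type \<union> P) p' q' h"
    using \<open>simultaneous (F_type \<union> P)\<close> unfolding simultaneous_def by blast
  have "app (rep t h) (c t) > d t" if "t \<in> F_type" for t
  proof -
    have "app (rep t h) (p' t) > q' t" using h that by (simp add: good_def)
    then show ?thesis using that by (simp add: p'_def q'_def)
  qed
  moreover have "app (rep t h) (p t) > q t \<or> app (rep t h) (q t) < p t" if t: "t \<in> inert" for t
  proof -
    have not_F: "s \<notin> F_type" if "s \<in> P" for s
      using neutral[OF that] not_neut[of f s] by (auto simp: F_type_def)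
    show ?thesis
    proof (cases "t \<in> P")
      case True
      then have "app (rep t h) (p' t) > q' t" using h by (simp add: good_def)
      then show ?thesis using t not_F[OF True] by (simp add: p'_def q'_def)
    next
      case False
      then have m: "mirror t \<in> P" using P(3) t by auto
      then have "app (rep (mirror t) h) (p' (mirror t)) > q' (mirror t)"
        using h unfolding good_def by blast
      moreover have "mirror t \<notin> inert" using t mirror_notin by (auto simp: inert_def)
      ultimately show ?thesis using not_F[OF m] by (simp add: p'_def q'_def)
    qed
  qed
  ultimately show ?thesis using h unfolding good_def by blast
qed

text \<open>The pair is \<open>f\<^sup>n\<close> and its conjugate by the element \<open>h\<close> of \<open>displacing_element\<close>, with one exponent \<open>n\<close> that is large enough
for all orbitals of \<open>F_type\<close>.\<close>

lemma first_pair: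
  "\<exists>g0\<in>G. \<exists>g1\<in>G. (\<forall>t\<in>F_type. F_pair (rep t g0) (rep t g1) \<and>
       rep t g0 + rep t g1 \<noteq> rep t g1 + rep t g0) \<and>
     (\<forall>t\<in>inert. rep t g0 + rep t g1 = rep t g1 + rep t g0)"
proof -
  have "\<exists>c. c \<in> ivl t \<and> (\<forall>x\<le>c. app (rep t f) x = x)" if "t \<in> F_type" for t
    using neut_low[of t f] act_S that by (auto simp: F_type_def)
  then obtain c where c: "\<And>t. t \<in> F_type \<Longrightarrow> c t \<in> ivl t \<and> (\<forall>x\<le>c t. app (rep t f) x = x)"
    by metis
  have "\<exists>d. d \<in> ivl t \<and> (\<forall>x\<in>{d..<hi t}. app (rep t f) x > x)" if "t \<in> F_type" for t
    using that by (auto simp: F_type_def attracts_def)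
  then obtain d where d: "\<And>t. t \<in> F_type \<Longrightarrow> d t \<in> ivl t \<and> (\<forall>x\<in>{d t..<hi t}. app (rep t f) x > x)"
    by metis
  have "\<exists>p. p \<in> ivl t \<and> (\<forall>x\<le>p. app (rep t f) x = x)" if "t \<in> inert" for t
    using neut_low[of t f] act_T that by (auto simp: inert_def)
  then obtain p where p: "\<And>t. t \<in> inert \<Longrightarrow> p t \<in> ivl t \<and> (\<forall>x\<le>p t. app (rep t f) x = x)"
    by metis
  have "\<exists>q. q \<in> ivl t \<and> (\<forall>x\<ge>q. app (rep t f) x = x)" if "t \<in> inert" for t
    using neut_high[of t f] act_T that by (auto simp: inert_def)
  then obtain q where q: "\<And>t. t \<in> inert \<Longrightarrow> q t \<in> ivl t \<and> (\<forall>x\<ge>q t. app (rep t f) x = x)"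
    by metis
  obtain h where h: "h \<in> G" "\<forall>t\<in>F_type. app (rep t h) (c t) > d t"
     "\<forall>t\<in>inert. app (rep t h) (p t) > q t \<or> app (rep t h) (q t) < p t"
    using displacing_element[of c d p q] c d p q unfolding on_ivl_def by blast
  have F_type: "\<forall>\<^sub>F n in sequentially. \<forall>t\<in>F_type.
      F_pair (nmul n (rep t f)) (cj (nmul n (rep t f)) (rep t h)) \<and>
      nmul n (rep t f) + cj (nmul n (rep t f)) (rep t h) \<noteq> cj (nmul n (rep t f)) (rep t h) + nmul n (rep t f)"
  proof (intro eventually_ball_finite ballI)
    show "finite F_type" using finite_S by (simp add: F_type_def)
    fix t assume t: "t \<in> F_type"
    then have a: "orbital_action t" using act_S by (simp add: F_type_def)
    obtain e where e: "e \<in> ivl t" "\<forall>x\<in>{e..<hi t}. app (rep t (f + h)) x = app (rep t (h + f)) x"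
      using a h(1) unfolding orbital_action_def by (meson f_in)
    show "\<forall>\<^sub>F n in sequentially.
      F_pair (nmul n (rep t f)) (cj (nmul n (rep t f)) (rep t h)) \<and>
      nmul n (rep t f) + cj (nmul n (rep t f)) (rep t h) \<noteq> cj (nmul n (rep t f)) (rep t h) + nmul n (rep t f)"
      unfolding eventually_sequentially
    proof (rule two_chain_F_pair[where c = "c t" and d = "d t" and r = "hi t" and e = e])
      show "\<forall>x\<le>c t. app (rep t f) x = x" "\<forall>x\<in>{d t..<hi t}. app (rep t f) x > x"
        using c d t by auto
      show "\<forall>x\<ge>hi t. app (rep t f) x = x" using rep_outside[OF a f_in] by auto
      show "app (rep t h) (hi t) = hi t" using rep_outside[OF a h(1)] by auto
      show "d t < app (rep t h) (c t)" using h t by blast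
      show "c t < hi t" "d t < hi t" using c d t by auto
      show "e < hi t" using e by simp
      show "\<forall>x\<in>{e..<hi t}. app (rep t f + rep t h) x = app (rep t h + rep t f) x"
        using e h(1) by (simp add: rep_simps[OF a])
    qed
  qed
  then obtain n where n: "\<forall>t\<in>F_type.
      F_pair (nmul n (rep t f)) (cj (nmul n (rep t f)) (rep t h)) \<and>
      nmul n (rep t f) + cj (nmul n (rep t f)) (rep t h) \<noteq> cj (nmul n (rep t f)) (rep t h) + nmul n (rep t f)"
    by (auto simp: eventually_sequentially)
  define g0 where "g0 = nmul n f"
  define g1 where "g1 = cj g0 h"
  have G: "g0 \<in> G" "g1 \<in> G" using h(1) by (simp_all add: g0_def g1_def)
  have rep: "rep t g0 = nmul n (rep t f)" "rep t g1 = cj (rep t g0) (rep t h)" if "orbital_action t" for t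
    using that h(1) G by (simp_all add: g0_def g1_def rep_simps)
  have "F_pair (rep t g0) (rep t g1) \<and> rep t g0 + rep t g1 \<noteq> rep t g1 + rep t g0" if "t \<in> F_type" for t
  proof -
    have "orbital_action t" using act_S that by (simp add: F_type_def)
    then show ?thesis using bspec[OF n that] by (simp only: rep) simp
  qed
  moreover have "rep t g0 + rep t g1 = rep t g1 + rep t g0" if t: "t \<in> inert" for t
  proof -
    have a: "orbital_action t" using act_T t by (simp add: inert_def)
    have "supp_in (p t) (q t) (rep t g0)"
      unfolding supp_in_def rep(1)[OF a] using p[OF t] q[OF t]
      by (metis app_nmul_fix linear)
    moreover from this have "supp_in (app (rep t h) (p t)) (app (rep t h) (q t)) (rep t g1)"
      unfolding rep(2)[OF a] by (rule supp_in_cj)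
    ultimately show ?thesis by (rule supp_in_disjoint_commute) (use h(3) t in auto)
  qed
  ultimately show ?thesis using G by blast
qed

text \<open>The invariant of the process that makes the pair trivial on one removable orbital after the other.\<close>

definition F_pair_trivial_on :: "action set \<Rightarrow> homeo \<Rightarrow> homeo \<Rightarrow> bool" where
  "F_pair_trivial_on A y z \<longleftrightarrow> y \<in> G \<and> z \<in> G \<and> (\<forall>t\<in>oriented. compact_supp t y \<and> compact_supp t z) \<and>
     (\<forall>t\<in>F_type. F_pair (rep t y) (rep t z) \<and> rep t y + rep t z \<noteq> rep t z + rep t y) \<and>
     (\<forall>t\<in>A. rep t y = 0 \<and> rep t z = 0)"

lemma F_pair_trivial_on_inert: "\<exists>y z. F_pair_trivial_on inert y z"
proof -
  obtain g0 g1 where g: "g0 \<in> G" "g1 \<in> G"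
     "\<forall>t\<in>F_type. F_pair (rep t g0) (rep t g1) \<and> rep t g0 + rep t g1 \<noteq> rep t g1 + rep t g0"
     "\<forall>t\<in>inert. rep t g0 + rep t g1 = rep t g1 + rep t g0"
    using first_pair by blast
  have rep: "rep t (shrink0 g0 g1) = shrink0 (rep t g0) (rep t g1)"
    "rep t (shrink1 g0 g1) = shrink1 (rep t g0) (rep t g1)" if "orbital_action t" for t
    using that g by (simp_all add: shrink_comm rep_simps)
  have "F_pair_trivial_on inert (shrink0 g0 g1) (shrink1 g0 g1)"
    unfolding F_pair_trivial_on_def
  proof (intro conjI ballI)
    show "shrink0 g0 g1 \<in> G" "shrink1 g0 g1 \<in> G" using g by (simp_all add: shrink_comm)
    show "compact_supp t (shrink0 g0 g1)" "compact_supp t (shrink1 g0 g1)" if "t \<in> oriented" for t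
      using act_S[OF that] g by (auto simp: shrink_comm intro!: csupp_comm)
  next
    fix t assume t: "t \<in> F_type"
    then have "orbital_action t" using act_S by (simp add: F_type_def)
    then show "F_pair (rep t (shrink0 g0 g1)) (rep t (shrink1 g0 g1))"
      "rep t (shrink0 g0 g1) + rep t (shrink1 g0 g1) \<noteq> rep t (shrink1 g0 g1) + rep t (shrink0 g0 g1)"
      using g(3) t shrink_F_pair shrink_noncommute unfolding rep[OF \<open>orbital_action t\<close>] by blast+
  next
    fix t assume t: "t \<in> inert"
    then have a: "orbital_action t" using act_T by (simp add: inert_def)
    have "cj (rep t g1) (rep t g0) = rep t g1" using g(4) t by (simp add: cj_eq_self_iff)
    then have "shrink0 (rep t g0) (rep t g1) = 0" "shrink1 (rep t g0) (rep t g1) = 0"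
      by (simp_all add: shrink0_def shrink1_def eval_nat_numeral)
    then show "rep t (shrink0 g0 g1) = 0" "rep t (shrink1 g0 g1) = 0" by (simp_all add: rep[OF a])
  qed
  then show ?thesis by blast
qed

text \<open>The elements \<open>s\<close> and \<open>t\<close> in the commutators \<open>[s, t]\<close> that make up the shrunk pair are words in \<open>y\<close> and \<open>z\<close>, and the new pair
consists of the commutators \<open>[s, t\<^sup>\<psi>]\<close>. Here \<open>\<psi>\<close> is a power of the conjugate of \<open>f\<close> by an element \<open>\<theta>\<close>, chosen
such that on the orbitals of \<open>F_type\<close> the region where \<open>f\<close> is trivial is moved over the supports
of \<open>y\<close> and \<open>z\<close>, while in \<open>B\<close> the region next to the right end where \<open>f\<close> has no fixed points is enlarged so
as to contain their supports. The first is a movement to the right, the second a movement to the left;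
this is why the mirror image of \<open>B\<close> enters.\<close>

lemma kill_removable:
  assumes F_pair_trivial_on: "F_pair_trivial_on A y z" and AS: "A \<subseteq> oriented" and B: "B \<in> removable"
  shows "\<exists>y' z'. F_pair_trivial_on (insert B A) y' z'"
proof -
  have yz: "y \<in> G" "z \<in> G" using F_pair_trivial_on by (auto simp: F_pair_trivial_on_def)
  have BS: "B \<in> oriented" and aB: "orbital_action B" using B act_S by (auto simp: removable_def)
  \<comment> \<open>Reversing \<open>f\<close> if necessary, points near the right end of \<open>B\<close> move up.\<close>
  obtain f' d where f': "f' = f \<or> f' = - f"
    and d: "d \<in> ivl B" "\<forall>x\<in>{d..<hi B}. app (rep B f') x > x"
  proof (cases "attracts f B")
    case True
    then show ?thesis using that[of f] by (auto simp: attracts_def)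
  next
    case False
    then have "repels f B" using B by (auto simp: removable_def)
    then show ?thesis
      using that[of "- f"] by (auto simp: repels_def rep_simps[OF aB] less_app_uminus_iff)
  qed
  have f'G: "f' \<in> G" using f' by auto
  have f'_fix: "app (rep t f') x = x" if "orbital_action t" "app (rep t f) x = x" for t x
    using f' that by (auto simp: rep_simps app_uminus_eq_iff)
  have "\<exists>c. c \<in> ivl t \<and> (\<forall>x\<le>c. app (rep t f) x = x)" if "t \<in> F_type" for t
    using neut_low[of t f] act_S that by (auto simp: F_type_def)
  then obtain c where c: "\<And>t. t \<in> F_type \<Longrightarrow> c t \<in> ivl t \<and> (\<forall>x\<le>c t. app (rep t f) x = x)"
    by metis
  have "\<exists>j k. j \<in> ivl t \<and> k \<in> ivl t \<and> supp_in j k (rep t y) \<and> supp_in j k (rep t z)" if "t \<in> oriented" for t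
    using F_pair_trivial_on that csupp_common[of t y z] unfolding F_pair_trivial_on_def by blast
  then obtain j k where jk: "\<And>t. t \<in> oriented \<Longrightarrow> j t \<in> ivl t \<and> k t \<in> ivl t \<and>
      supp_in (j t) (k t) (rep t y) \<and> supp_in (j t) (k t) (rep t z)"
    by metis
  have mB: "mirror B \<notin> F_type"
    using B not_neut[of f B] by (auto simp: removable_def F_type_def)
  have aG: "\<forall>t\<in>F_type. orbital_action t" "finite F_type" using act_S finite_S by (auto simp: F_type_def)
  have "simultaneous (F_type \<union> {mirror B})"
  proof (cases "repels f B")
    case True
    then show ?thesis
      using aG F_type_simultaneous act_mirror[OF aB]
      by (intro simultaneous_union[of _ f] simultaneous_single) (auto simp: F_type_def intro: no_descentI)
  next
    case False
    then have "attracts f (mirror B)" using B by (auto simp: removable_def)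
    then have "simultaneous ({mirror B} \<union> F_type)"
      using aG F_type_simultaneous act_mirror[OF aB]
      by (intro simultaneous_union[of _ f] simultaneous_single) (auto simp: F_type_def intro: no_descentI)
    then show ?thesis by (simp add: Un_commute)
  qed
  \<comment> \<open>The second branch concerns the mirror image of \<open>B\<close> only.\<close>
  moreover define p where "p = (\<lambda>t. if t \<in> F_type then c t else - d)"
  moreover define q where "q = (\<lambda>t. if t \<in> F_type then k t else - j B)"
  moreover have "on_ivl (F_type \<union> {mirror B}) p" "on_ivl (F_type \<union> {mirror B}) q"
    using c jk d BS mB by (auto simp: on_ivl_def p_def q_def F_type_def)
  ultimately obtain \<theta> where \<theta>: "good (F_type \<union> {mirror B}) p q \<theta>"
    unfolding simultaneous_def by blast
  have \<theta>G: "\<theta> \<in> G" using \<theta> by (simp add: good_def)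
  have \<theta>F_type: "app (rep t \<theta>) (c t) > k t" if "t \<in> F_type" for t
  proof -
    have "app (rep t \<theta>) (p t) > q t" using \<theta> that by (simp add: good_def)
    then show ?thesis using that by (simp add: p_def q_def)
  qed
  have \<theta>B: "app (rep B \<theta>) d < j B"
  proof -
    have "app (rep (mirror B) \<theta>) (p (mirror B)) > q (mirror B)"
      using \<theta> unfolding good_def by blast
    then show ?thesis using mB by (simp add: p_def q_def)
  qed
  define v where "v = cj f' \<theta>"
  have vG: "v \<in> G" using f'G \<theta>G by (simp add: v_def)
  have v_up: "app (rep B v) x > x" if x: "x \<in> {app (rep B \<theta>) d..<hi B}" for x
  proof -
    have "app (- rep B \<theta>) x \<in> {d..<hi B}"
      using x rep_outside[OF aB \<theta>G, of "hi B"]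
      by (auto simp: app_uminus_less_iff) (metis app_app_uminus app_le)
    then have "app (rep B f') (app (- rep B \<theta>) x) > app (- rep B \<theta>) x" using d by blast
    then have "app (rep B \<theta>) (app (rep B f') (app (- rep B \<theta>) x)) > x"
      by (simp add: app_uminus_less_iff)
    then show ?thesis using f'G \<theta>G by (simp add: v_def rep_simps[OF aB] app_cj)
  qed
  have "\<exists>N. \<forall>n\<ge>N. app (nmul n (rep B v)) (j B) > k B"
    using jk[OF BS] \<theta>B v_up rep_outside[OF aB vG, of "hi B"]
    by (intro escape[of "app (rep B \<theta>) d" "hi B"]) auto
  then obtain n where n: "app (nmul n (rep B v)) (j B) > k B" by blast
  define \<psi> where "\<psi> = nmul n v"
  have \<psi>G: "\<psi> \<in> G" using vG by (simp add: \<psi>_def)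
  have \<psi>_F: "app (rep t \<psi>) x = x" if t: "t \<in> F_type" and x: "x \<le> k t" for t x
  proof -
    have a: "orbital_action t" using aG t by blast
    have "app (- rep t \<theta>) x \<le> c t" using x \<theta>F_type[OF t] by (metis app_app_uminus app_le le_less_trans less_imp_le)
    then have "app (rep t f) (app (- rep t \<theta>) x) = app (- rep t \<theta>) x" using c[OF t] by blast
    then have "app (rep t f') (app (- rep t \<theta>) x) = app (- rep t \<theta>) x" by (rule f'_fix[OF a])
    then have "app (rep t v) x = x" using f'G \<theta>G by (simp add: v_def rep_simps[OF a] app_cj)
    then show ?thesis using vG by (simp add: \<psi>_def rep_simps[OF a] app_nmul_fix)
  qed
  have \<psi>_commute: "cj (rep t u) (rep t \<psi>) = rep t u"
    if t: "t \<in> F_type" and u: "supp_in (j t) (k t) (rep t u)" for t u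
    unfolding cj_eq_self_iff
    by (rule disjoint_supports_commute) (metis supp_in_def u \<psi>_F[OF t])
  define y' where "y' = comm (- z) (cj (y + y) \<psi>)"
  define z' where "z' = comm (- cj z y) (cj y \<psi>)"
  have G': "y' \<in> G" "z' \<in> G" using yz \<psi>G by (simp_all add: y'_def z'_def)
  have rep': "rep t y' = comm (- rep t z) (cj (rep t (y + y)) (rep t \<psi>))"
    "rep t z' = comm (- cj (rep t z) (rep t y)) (cj (rep t y) (rep t \<psi>))" if "orbital_action t" for t
    using yz \<psi>G that by (simp_all add: y'_def z'_def rep_simps)
  have "F_pair_trivial_on (insert B A) y' z'"
    unfolding F_pair_trivial_on_def
  proof (intro conjI ballI)
    show "y' \<in> G" "z' \<in> G" by (fact G')+
    show "compact_supp t y'" "compact_supp t z'" if "t \<in> oriented" for t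
      using act_S[OF that] yz \<psi>G by (auto simp: y'_def z'_def intro!: csupp_comm)
  next
    fix t assume t: "t \<in> F_type"
    then have a: "orbital_action t" and tS: "t \<in> oriented" using aG by (blast, simp add: F_type_def)
    have "supp_in (j t) (k t) (rep t (y + y))"
      using jk[OF tS] yz by (simp add: rep_simps[OF a] supp_in_add)
    then have "cj (rep t (y + y)) (rep t \<psi>) = rep t (y + y)" by (rule \<psi>_commute[OF t])
    then have "rep t y' = shrink0 (rep t y) (rep t z)" "rep t z' = shrink1 (rep t y) (rep t z)"
      using \<psi>_commute[OF t] jk[OF tS] yz unfolding rep'[OF a] shrink_comm
      by (simp_all add: rep_simps[OF a])
    moreover have "F_pair (rep t y) (rep t z)" "rep t y + rep t z \<noteq> rep t z + rep t y"
      using F_pair_trivial_on t by (auto simp: F_pair_trivial_on_def)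
    ultimately show "F_pair (rep t y') (rep t z')" "rep t y' + rep t z' \<noteq> rep t z' + rep t y'"
      using shrink_F_pair shrink_noncommute by metis+
  next
    fix t assume "t \<in> insert B A"
    then consider "t = B" | "t \<in> A" by blast
    then have "rep t y' = 0 \<and> rep t z' = 0"
    proof cases
      case 1
      have disj: "app (rep B \<psi>) (j B) > k B" using n vG by (simp add: \<psi>_def rep_simps[OF aB])
      have s: "supp_in (j B) (k B) (rep B y)" "supp_in (j B) (k B) (rep B z)" using jk[OF BS] by auto
      then have s': "supp_in (j B) (k B) (rep B (y + y))" "supp_in (j B) (k B) (cj (rep B z) (rep B y))"
        using yz by (simp_all add: rep_simps[OF aB] supp_in_add supp_in_minus cj_def)
      show ?thesis
        unfolding 1 rep'[OF aB] comm_eq_0_iff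
        using disj supp_in_disjoint_commute[OF supp_in_minus[OF s(2)] supp_in_cj[OF s'(1)]]
          supp_in_disjoint_commute[OF supp_in_minus[OF s'(2)] supp_in_cj[OF s(1)]] by blast
    next
      case 2
      then have a: "orbital_action t" using AS act_S by blast
      have "rep t y = 0" "rep t z = 0" using F_pair_trivial_on 2 by (auto simp: F_pair_trivial_on_def)
      then show ?thesis by (simp add: rep'[OF a] rep_add[OF a] yz comm_def)
    qed
    then show "rep t y' = 0" "rep t z' = 0" by auto
  qed
  then show ?thesis by blast
qed

lemma F_pair_trivial_on_all: "\<exists>y z. F_pair_trivial_on (inert \<union> removable) y z"
proof -
  have "finite removable" using finite_S by (simp add: removable_def)
  moreover have "\<exists>y z. F_pair_trivial_on (inert \<union> X) y z" if "finite X" "X \<subseteq> removable" for X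
    using that
  proof (induction X rule: finite_induct)
    case (insert B X)
    then obtain y z where "F_pair_trivial_on (inert \<union> X) y z" by auto
    moreover have "inert \<union> X \<subseteq> oriented" using insert by (auto simp: inert_def oriented_def removable_def)
    ultimately show ?case using kill_removable[of "inert \<union> X" y z B] insert by auto
  qed (simp add: F_pair_trivial_on_inert)
  ultimately show ?thesis by blast
qed

text \<open>Every orbital is of \<open>F_type\<close>, inert or removable in one of its orientations, and the trivial pair satisfies the
relations of \<open>F\<close>.\<close>

theorem F_pair_on_orbitals:
  "\<exists>y\<in>G. \<exists>z\<in>G. (\<forall>t\<in>T. F_pair (rep t y) (rep t z)) \<and>
     (\<forall>t\<in>F_type. rep t y + rep t z \<noteq> rep t z + rep t y)"
proof -
  obtain y z where F_pair_trivial_on: "F_pair_trivial_on (inert \<union> removable) y z" using F_pair_trivial_on_all by blast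
  have "F_pair (rep t y) (rep t z)" if t: "t \<in> T" for t
    using orbital_types[OF t]
  proof (elim disjE)
    assume "t \<in> inert" then show ?thesis using F_pair_trivial_on by (simp add: F_pair_trivial_on_def F_pair_0)
  next
    assume "t \<in> removable" then show ?thesis using F_pair_trivial_on by (simp add: F_pair_trivial_on_def F_pair_0)
  next
    assume "t \<in> F_type" then show ?thesis using F_pair_trivial_on by (simp add: F_pair_trivial_on_def)
  next
    assume "mirror t \<in> F_type"
    then have "F_pair (rep (mirror t) y) (rep (mirror t) z)" using F_pair_trivial_on unfolding F_pair_trivial_on_def by blast
    then show ?thesis by simp
  next
    assume "mirror t \<in> removable"
    then have "rep (mirror t) y = 0" "rep (mirror t) z = 0" using F_pair_trivial_on unfolding F_pair_trivial_on_def by blast+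
    then have "F_pair (rep (mirror t) y) (rep (mirror t) z)" by (simp only: F_pair_0)
    then show ?thesis by simp
  qed
  then show ?thesis using F_pair_trivial_on unfolding F_pair_trivial_on_def by blast
qed

end

section \<open>Orbitals of a pair of piecewise linear homeomorphisms\<close>

lemma homeo_group_gen2: "homeo_group (gen2 u v)"
proof
  show add: "p + q \<in> gen2 u v" if "p \<in> gen2 u v" "q \<in> gen2 u v" for p q
    using that by (induction p rule: gen2.induct) (auto simp: add.assoc intro: gen2.intros)
  have single: "u \<in> gen2 u v" "v \<in> gen2 u v" "- u \<in> gen2 u v" "- v \<in> gen2 u v"
    using gen2_x[OF gen2_0, of u v] gen2_y[OF gen2_0, of v u] gen2_mx[OF gen2_0, of u v]
      gen2_my[OF gen2_0, of v u] by simp_all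
  show "- p \<in> gen2 u v" if "p \<in> gen2 u v" for p
    using that by (induction p rule: gen2.induct) (auto simp: minus_add intro: add single gen2_0)
qed (rule gen2_0)

lemma (in homeo_group) gen2_subset:
  assumes "u \<in> G" "v \<in> G" shows "gen2 u v \<subseteq> G"
proof
  fix w assume "w \<in> gen2 u v" then show "w \<in> G" using assms by induction auto
qed

lemma gen2_self: "u \<in> gen2 u v" "v \<in> gen2 u v"
  using gen2_x[OF gen2_0, of u v] gen2_y[OF gen2_0, of v u] by simp_all

lemma gen2_fix:
  assumes "w \<in> gen2 u v" "app u x = x" "app v x = x"
  shows "app w x = x"
  using assms by induction (simp_all add: app_uminus_eq_iff[THEN iffD2])

text \<open>\<open>(l, r)\<close> is an orbital of the group generated by \<open>f\<close> and \<open>h\<close>.\<close>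

definition joint_orbital :: "homeo \<Rightarrow> homeo \<Rightarrow> real \<Rightarrow> real \<Rightarrow> bool" where
  "joint_orbital f h l r \<longleftrightarrow> l < r \<and> app f l = l \<and> app h l = l \<and> app f r = r \<and> app h r = r \<and>
     (\<forall>x\<in>{l<..<r}. app f x \<noteq> x \<or> app h x \<noteq> x)"

lemma orb_flipI: "joint_orbital f h l r \<Longrightarrow> joint_orbital (flip f) (flip h) (- r) (- l)"
  unfolding joint_orbital_def
proof (elim conjE, intro conjI ballI)
  fix x assume "\<forall>x\<in>{l<..<r}. app f x \<noteq> x \<or> app h x \<noteq> x" "x \<in> {- r<..<- l}"
  then have "app f (- x) \<noteq> - x \<or> app h (- x) \<noteq> - x" by auto
  then show "app (flip f) x \<noteq> x \<or> app (flip h) x \<noteq> x" unfolding app_flip by linarith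
qed simp_all

lemma orb_flip: "joint_orbital (flip f) (flip h) (- r) (- l) \<longleftrightarrow> joint_orbital f h l r"
  using orb_flipI[of f h l r] orb_flipI[of "flip f" "flip h" "- r" "- l"] by auto

lemma continuous_app: "continuous_on UNIV (app u)"
  using app[of u] by (intro continuous_onI_mono) auto

lemma closed_fix: "closed {x. app u x = x}"
  by (intro closed_Collect_eq continuous_app continuous_on_id)

lemma orbital_around:
  assumes x: "app f x \<noteq> x \<or> app h x \<noteq> x"
    and p: "p < x" "app f p = p" "app h p = p" and s: "x < s" "app f s = s" "app h s = s"
  shows "\<exists>l r. joint_orbital f h l r \<and> l < x \<and> x < r \<and> p \<le> l \<and> r \<le> s"
proof -
  define C where "C = {y. app f y = y} \<inter> {y. app h y = y}"
  have C: "closed C" unfolding C_def by (intro closed_Int closed_fix)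
  define l where "l = Sup (C \<inter> {p..x})"
  define r where "r = Inf (C \<inter> {x..s})"
  have "l \<in> C \<inter> {p..x}"
    unfolding l_def using p C by (intro closed_contains_Sup) (auto simp: C_def intro: closed_Int)
  moreover have "r \<in> C \<inter> {x..s}"
    unfolding r_def using s C by (intro closed_contains_Inf) (auto simp: C_def intro: closed_Int)
  moreover have "x \<notin> C" using x by (auto simp: C_def)
  moreover have "y \<notin> C" if "l < y" "y < r" for y
  proof
    assume y: "y \<in> C"
    show False
    proof (cases "y \<le> x")
      case True
      then have "y \<le> l" unfolding l_def using y that \<open>l \<in> C \<inter> {p..x}\<close>
        by (intro cSup_upper) auto
      then show False using that by simp
    next
      case False
      then have "r \<le> y" unfolding r_def using y that \<open>r \<in> C \<inter> {x..s}\<close>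
        by (intro cInf_lower) auto
      then show False using that by simp
    qed
  qed
  moreover have "l \<noteq> x" "r \<noteq> x" using calculation by auto
  ultimately show ?thesis
    unfolding joint_orbital_def C_def by (intro exI[of _ l] exI[of _ r]) auto
qed

definition pl_homeo :: "homeo \<Rightarrow> bool" where
  "pl_homeo u \<longleftrightarrow> (\<exists>P. finite P \<and> (\<forall>x y. x \<le> y \<and> P \<inter> {x<..<y} = {} \<longrightarrow> linear_on_Icc (app u) x y))"

lemma plh_flip: assumes "pl_homeo u" shows "pl_homeo (flip u)"
proof -
  obtain P where P: "finite P" "\<And>x y. x \<le> y \<Longrightarrow> P \<inter> {x<..<y} = {} \<Longrightarrow> linear_on_Icc (app u) x y"
    using assms unfolding pl_homeo_def by blast
  have "linear_on_Icc (app (flip u)) x y" if xy: "x \<le> y" "uminus ` P \<inter> {x<..<y} = {}" for x y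
  proof -
    have "P \<inter> {- y<..<- x} = {}"
    proof (rule ccontr)
      assume "\<not> ?thesis"
      then obtain p where "p \<in> P" "- y < p" "p < - x" by auto
      then have "- p \<in> uminus ` P \<inter> {x<..<y}" by auto
      with xy show False by blast
    qed
    then obtain m c where mc: "\<forall>z\<in>{- y..- x}. app u z = m * z + c"
      using P(2)[of "- y" "- x"] xy unfolding linear_on_Icc_def by auto
    have "app (flip u) z = m * z + - c" if "z \<in> {x..y}" for z
      using mc[rule_format, of "- z"] that by simp
    then show ?thesis unfolding linear_on_Icc_def by blast
  qed
  moreover have "finite (uminus ` P)" using P(1) by simp
  ultimately show ?thesis unfolding pl_homeo_def by blast
qed

definition high_germ :: "homeo \<Rightarrow> real \<Rightarrow> bool" where
  "high_germ u r \<longleftrightarrow> (\<exists>m>0. \<exists>q<r. \<forall>y\<in>{q..r}. app u y = r + m * (y - r))"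

lemma plh_high_germ:
  assumes "pl_homeo u" "app u r = r"
  shows "high_germ u r"
proof -
  obtain P where P: "finite P" "\<And>x y. x \<le> y \<Longrightarrow> P \<inter> {x<..<y} = {} \<Longrightarrow> linear_on_Icc (app u) x y"
    using assms(1) unfolding pl_homeo_def by blast
  define A where "A = insert (r - 1) {p \<in> P. p < r}"
  have A: "finite A" "A \<noteq> {}" using P(1) by (auto simp: A_def)
  define q where "q = Max A"
  have qr: "q < r" unfolding q_def using Max_in[OF A] by (auto simp: A_def)
  have "P \<inter> {q<..<r} = {}"
  proof (rule ccontr)
    assume "\<not> ?thesis"
    then obtain p where p: "p \<in> P" "q < p" "p < r" by auto
    then have "p \<le> q" unfolding q_def by (intro Max_ge A) (simp add: A_def)
    with p show False by simp
  qed
  then obtain m c where mc: "\<forall>z\<in>{q..r}. app u z = m * z + c"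
    using P(2)[of q r] qr unfolding linear_on_Icc_def by auto
  have "app u r = m * r + c" "app u q = m * q + c" using mc qr by auto
  moreover have "app u q < app u r" using qr by simp
  ultimately have "m * q < m * r" "c = r - m * r" using assms(2) by auto
  moreover from this have "m > 0" using qr by (simp add: mult_less_cancel_left)
  ultimately show ?thesis
    unfolding high_germ_def using mc qr
    by (intro exI[of _ m] conjI exI[of _ q]) (auto simp: algebra_simps)
qed

text \<open>Two linear maps with a common fixed point commute.\<close>

lemma high_germ_commute:
  assumes "high_germ u r" "high_germ v r"
  shows "\<exists>q<r. \<forall>x\<in>{q..r}. app (u + v) x = app (v + u) x"
proof -
  obtain m q where u: "m > 0" "q < r" "\<forall>y\<in>{q..r}. app u y = r + m * (y - r)"
    using assms(1) unfolding high_germ_def by blast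
  obtain n p where v: "n > 0" "p < r" "\<forall>y\<in>{p..r}. app v y = r + n * (y - r)"
    using assms(2) unfolding high_germ_def by blast
  have ur: "app u r = r" "app v r = r" using u(3)[rule_format, of r] u(2) v(3)[rule_format, of r] v(2) by auto
  define s where "s = Max {q, p, app (- u) p, app (- v) q}"
  have "app (- u) p < r" "app (- v) q < r" using u v ur by (simp_all add: app_uminus_less_iff)
  then have sr: "s < r" using u v by (simp add: s_def)
  have "app (u + v) x = app (v + u) x" if x: "x \<in> {s..r}" for x
  proof -
    have "x \<ge> q" "x \<ge> p" "x \<ge> app (- u) p" "x \<ge> app (- v) q" "x \<le> r" using x by (auto simp: s_def)
    moreover from this have "app u x \<ge> p" "app v x \<ge> q" "app u x \<le> r" "app v x \<le> r"
      by (metis app_le app_app_uminus, metis app_le app_app_uminus, metis app_le ur(1), metis app_le ur(2))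
    ultimately have "app v (app u x) = r + n * (m * (x - r))" "app u (app v x) = r + m * (n * (x - r))"
      using u(3) v(3) by auto
    then show ?thesis by simp
  qed
  then show ?thesis using sr by blast
qed

lemma high_germ_cases:
  assumes "high_germ (rep t u) (hi t)" "lo t < hi t"
  shows "attracts u t \<or> repels u t \<or> neutral u t"
proof -
  obtain m q where u: "m > 0" "q < hi t" "\<forall>y\<in>{q..hi t}. app (rep t u) y = hi t + m * (y - hi t)"
    using assms(1) unfolding high_germ_def by blast
  define d where "d = max q ((lo t + hi t) / 2)"
  have d: "d \<in> ivl t" "q \<le> d" using u(2) assms(2) by (auto simp: d_def less_max_iff_disj)
  have eq: "app (rep t u) x - x = (1 - m) * (hi t - x)" if "x \<in> {d..<hi t}" for x
    using u(3) d that by (auto simp: algebra_simps)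
  consider "m < 1" | "m > 1" | "m = 1" by linarith
  then show ?thesis
  proof cases
    case 1
    then have "app (rep t u) x > x" if "x \<in> {d..<hi t}" for x
      using eq[OF that] that mult_pos_pos[of "1 - m" "hi t - x"] unfolding atLeastLessThan_iff by linarith
    then show ?thesis using d unfolding attracts_def by blast
  next
    case 2
    then have "app (rep t u) x < x" if "x \<in> {d..<hi t}" for x
      using eq[OF that] that mult_neg_pos[of "1 - m" "hi t - x"] unfolding atLeastLessThan_iff by linarith
    then show ?thesis using d unfolding repels_def by blast
  next
    case 3
    then have "app (rep t u) x = x" if "x \<in> {d..<hi t}" for x
      using eq[OF that] by auto
    then show ?thesis using d unfolding neutral_def by blast
  qed
qed

definition restr :: "real \<Rightarrow> real \<Rightarrow> homeo \<Rightarrow> homeo" where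
  "restr l r u = Homeo (\<lambda>x. if l < x \<and> x < r then app u x else x)"

lemma app_restr:
  assumes "app u l = l" "app u r = r"
  shows "app (restr l r u) x = (if l < x \<and> x < r then app u x else x)"
proof -
  let ?g = "\<lambda>u x. if l < x \<and> x < r then app u x else x"
  have 1: "l < app w x \<longleftrightarrow> l < x" "app w x < r \<longleftrightarrow> x < r" if "app w l = l" "app w r = r" for w x
    using that app_less by metis+
  have m: "app (- u) l = l" "app (- u) r = r" using assms by (simp_all add: app_uminus_eq_iff)
  have "strict_mono (?g u)"
  proof (rule strict_monoI)
    fix x y :: real assume "x < y"
    then show "?g u x < ?g u y" using 1[OF assms, of x] 1[OF assms, of y]
      by (smt (verit) app_less)
  qed
  moreover have "surj (?g u)"
    by (rule surjI[of _ "?g (- u)"]) (auto simp: 1[OF m])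
  ultimately show ?thesis unfolding restr_def by (simp add: app_Homeo)
qed

lemma restr_add:
  assumes "app u l = l" "app u r = r" "app v l = l" "app v r = r"
  shows "restr l r (u + v) = restr l r u + restr l r v"
proof (rule homeo_eqI)
  fix x
  have "l < app u x \<longleftrightarrow> l < x" "app u x < r \<longleftrightarrow> x < r" using assms app_less by metis+
  then show "app (restr l r (u + v)) x = app (restr l r u + restr l r v) x"
    using assms by (auto simp: app_restr)
qed

lemma high_germ_restr:
  assumes "high_germ u r" "app u l = l" "app u r = r" "l < r"
  shows "high_germ (restr l r u) r"
proof -
  obtain m q where u: "m > 0" "q < r" "\<forall>y\<in>{q..r}. app u y = r + m * (y - r)"
    using assms(1) unfolding high_germ_def by blast
  define s where "s = max q ((l + r) / 2)"
  have "app (restr l r u) y = r + m * (y - r)" if "y \<in> {s..r}" for y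
    using that u assms by (cases "y = r") (auto simp: app_restr s_def)
  moreover have "s < r" using u assms by (simp add: s_def)
  ultimately show ?thesis using u(1) unfolding high_germ_def by blast
qed

lemma flip_restr:
  assumes "app u l = l" "app u r = r"
  shows "flip (restr l r u) = restr (- r) (- l) (flip u)"
  by (rule homeo_eqI) (use assms in \<open>auto simp: app_restr\<close>)

text \<open>The supremum of an orbit is fixed by the whole group.\<close>

lemma orbit_cofinal:
  assumes "homeo_group G" and fixr: "\<And>u. u \<in> G \<Longrightarrow> app u r = r"
    and nofix: "\<And>s. x \<le> s \<Longrightarrow> s < r \<Longrightarrow> \<exists>u\<in>G. app u s \<noteq> s"
    and xy: "x < r" "y < r"
  shows "\<exists>u\<in>G. app u x > y"
proof (rule ccontr)
  interpret homeo_group G by fact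
  assume "\<not> ?thesis"
  then have le: "app u x \<le> y" if "u \<in> G" for u using that by (auto simp: not_less)
  let ?O = "(\<lambda>u. app u x) ` G"
  have bdd: "bdd_above ?O" by (rule bdd_aboveI2[OF le])
  define s where "s = Sup ?O"
  have up: "app u x \<le> s" if "u \<in> G" for u unfolding s_def using that by (rule cSUP_upper[OF _ bdd])
  have "s \<le> y" unfolding s_def using le by (intro cSUP_least) auto
  moreover have "x \<le> s" using up[of 0] by simp
  ultimately obtain u where u: "u \<in> G" "app u s \<noteq> s" using nofix[of s] xy by auto
  have ge: "s \<le> app v s" if v: "v \<in> G" for v
    unfolding s_def
  proof (rule cSUP_least)
    fix w assume "w \<in> G"
    then have "app (w + - v) x \<le> s" using v by (intro up) auto
    then have "app (- v) (app w x) \<le> s" by simp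
    then have "app w x \<le> app v s" by (metis app_app_uminus app_le)
    then show "app w x \<le> app v (SUP u\<in>G. app u x)" by (simp add: s_def)
  qed auto
  have "app (- u) s \<ge> s" using ge u by blast
  then have "app u s \<le> s" by (metis app_app_uminus app_le)
  then show False using ge[OF u(1)] u(2) by simp
qed

text \<open>If \<open>l < l'\<close> are left ends of two orbitals and there is no break point between them, then \<open>f\<close> and \<open>h\<close> are linear on
\<open>[l, l']\<close> and fix both ends; hence they are the identity there, contrary to \<open>l\<close> being the left end of an
orbital. So an orbital is determined by the set of break points to the left of it.\<close>

lemma finite_joint_orbitals:
  assumes "pl_homeo f" "pl_homeo h"
  shows "finite {(l, r). joint_orbital f h l r}"
proof -
  obtain P where P: "finite P" "\<And>x y. x \<le> y \<Longrightarrow> P \<inter> {x<..<y} = {} \<Longrightarrow> linear_on_Icc (app f) x y"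
    using assms(1) unfolding pl_homeo_def by blast
  obtain Q where Q: "finite Q" "\<And>x y. x \<le> y \<Longrightarrow> Q \<inter> {x<..<y} = {} \<Longrightarrow> linear_on_Icc (app h) x y"
    using assms(2) unfolding pl_homeo_def by blast
  have id: "app u x = x" if lin: "linear_on_Icc (app u) l r" and "app u l = l" "app u r = r" "l < x" "x < r" for u l r x
  proof -
    obtain m c where mc: "\<forall>z\<in>{l..r}. app u z = m * z + c" using lin unfolding linear_on_Icc_def by blast
    have "m * l + c = l" "m * r + c = r" using mc that by (auto dest!: bspec)
    then have "(m - 1) * (r - l) = 0" by (simp add: algebra_simps)
    then have "m = 1" "c = 0" using that \<open>m * l + c = l\<close> by auto
    then show ?thesis using mc that by auto
  qed
  have less: "(P \<union> Q) \<inter> {..l} \<noteq> (P \<union> Q) \<inter> {..l'}"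
    if o: "joint_orbital f h l r" "joint_orbital f h l' r'" and "l < l'" for l r l' r'
  proof
    assume eq: "(P \<union> Q) \<inter> {..l} = (P \<union> Q) \<inter> {..l'}"
    have "r \<le> l'"
    proof (rule ccontr)
      assume "\<not> r \<le> l'"
      then have "l' \<in> {l<..<r}" using that by auto
      then show False using o unfolding joint_orbital_def by blast
    qed
    have "P \<inter> {l<..<l'} = {}" "Q \<inter> {l<..<l'} = {}" using eq by auto (force simp: set_eq_iff)+
    then have "linear_on_Icc (app f) l l'" "linear_on_Icc (app h) l l'" using P Q \<open>l < l'\<close> by auto
    moreover define x where "x = (l + r) / 2"
    moreover have "l < x" "x < r" using o by (auto simp: x_def joint_orbital_def)
    ultimately have "app f x = x" "app h x = x"
      using o \<open>r \<le> l'\<close> unfolding joint_orbital_def by (auto intro!: id[of _ l l'])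
    then show False using o(1) \<open>l < x\<close> \<open>x < r\<close> unfolding joint_orbital_def by auto
  qed
  have "inj_on (\<lambda>(l, r). (P \<union> Q) \<inter> {..l}) {(l, r). joint_orbital f h l r}"
  proof (rule inj_onI, clarify)
    fix l r l' r' assume o: "joint_orbital f h l r" "joint_orbital f h l' r'" and eq: "(P \<union> Q) \<inter> {..l} = (P \<union> Q) \<inter> {..l'}"
    have l: "l = l'" using less[OF o] less[OF o(2,1)] eq by (metis linorder_less_linear)
    have "\<not> r < r'" "\<not> r' < r"
      using o unfolding l joint_orbital_def by auto
    then show "l = l' \<and> r = r'" using l by simp
  qed
  moreover have "(\<lambda>(l, r). (P \<union> Q) \<inter> {..l}) ` {(l, r). joint_orbital f h l r} \<subseteq> Pow (P \<union> Q)" by auto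
  ultimately show ?thesis using P(1) Q(1) by (meson finite_Pow_iff finite_UnI inj_on_finite)
qed

definition orbital_act :: "real \<Rightarrow> real \<Rightarrow> action" where
  "orbital_act l r = (restr l r, l, r)"

lemma orbital_act_simps [simp]:
  "rep (orbital_act l r) = restr l r" "lo (orbital_act l r) = l" "hi (orbital_act l r) = r"
  by (simp_all add: orbital_act_def rep_def lo_def hi_def)

text \<open>Elements of the group generated by \<open>f\<close> and \<open>h\<close> are determined by their restrictions to the orbitals, so relations that hold on
each orbital hold globally.\<close>

lemma F_pair_in_gen2:
  assumes pl: "\<And>u. u \<in> gen2 f h \<Longrightarrow> pl_homeo u"
    and supp: "supp_in 0 1 f" "supp_in 0 1 h"
    and joint_orbital: "joint_orbital f h l r"
    and type: "attracts f t \<and> neutral f (mirror t)" "t = orbital_act l r \<or> t = mirror (orbital_act l r)"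
  shows "\<exists>y\<in>gen2 f h. \<exists>z\<in>gen2 f h. F_pair y z \<and> y + z \<noteq> z + y"
proof -
  interpret homeo_group "gen2 f h" by (rule homeo_group_gen2)
  define T where "T = (\<lambda>(l, r). orbital_act l r) ` {(l, r). joint_orbital f h l r}"
  have Fix: "app u l = l" "app u r = r" if "u \<in> gen2 f h" "joint_orbital f h l r" for u l r
    using that gen2_fix unfolding joint_orbital_def by auto
  have germ: "high_germ (restr l r u) r" "high_germ (flip (restr l r u)) (- l)"
    if u: "u \<in> gen2 f h" and o: "joint_orbital f h l r" for u l r
  proof -
    show "high_germ (restr l r u) r"
      using Fix[OF u o] o by (intro high_germ_restr plh_high_germ pl u) (auto simp: joint_orbital_def)
    have "high_germ (restr (- r) (- l) (flip u)) (- l)"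
      using Fix[OF u o] o by (intro high_germ_restr plh_high_germ plh_flip pl u) (auto simp: joint_orbital_def)
    then show "high_germ (flip (restr l r u)) (- l)" using Fix[OF u o] by (simp add: flip_restr)
  qed
  have orbital_action: "orbital_action (orbital_act l r)" if o: "joint_orbital f h l r" for l r
    unfolding orbital_action_def orbital_act_simps
  proof (intro conjI ballI allI impI)
    show lr: "l < r" using o by (simp add: joint_orbital_def)
    fix u v assume u: "u \<in> gen2 f h" and v: "v \<in> gen2 f h"
    show add: "restr l r (u + v) = restr l r u + restr l r v"
      using Fix[OF _ o] u v by (simp add: restr_add)
    have add': "restr l r (v + u) = restr l r v + restr l r u"
      using Fix[OF _ o] u v by (simp add: restr_add)
    obtain q where q: "q < r" "\<forall>x\<in>{q..r}. app (restr l r u + restr l r v) x = app (restr l r v + restr l r u) x"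
      using high_germ_commute[OF germ(1)[OF u o] germ(1)[OF v o]] by blast
    show "\<exists>q\<in>{l<..<r}. \<forall>x\<in>{q..<r}. app (restr l r (u + v)) x = app (restr l r (v + u)) x"
      using q lr unfolding add add'
      by (intro bexI[of _ "max q ((l + r) / 2)"]) (auto simp: less_max_iff_disj)
    obtain q where q: "q < - l" "\<forall>x\<in>{q..- l}. app (flip (restr l r u) + flip (restr l r v)) x =
        app (flip (restr l r v) + flip (restr l r u)) x"
      using high_germ_commute[OF germ(2)[OF u o] germ(2)[OF v o]] by blast
    have *: "app (restr l r (u + v)) x = app (restr l r (v + u)) x" if "l \<le> x" "x \<le> - q" for x
      using q(2)[rule_format, of "- x"] that unfolding add add' by simp
    show "\<exists>q\<in>{l<..<r}. \<forall>x\<in>{l<..q}. app (restr l r (u + v)) x = app (restr l r (v + u)) x"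
      using * lr q(1) by (intro bexI[of _ "min (- q) ((l + r) / 2)"]) (auto simp: min_less_iff_disj)
  next
    fix u x assume "u \<in> gen2 f h" "x \<notin> {l<..<r}"
    then show "app (restr l r u) x = x" using Fix[OF _ o] by (auto simp: app_restr)
  next
    fix x y assume x: "x \<in> {l<..<r}" and y: "y \<in> {l<..<r}"
    have "\<exists>u\<in>gen2 f h. app u x > y"
    proof (rule orbit_cofinal[of _ r])
      show "app u r = r" if "u \<in> gen2 f h" for u using Fix[OF that o] by simp
      show "\<exists>u\<in>gen2 f h. app u s \<noteq> s" if "x \<le> s" "s < r" for s
      proof -
        have "s \<in> {l<..<r}" using that x by auto
        then show ?thesis using o gen2_self[of f h] gen2_self[of h f] unfolding joint_orbital_def by blast
      qed
    qed (use x y in \<open>auto intro: homeo_group_gen2\<close>)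
    then show "\<exists>u\<in>gen2 f h. app (restr l r u) x > y" using Fix[OF _ o] x by (auto simp: app_restr)
  qed
  have lo_hi: "0 \<le> l" if o: "joint_orbital f h l r" for l r
  proof (rule ccontr)
    assume "\<not> ?thesis"
    then have "l < 0" by simp
    define x where "x = (l + min 0 r) / 2"
    have x: "x \<in> {l<..<r}" "x < 0" using \<open>l < 0\<close> o by (auto simp: x_def joint_orbital_def)
    then show False using o supp unfolding joint_orbital_def supp_in_def by fastforce
  qed
  interpret orbital_system "gen2 f h" f T
  proof
    show "f \<in> gen2 f h" by (rule gen2_self)
    show "finite T" unfolding T_def by (intro finite_imageI finite_joint_orbitals pl gen2_self)
    show "orbital_action t" if "t \<in> T" for t using that orbital_action by (auto simp: T_def)
    show "attracts f t \<or> repels f t \<or> neutral f t" if t: "t \<in> T \<union> mirror ` T" for t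
    proof -
      obtain l r where o: "joint_orbital f h l r" "t = orbital_act l r \<or> t = mirror (orbital_act l r)"
        using t by (auto simp: T_def)
      then show ?thesis
        using germ[OF gen2_self(1) o(1)] o(1)
        by (intro high_germ_cases) (auto simp: joint_orbital_def)
    qed
    show "mirror t \<notin> T" if "t \<in> T" for t
    proof
      assume "mirror t \<in> T"
      then obtain l r l' r' where "joint_orbital f h l r" "t = orbital_act l r" "joint_orbital f h l' r'" "mirror t = orbital_act l' r'"
        using \<open>t \<in> T\<close> by (auto simp: T_def)
      moreover from this have "- r = l'" by (metis mirror_simps(2) orbital_act_simps(2,3))
      ultimately show False using lo_hi[of l r] lo_hi[of l' r'] by (auto simp: joint_orbital_def)
    qed
  qed
  obtain y z where yz: "y \<in> gen2 f h" "z \<in> gen2 f h" "\<forall>t\<in>T. F_pair (rep t y) (rep t z)"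
     "\<forall>t\<in>F_type. rep t y + rep t z \<noteq> rep t z + rep t y"
    using F_pair_on_orbitals by blast
  have eqI: "u = v" if u: "u \<in> gen2 f h" and v: "v \<in> gen2 f h" and uv: "\<And>t. t \<in> T \<Longrightarrow> rep t u = rep t v" for u v
  proof (rule homeo_eqI)
    fix x
    show "app u x = app v x"
    proof (cases "app f x = x \<and> app h x = x")
      case True
      then show ?thesis using gen2_fix u v by metis
    next
      case False
      then have "0 \<le> x" "x \<le> 1" using supp by (auto simp: supp_in_def)
      moreover have "app f (- 1) = - 1" "app h (- 1) = - 1" "app f 2 = 2" "app h 2 = 2"
        using supp unfolding supp_in_def by fastforce+
      ultimately obtain l r where o: "joint_orbital f h l r" "l < x" "x < r"
        using orbital_around[of f x h "- 1" 2] False by auto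
      then have "rep (orbital_act l r) u = rep (orbital_act l r) v" by (intro uv) (auto simp: T_def)
      then have "app (restr l r u) x = app (restr l r v) x" by simp
      then show ?thesis using o Fix[OF u o(1)] Fix[OF v o(1)] by (simp add: app_restr)
    qed
  qed
  have "F_pair y z"
    unfolding F_pair_def
  proof (intro conjI; rule eqI)
    fix t assume t: "t \<in> T"
    then have "F_pair (rep t y) (rep t z)" using yz by blast
    then show "rep t (cj z (y + y)) = rep t (cj z (y + z))"
      "rep t (cj z (y + y + y)) = rep t (cj z (y + y + z))"
      using yz(1,2) by (simp_all add: F_pair_def rep_simps[OF act_T[OF t]])
  qed (use yz in auto)
  moreover have "y + z \<noteq> z + y"
  proof
    assume c: "y + z = z + y"
    have "orbital_act l r \<in> T" using joint_orbital by (auto simp: T_def)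
    then have "t \<in> oriented" using type(2) unfolding oriented_def by blast
    then have tG: "t \<in> F_type" using type(1) unfolding F_type_def by blast
    then have "orbital_action t" using act_S by (simp add: F_type_def)
    then have "rep t y + rep t z = rep t z + rep t y" using c yz(1,2) by (metis rep_add)
    then show False using yz(4) tG by blast
  qed
  ultimately show ?thesis using yz by blast
qed

section \<open>From \<open>PLo\<close> to homeomorphisms of the line\<close>

text \<open>Extending the elements of \<open>PLo\<close> by the identity embeds \<open>PLo\<close> into the group of increasing homeomorphisms of
the line, where no carrier sets are needed.\<close>

definition ext_homeo :: "(real \<Rightarrow> real) \<Rightarrow> homeo" where
  "ext_homeo f = Homeo (\<lambda>x. if x \<in> unit_Icc then f x else x)"

lemma PLoD:
  assumes "f \<in> carrier PLo"
  shows "f ` unit_Icc = unit_Icc" "strict_mono_on unit_Icc f" "piecewise_linear f"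
    "f \<in> extensional unit_Icc"
  using assms by (auto simp: PLo_def homeomorphism_def)

lemma app_ext_homeo:
  assumes "f \<in> carrier PLo"
  shows "app (ext_homeo f) x = (if x \<in> unit_Icc then f x else x)"
proof -
  note f = PLoD[OF assms]
  let ?g = "\<lambda>x. if x \<in> unit_Icc then f x else x"
  have I: "f x \<in> unit_Icc" if "x \<in> unit_Icc" for x using f(1) that by blast
  have "strict_mono ?g"
  proof (rule strict_monoI)
    fix x y :: real assume xy: "x < y"
    show "?g x < ?g y"
      using I[of x] I[of y] strict_mono_onD[OF f(2), of x y] xy by auto
  qed
  moreover have "surj ?g"
    unfolding surj_def
  proof
    fix y show "\<exists>x. y = ?g x"
    proof (cases "y \<in> unit_Icc")
      case True
      then obtain x where "x \<in> unit_Icc" "y = f x" using f(1) by blast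
      then show ?thesis by (intro exI[of _ x]) auto
    next
      case False
      then show ?thesis by (intro exI[of _ y]) auto
    qed
  qed
  ultimately show ?thesis unfolding ext_homeo_def by (simp add: app_Homeo)
qed

lemma PLo_in_unit: "f \<in> carrier PLo \<Longrightarrow> x \<in> unit_Icc \<Longrightarrow> f x \<in> unit_Icc"
  using PLoD(1) by blast

lemma ext_homeo_mult:
  assumes "f \<in> carrier PLo" "g \<in> carrier PLo"
  shows "ext_homeo (f \<otimes>\<^bsub>PLo\<^esub> g) = ext_homeo f + ext_homeo g"
proof (rule homeo_eqI)
  fix x
  have fg: "f \<otimes>\<^bsub>PLo\<^esub> g \<in> carrier PLo"
    using assms group_PLo by (simp add: group.is_monoid monoid.m_closed)
  show "app (ext_homeo (f \<otimes>\<^bsub>PLo\<^esub> g)) x = app (ext_homeo f + ext_homeo g) x"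
    using assms PLo_in_unit[OF assms(1), of x]
    unfolding app_add app_ext_homeo[OF fg] app_ext_homeo[OF assms(1)] app_ext_homeo[OF assms(2)]
    by (auto simp: PLo_def compose_def)
qed

lemma ext_homeo_one: "ext_homeo \<one>\<^bsub>PLo\<^esub> = 0"
proof (rule homeo_eqI)
  fix x
  have "\<one>\<^bsub>PLo\<^esub> \<in> carrier PLo" using group_PLo by (simp add: group.is_monoid monoid.one_closed)
  then show "app (ext_homeo \<one>\<^bsub>PLo\<^esub>) x = app 0 x"
    by (simp add: app_ext_homeo) (simp add: PLo_def)
qed

lemma ext_homeo_inv:
  assumes "f \<in> carrier PLo"
  shows "ext_homeo (inv\<^bsub>PLo\<^esub> f) = - ext_homeo f"
proof -
  interpret group PLo by (rule group_PLo)
  have "ext_homeo (inv\<^bsub>PLo\<^esub> f) + ext_homeo f = ext_homeo (inv\<^bsub>PLo\<^esub> f \<otimes>\<^bsub>PLo\<^esub> f)"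
    using assms by (intro ext_homeo_mult[symmetric]) auto
  then show ?thesis using assms by (simp add: ext_homeo_one eq_neg_iff_add_eq_0)
qed

lemma ext_homeo_inj: "inj_on ext_homeo (carrier PLo)"
proof (rule inj_onI)
  fix f g assume fg: "f \<in> carrier PLo" "g \<in> carrier PLo" "ext_homeo f = ext_homeo g"
  have "f x = g x" if "x \<in> unit_Icc" for x
    using that app_ext_homeo[OF fg(1), of x] app_ext_homeo[OF fg(2), of x] fg(3) by simp
  then show "f = g" using PLoD(4) fg extensionalityI by metis
qed

lemma supp_in_ext_homeo: "f \<in> carrier PLo \<Longrightarrow> supp_in 0 1 (ext_homeo f)"
  unfolding supp_in_def by (auto simp: app_ext_homeo split: if_splits)

lemma plh_ext_homeo:
  assumes f: "f \<in> carrier PLo"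
  shows "pl_homeo (ext_homeo f)"
proof -
  obtain P where P: "finite P"
    "\<And>x y. 0 \<le> x \<Longrightarrow> x \<le> y \<Longrightarrow> y \<le> 1 \<Longrightarrow> P \<inter> {x<..<y} = {} \<Longrightarrow> linear_on_Icc f x y"
    using PLoD(3)[OF f] unfolding piecewise_linear_def by metis
  let ?u = "app (ext_homeo f)"
  have out: "?u x = x" if "x < 0 \<or> x > 1" for x
    using that by (auto simp: app_ext_homeo[OF f])
  have u0: "?u 0 = 0"
  proof -
    have I: "?u x \<in> unit_Icc" if "x \<in> unit_Icc" for x
      using PLo_in_unit[OF f that] that by (simp add: app_ext_homeo[OF f])
    have "0 \<in> f ` unit_Icc" using PLoD(1)[OF f] by simp
    then obtain x where "x \<in> unit_Icc" "?u x = 0" by (auto simp: app_ext_homeo[OF f])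
    then show ?thesis using I[of 0] app_le[of "ext_homeo f" 0 x] by auto
  qed
  have u1: "?u 1 = 1"
  proof -
    have I: "?u x \<in> unit_Icc" if "x \<in> unit_Icc" for x
      using PLo_in_unit[OF f that] that by (simp add: app_ext_homeo[OF f])
    have "1 \<in> f ` unit_Icc" using PLoD(1)[OF f] by simp
    then obtain x where "x \<in> unit_Icc" "?u x = 1" by (auto simp: app_ext_homeo[OF f])
    then show ?thesis using I[of 1] app_le[of "ext_homeo f" x 1] by auto
  qed
  have "linear_on_Icc ?u x y" if xy: "x \<le> y" "(P \<union> {0, 1}) \<inter> {x<..<y} = {}" for x y
  proof (cases "0 \<le> x \<and> y \<le> 1")
    case True
    then have "linear_on_Icc f x y" using P(2)[of x y] xy by auto
    then show ?thesis unfolding linear_on_Icc_def using True by (auto simp: app_ext_homeo[OF f])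
  next
    case False
    have "0 \<notin> {x<..<y}" "1 \<notin> {x<..<y}" using xy(2) by blast+
    have "?u z = 1 * z + 0" if "z \<in> {x..y}" for z
    proof -
      have "z = 0 \<or> z = 1 \<or> z < 0 \<or> z > 1"
        using that False \<open>0 \<notin> {x<..<y}\<close> \<open>1 \<notin> {x<..<y}\<close> by auto
      then show ?thesis using u0 u1 out by auto
    qed
    then show ?thesis unfolding linear_on_Icc_def by blast
  qed
  moreover have "finite (P \<union> {0, 1})" using P(1) by simp
  ultimately show ?thesis unfolding pl_homeo_def by blast
qed

lemma homeo_group_ext_homeo:
  assumes H: "subgroup H PLo"
  shows "homeo_group (ext_homeo ` H)"
proof
  have car: "h \<in> carrier PLo" if "h \<in> H" for h using that subgroup.subset[OF H] by blast
  show "0 \<in> ext_homeo ` H" using ext_homeo_one subgroup.one_closed[OF H] by (metis imageI)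
  show "u + v \<in> ext_homeo ` H" if "u \<in> ext_homeo ` H" "v \<in> ext_homeo ` H" for u v
  proof -
    obtain f g where "f \<in> H" "g \<in> H" "u = ext_homeo f" "v = ext_homeo g" using \<open>u \<in> _\<close> \<open>v \<in> _\<close> by blast
    then show ?thesis using ext_homeo_mult[of f g] car subgroup.m_closed[OF H] by (metis imageI)
  qed
  show "- u \<in> ext_homeo ` H" if "u \<in> ext_homeo ` H" for u
  proof -
    obtain f where "f \<in> H" "u = ext_homeo f" using \<open>u \<in> _\<close> by blast
    then show ?thesis using ext_homeo_inv[of f] car subgroup.m_inv_closed[OF H] by (metis imageI)
  qed
qed

lemma hull_openI:
  fixes S :: "real set"
  assumes "S \<subseteq> {a<..<b}"
    and "\<And>z. z \<in> {a<..<b} \<Longrightarrow> (\<exists>s\<in>S. s < z) \<and> (\<exists>s\<in>S. z < s)"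
  shows "convex hull S = {a<..<b}"
proof
  show "convex hull S \<subseteq> {a<..<b}" using assms(1) by (intro hull_minimal) auto
  show "{a<..<b} \<subseteq> convex hull S"
  proof
    fix z assume "z \<in> {a<..<b}"
    then obtain s t where "s \<in> S" "t \<in> S" "s < z" "z < t" using assms(2) by blast
    then show "z \<in> convex hull S"
      using convex_convex_hull[of S] hull_subset[of S convex]
      by (meson is_interval_convex_1 less_imp_le mem_is_interval_1_I subsetD)
  qed
qed

lemma hull_openD:
  fixes S :: "real set"
  assumes "convex hull S = {a<..<b}"
  shows "S \<subseteq> {a<..<b}" "z \<in> {a<..<b} \<Longrightarrow> \<exists>s\<in>S. z < s" "z \<in> {a<..<b} \<Longrightarrow> \<exists>s\<in>S. s < z"
proof -
  show "S \<subseteq> {a<..<b}" using hull_subset[of S convex] assms by simp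
  show "\<exists>s\<in>S. z < s" if z: "z \<in> {a<..<b}"
  proof (rule ccontr)
    assume "\<not> ?thesis"
    then have "convex hull S \<subseteq> {..z}" by (intro hull_minimal) (auto simp: not_less)
    moreover have "(z + b) / 2 \<in> convex hull S" using z unfolding assms by auto
    ultimately show False using z by auto
  qed
  show "\<exists>s\<in>S. s < z" if z: "z \<in> {a<..<b}"
  proof (rule ccontr)
    assume "\<not> ?thesis"
    then have "convex hull S \<subseteq> {z..}" by (intro hull_minimal) (auto simp: not_less)
    moreover have "(z + a) / 2 \<in> convex hull S" using z unfolding assms by auto
    ultimately show False using z by auto
  qed
qed

lemma orbital_of_ext_homeo:
  assumes "H \<subseteq> carrier PLo" "x \<in> unit_Icc"
  shows "orbital_of H x = convex hull {app u x |u. u \<in> ext_homeo ` H}"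
proof -
  have "app (ext_homeo h) x = h x" if "h \<in> H" for h
    using that assms by (simp add: app_ext_homeo subset_iff)
  then have "{h x |h. h \<in> H} = {app u x |u. u \<in> ext_homeo ` H}"
    unfolding setcompr_eq_image Collect_mem_eq image_image by (intro image_cong) simp_all
  then show ?thesis by (simp add: orbital_of_def)
qed

lemma generate_fix:
  assumes h: "h \<in> carrier PLo" and k: "k \<in> generate PLo {h}" and x: "app (ext_homeo h) x = x"
  shows "app (ext_homeo k) x = x"
proof -
  interpret group PLo by (rule group_PLo)
  have gc: "generate PLo {h} \<subseteq> carrier PLo" using h by (intro generate_incl) auto
  from k show ?thesis
  proof (induction k rule: generate.induct)
    case one
    then show ?case by (simp add: ext_homeo_one)
  next
    case (incl g)
    then show ?case using x by simp
  next
    case (inv g)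
    then show ?case using x h by (simp add: ext_homeo_inv app_uminus_eq_iff)
  next
    case (eng g1 g2)
    then show ?case using gc by (simp add: ext_homeo_mult subset_iff)
  qed
qed

lemma orbital_of_generate:
  assumes h: "h \<in> carrier PLo" and o: "joint_orbital (ext_homeo h) (ext_homeo h) l r" and y: "l < y" "y < r"
  shows "orbital_of (generate PLo {h}) y = {l<..<r}"
proof -
  interpret group PLo by (rule group_PLo)
  let ?u = "ext_homeo h" and ?G = "ext_homeo ` generate PLo {h}"
  have sub: "subgroup (generate PLo {h}) PLo" using h by (intro generate_is_subgroup) auto
  interpret G: homeo_group ?G by (rule homeo_group_ext_homeo[OF sub])
  have uG: "?u \<in> ?G" using generate.incl[of h "{h}" PLo] by simp
  have fixr: "app v x = x" if "v \<in> ?G" "app ?u x = x" for v x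
    using that generate_fix[OF h] by blast
  have lr: "app v l = l" "app v r = r" if "v \<in> ?G" for v
    using fixr[OF that] o by (auto simp: joint_orbital_def)
  have cof: "\<exists>v\<in>?G. app v x > z" if "x \<in> {l<..<r}" "z < r" for x z
  proof (rule orbit_cofinal[of _ r])
    show "\<exists>v\<in>?G. app v s \<noteq> s" if "x \<le> s" "s < r" for s
      using that \<open>x \<in> _\<close> o uG unfolding joint_orbital_def by (metis greaterThanLessThan_iff less_le_trans)
  qed (use that lr G.homeo_group_axioms in auto)
  have yI: "y \<in> unit_Icc"
    using supp_in_ext_homeo[OF h] o y unfolding supp_in_def joint_orbital_def by auto
  have "convex hull {app v y |v. v \<in> ?G} = {l<..<r}"
  proof (rule hull_openI)
    show "{app v y |v. v \<in> ?G} \<subseteq> {l<..<r}"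
      using lr y app_less by (smt (verit) greaterThanLessThan_iff mem_Collect_eq subsetI)
    fix z assume z: "z \<in> {l<..<r}"
    obtain v where v: "v \<in> ?G" "app v z > y" using cof[of z y] z y by auto
    then have "app (- v) y < z" by (simp add: app_uminus_less_iff)
    moreover obtain w where "w \<in> ?G" "app w y > z" using cof[of y z] z y by auto
    ultimately show "(\<exists>s\<in>{app v y |v. v \<in> ?G}. s < z) \<and> (\<exists>s\<in>{app v y |v. v \<in> ?G}. z < s)"
      using v(1) by blast
  qed
  then show ?thesis
    using orbital_of_ext_homeo[OF subgroup.subset[OF sub] yI] by simp
qed

text \<open>The orbitals of a cyclic group are the gaps between the fixed points of a generator.\<close>

lemma orbitals_elt_eq:
  assumes h: "h \<in> carrier PLo"
  shows "orbitals_elt h = {{l<..<r} |l r. joint_orbital (ext_homeo h) (ext_homeo h) l r}"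
proof -
  interpret group PLo by (rule group_PLo)
  let ?u = "ext_homeo h"
  have gc: "generate PLo {h} \<subseteq> carrier PLo" using h by (intro generate_incl) auto
  have supp: "supp_in 0 1 ?u" by (rule supp_in_ext_homeo[OF h])
  have supp_eq: "support (generate PLo {h}) = {y. app ?u y \<noteq> y}"
  proof (intro Set.set_eqI iffI)
    fix y assume "y \<in> support (generate PLo {h})"
    then obtain k where k: "y \<in> unit_Icc" "k \<in> generate PLo {h}" "k y \<noteq> y"
      by (auto simp: support_def fixed_points_def)
    then have "app (ext_homeo k) y \<noteq> y" using gc app_ext_homeo[of k y] by auto
    then show "y \<in> {y. app ?u y \<noteq> y}" using generate_fix[OF h k(2)] by auto
  next
    fix y assume "y \<in> {y. app ?u y \<noteq> y}"
    then have "y \<in> unit_Icc" "h y \<noteq> y" using app_ext_homeo[OF h, of y] by (auto split: if_splits)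
    then show "y \<in> support (generate PLo {h})"
      using generate.incl[of h "{h}" PLo] by (auto simp: support_def fixed_points_def)
  qed
  have around: "\<exists>l r. joint_orbital ?u ?u l r \<and> l < y \<and> y < r" if "app ?u y \<noteq> y" for y
  proof -
    have "0 \<le> y" "y \<le> 1" "app ?u (- 1) = - 1" "app ?u 2 = 2" using supp that unfolding supp_in_def by fastforce+
    then show ?thesis using orbital_around[of ?u y ?u "- 1" 2] that by auto
  qed
  have mid: "app ?u ((l + r) / 2) \<noteq> (l + r) / 2" "l < (l + r) / 2" "(l + r) / 2 < r"
    if o: "joint_orbital ?u ?u l r" for l r
  proof -
    show *: "l < (l + r) / 2" "(l + r) / 2 < r" using o by (auto simp: joint_orbital_def)
    have "(l + r) / 2 \<in> {l<..<r}" using * by simp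
    then show "app ?u ((l + r) / 2) \<noteq> (l + r) / 2" using o unfolding joint_orbital_def by blast
  qed
  show ?thesis
    unfolding orbitals_elt_def orbitals_def supp_eq
  proof (intro equalityI subsetI; clarify)
    fix y assume "app ?u y \<noteq> y"
    then show "\<exists>l r. orbital_of (generate PLo {h}) y = {l<..<r} \<and> joint_orbital ?u ?u l r"
      using around[of y] orbital_of_generate[OF h] by blast
  next
    fix l r assume o: "joint_orbital ?u ?u l r"
    then show "\<exists>y. {l<..<r} = orbital_of (generate PLo {h}) y \<and> y \<in> {y. app ?u y \<noteq> y}"
      using orbital_of_generate[OF h o mid(2,3)[OF o]] mid(1)[OF o] by blast
  qed
qed

lemma approaches_in_iff:
  assumes h: "h \<in> carrier PLo" and "a < b"
  shows "approaches_in h b {a<..<b} \<longleftrightarrow> (\<exists>l\<ge>a. joint_orbital (ext_homeo h) (ext_homeo h) l b)"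
    and "approaches_in h a {a<..<b} \<longleftrightarrow> (\<exists>r\<le>b. joint_orbital (ext_homeo h) (ext_homeo h) a r)"
proof -
  let ?u = "ext_homeo h"
  have eq: "{l<..<r} = {l'<..<r'} \<longleftrightarrow> l = l' \<and> r = r'" if "l < r" for l r l' r' :: real
    using greaterThanLessThan_subseteq_greaterThanLessThan[of l r l' r']
      greaterThanLessThan_subseteq_greaterThanLessThan[of l' r' l r] that
    by (metis dual_order.antisym greaterThanLessThan_empty_iff linorder_not_le order_refl subset_refl)
  have "approaches_in h e {a<..<b} \<longleftrightarrow>
      (\<exists>l r. joint_orbital ?u ?u l r \<and> a \<le> l \<and> r \<le> b \<and> (e = l \<or> e = r))" for e
  proof -
    have "endpoint e {l<..<r} \<longleftrightarrow> e = l \<or> e = r" if "l < r" for l r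
      unfolding endpoint_def eq[OF that] using that by auto
    moreover have "{l<..<r} \<subseteq> {a<..<b} \<longleftrightarrow> a \<le> l \<and> r \<le> b" if "l < r" for l r
      using that greaterThanLessThan_subseteq_greaterThanLessThan[of l r a b] by auto
    ultimately show ?thesis
      unfolding approaches_in_def orbitals_elt_eq[OF h] by (auto simp: joint_orbital_def) blast+
  qed
  then show "approaches_in h b {a<..<b} \<longleftrightarrow> (\<exists>l\<ge>a. joint_orbital ?u ?u l b)"
    "approaches_in h a {a<..<b} \<longleftrightarrow> (\<exists>r\<le>b. joint_orbital ?u ?u a r)"
    using \<open>a < b\<close> by (fastforce simp: joint_orbital_def)+
qed

text \<open>By the trichotomy at \<open>b\<close>, the only alternative is that \<open>u\<close> has no fixed points near \<open>b\<close>, and then the gap between its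
fixed points that reaches \<open>b\<close> is an orbital that approaches \<open>b\<close>.\<close>

lemma not_approaching_imp_neutral:
  assumes "pl_homeo u" "app u a = a" "app u b = b" "a < b" and "\<not> (\<exists>l\<ge>a. joint_orbital u u l b)"
  shows "\<exists>d\<in>{a<..<b}. \<forall>x\<in>{d..<b}. app u x = x"
proof -
  define t :: action where "t = (\<lambda>g. g, a, b)"
  have t: "rep t u = u" "lo t = a" "hi t = b" by (simp_all add: t_def rep_def lo_def hi_def)
  have "attracts u t \<or> repels u t \<or> neutral u t"
    using plh_high_germ[OF assms(1,3)] assms(4) by (intro high_germ_cases) (simp_all add: t)
  moreover have False if moves: "attracts u t \<or> repels u t"
  proof -
    obtain d where d: "d \<in> {a<..<b}" "\<forall>x\<in>{d..<b}. app u x \<noteq> x"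
      using moves unfolding attracts_def repels_def t by (metis less_irrefl)
    then obtain l r where o: "joint_orbital u u l r" "l < d" "d < r" "a \<le> l" "r \<le> b"
      using orbital_around[of u d u a b] assms(2,3) by auto
    have "r = b"
    proof (rule ccontr)
      assume "r \<noteq> b"
      then have "r \<in> {d..<b}" using o by auto
      then show False using d o by (auto simp: joint_orbital_def)
    qed
    then show False using o assms(5) by blast
  qed
  ultimately have "neutral u t" by blast
  then show ?thesis unfolding neutral_def t by blast
qed

text \<open>Let \<open>h\<close> move \<open>c\<close> beyond a point \<open>d\<close> such that \<open>w\<close> moves all points of \<open>[d, b)\<close> up. The orbital of
\<open>c\<close> under \<open>w\<close> and \<open>h\<close> must reach \<open>b\<close>: a fixed point of both below \<open>b\<close> and above \<open>c\<close> would lie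
below \<open>d\<close>, but it would have to stay above the image of \<open>c\<close> under \<open>h\<close>.\<close>

lemma one_sided_orbital:
  assumes "homeo_group G" and pl_homeo: "\<And>u. u \<in> G \<Longrightarrow> pl_homeo u"
    and fixr: "\<And>u. u \<in> G \<Longrightarrow> app u a = a \<and> app u b = b"
    and trans: "\<And>x y. x \<in> {a<..<b} \<Longrightarrow> y \<in> {a<..<b} \<Longrightarrow> \<exists>u\<in>G. app u x > y"
    and u: "u \<in> G" "joint_orbital u u l b" "a \<le> l"
    and c: "c \<in> {a<..<b}" "\<forall>x\<in>{a<..c}. app u x = x"
  shows "\<exists>w\<in>G. \<exists>h\<in>G. \<exists>l. joint_orbital w h l b \<and> attracts w (orbital_act l b) \<and> neutral w (mirror (orbital_act l b))"
proof -
  interpret homeo_group G by fact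
  define t :: action where "t = (\<lambda>g. g, l, b)"
  have t: "rep t g = g" "lo t = l" "hi t = b" for g by (simp_all add: t_def rep_def lo_def hi_def)
  have lb: "l < b" using u by (simp add: joint_orbital_def)
  have "c \<le> l"
  proof (rule ccontr)
    assume "\<not> c \<le> l"
    then have "c \<in> {l<..<b}" "app u c = c" using c by auto
    then show False using u(2) by (auto simp: joint_orbital_def)
  qed
  have "attracts u t \<or> repels u t \<or> neutral u t"
    using plh_high_germ[OF pl_homeo[OF u(1)]] fixr[OF u(1)] lb by (intro high_germ_cases) (simp_all add: t)
  moreover have "\<not> neutral u t"
  proof
    assume "neutral u t"
    then obtain d where "d \<in> {l<..<b}" "app u d = d" unfolding neutral_def t by force
    then show False using u(2) by (auto simp: joint_orbital_def)
  qed
  ultimately obtain w where w: "w = u \<or> w = - u" "attracts w t"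
  proof (elim disjE)
    assume "repels u t"
    then have "attracts (- u) t" unfolding attracts_def repels_def t by (auto simp: less_app_uminus_iff)
    then show ?thesis using that by blast
  qed auto
  have wG: "w \<in> G" using w u by auto
  have wc: "app w x = x" if "x \<in> {a<..c}" for x
    using w(1) c that by (auto simp: app_uminus_eq_iff)
  obtain d where d: "d \<in> {l<..<b}" "\<forall>x\<in>{d..<b}. app w x > x" using w(2) unfolding attracts_def t by blast
  obtain h where h: "h \<in> G" "app h c > d" using trans[of c d] c d u(3) by auto
  obtain l' r where o: "joint_orbital w h l' r" "l' < c" "c < r" "a \<le> l'" "r \<le> b"
    using orbital_around[of w c h a b] h d \<open>c \<le> l\<close> c(1) fixr[OF wG] fixr[OF h(1)] by auto
  have "r = b"
  proof (rule ccontr)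
    assume "r \<noteq> b"
    have "\<not> d \<le> r"
    proof
      assume "d \<le> r"
      then have "app w r > r" using \<open>r \<noteq> b\<close> o(5) d(2) by auto
      then show False using o(1) by (simp add: joint_orbital_def)
    qed
    moreover have "app h c < r" using o app_less[of h c r] by (auto simp: joint_orbital_def)
    ultimately show False using h by simp
  qed
  have fw: "app w l' = l'" "app w b = b" using o \<open>r = b\<close> by (auto simp: joint_orbital_def)
  have "attracts w (orbital_act l' b)"
    unfolding attracts_def orbital_act_simps
    using d o \<open>c \<le> l\<close> by (intro bexI[of _ d]) (auto simp: app_restr[OF fw])
  moreover have "neutral w (mirror (orbital_act l' b))"
    unfolding neutral_def mirror_simps orbital_act_simps
    using c o wc by (intro bexI[of _ "- c"]) (auto simp: app_restr[OF fw])
  ultimately show ?thesis using o \<open>r = b\<close> wG h by blast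
qed

lemma F_pair_in_PLo:
  assumes H: "subgroup H PLo" and A: "{a<..<b} \<in> orbitals H" and "k \<in> H"
    and k: "approaches_in k a {a<..<b} \<and> \<not> approaches_in k b {a<..<b} \<or>
            approaches_in k b {a<..<b} \<and> \<not> approaches_in k a {a<..<b}"
  shows "\<exists>y\<in>ext_homeo ` H. \<exists>z\<in>ext_homeo ` H. F_pair y z \<and> y + z \<noteq> z + y"
proof -
  let ?G = "ext_homeo ` H" and ?u = "ext_homeo k"
  interpret G: homeo_group ?G by (rule homeo_group_ext_homeo[OF H])
  have HC: "H \<subseteq> carrier PLo" by (rule subgroup.subset[OF H])
  have kC: "k \<in> carrier PLo" using HC \<open>k \<in> H\<close> by blast
  have uG: "?u \<in> ?G" using \<open>k \<in> H\<close> by simp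
  have pl: "pl_homeo v" "supp_in 0 1 v" if "v \<in> ?G" for v
    using that HC plh_ext_homeo supp_in_ext_homeo by auto
  obtain x where x: "x \<in> unit_Icc" "{a<..<b} = orbital_of H x"
    using A by (auto simp: orbitals_def support_def)
  define Orb where "Orb = {app u x |u. u \<in> ?G}"
  have hull: "convex hull Orb = {a<..<b}"
    using x orbital_of_ext_homeo[OF HC x(1)] by (simp add: Orb_def)
  note Orb = hull_openD[OF hull]
  have inO: "app u x \<in> Orb" if "u \<in> ?G" for u using that by (auto simp: Orb_def)
  have "x \<in> {a<..<b}" using inO[of 0] Orb(1) by auto
  then have ab: "a < b" by auto
  have OI: "app u s \<in> Orb" if "s \<in> Orb" "u \<in> ?G" for s u
  proof -
    obtain v where "v \<in> ?G" "s = app v x" using \<open>s \<in> Orb\<close> by (auto simp: Orb_def)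
    then show ?thesis using inO[of "v + u"] that by simp
  qed
  have I: "app u s \<in> {a<..<b}" if s: "s \<in> {a<..<b}" and u: "u \<in> ?G" for s u
  proof -
    obtain p q where "p \<in> Orb" "q \<in> Orb" "p < s" "s < q" using Orb(2,3)[OF s] by blast
    moreover from this have "app u p \<in> {a<..<b}" "app u q \<in> {a<..<b}" using OI u Orb(1) by blast+
    moreover have "app u p < app u s" "app u s < app u q" using calculation by simp_all
    ultimately show ?thesis by (meson greaterThanLessThan_iff less_trans)
  qed
  have fixr: "app u a = a \<and> app u b = b" if u: "u \<in> ?G" for u
  proof -
    have "\<not> app u a > a" "\<not> app u b < b" if "u \<in> ?G" for u
    proof -
      show "\<not> app u b < b"
      proof
        assume lt: "app u b < b"
        define s where "s = (max (app u b) a + b) / 2"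
        have s: "s \<in> {a<..<b}" "app u b < s" using lt ab by (auto simp: s_def less_max_iff_disj field_simps)
        then have "app (- u) s \<in> {a<..<b}" using I[OF s(1)] G.G_minus[OF that] by blast
        then show False using s(2) by (auto simp: app_uminus_less_iff)
      qed
      show "\<not> app u a > a"
      proof
        assume lt: "app u a > a"
        define s where "s = (min (app u a) b + a) / 2"
        have s: "s \<in> {a<..<b}" "app u a > s" using lt ab by (auto simp: s_def min_less_iff_disj field_simps)
        then have "app (- u) s \<in> {a<..<b}" using I[OF s(1)] G.G_minus[OF that] by blast
        then show False using s(2) by (auto simp: less_app_uminus_iff)
      qed
    qed
    from this[OF u] this[OF G.G_minus[OF u]] show ?thesis
      by (auto simp: app_uminus_less_iff less_app_uminus_iff)
  qed
  have trans: "\<exists>u\<in>?G. app u s > y" if s: "s \<in> {a<..<b}" and y: "y \<in> {a<..<b}" for s y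
  proof -
    obtain v w where v: "v \<in> ?G" "app v x < s" and w: "w \<in> ?G" "y < app w x"
      using Orb(3)[OF s] Orb(2)[OF y] unfolding Orb_def by blast
    have "x < app (- v) s" using v by (simp add: less_app_uminus_iff)
    then have "app w x < app w (app (- v) s)" by simp
    then have "app (- v + w) s > y" using w(2) by (simp del: app_less)
    then show ?thesis using v(1) w(1) by blast
  qed
  note approach = approaches_in_iff[OF kC ab]
  from k show ?thesis
  proof (elim disjE conjE)
    assume "approaches_in k b {a<..<b}" and na: "\<not> approaches_in k a {a<..<b}"
    then obtain l where l: "joint_orbital ?u ?u l b" "a \<le> l" using approach by blast
    have "\<exists>d\<in>{- b<..<- a}. \<forall>x\<in>{d..<- a}. app (flip ?u) x = x"
    proof (rule not_approaching_imp_neutral)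
      show "\<not> (\<exists>l\<ge>- b. joint_orbital (flip ?u) (flip ?u) l (- a))"
      proof
        assume "\<exists>l\<ge>- b. joint_orbital (flip ?u) (flip ?u) l (- a)"
        then obtain r where "- r \<ge> - b" "joint_orbital (flip ?u) (flip ?u) (- r) (- a)" by (metis minus_minus)
        then show False using na unfolding approach(2) orb_flip by auto
      qed
    qed (use fixr[OF uG] plh_flip[OF pl(1)[OF uG]] ab in simp_all)
    then obtain d where d: "d \<in> {- b<..<- a}" "\<forall>x\<in>{d..<- a}. app (flip ?u) x = x" by blast
    have "app ?u y = y" if "y \<in> {a<..- d}" for y
      using d(2)[rule_format, of "- y"] that by auto
    then have "\<exists>w\<in>?G. \<exists>h\<in>?G. \<exists>l. joint_orbital w h l b \<and> attracts w (orbital_act l b) \<and>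
        neutral w (mirror (orbital_act l b))"
      using d(1) by (intro one_sided_orbital[OF G.homeo_group_axioms pl(1) fixr trans uG l, of "- d"]) auto
    then obtain w h l' where w: "w \<in> ?G" "h \<in> ?G" "joint_orbital w h l' b" "attracts w (orbital_act l' b)"
      "neutral w (mirror (orbital_act l' b))"
      by blast
    have sub: "gen2 w h \<subseteq> ?G" by (rule G.gen2_subset[OF w(1,2)])
    have "\<exists>y\<in>gen2 w h. \<exists>z\<in>gen2 w h. F_pair y z \<and> y + z \<noteq> z + y"
      using F_pair_in_gen2[of w h l' b "orbital_act l' b"] pl sub w by blast
    then show ?thesis using sub by blast
  next
    assume "approaches_in k a {a<..<b}" and nb: "\<not> approaches_in k b {a<..<b}"
    then obtain r where r: "joint_orbital ?u ?u a r" "r \<le> b" using approach by blast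
    have "\<exists>d\<in>{a<..<b}. \<forall>x\<in>{d..<b}. app ?u x = x"
      using nb fixr[OF uG] pl[OF uG] ab unfolding approach(1)
      by (intro not_approaching_imp_neutral) auto
    then obtain d where d: "d \<in> {a<..<b}" "\<forall>x\<in>{d..<b}. app ?u x = x" by blast
    let ?G' = "flip ` ?G"
    have G': "homeo_group ?G'"
    proof
      show "0 \<in> ?G'" by (rule image_eqI[of _ _ 0]) (auto intro: homeo_eqI)
      show "u + v \<in> ?G'" if "u \<in> ?G'" "v \<in> ?G'" for u v
      proof -
        obtain p q where "p \<in> ?G" "q \<in> ?G" "u = flip p" "v = flip q" using \<open>u \<in> _\<close> \<open>v \<in> _\<close> by blast
        then show ?thesis using imageI[OF G.G_add, of p q flip] by (simp only: flip_add)
      qed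
      show "- u \<in> ?G'" if "u \<in> ?G'" for u
      proof -
        obtain p where "p \<in> ?G" "u = flip p" using \<open>u \<in> _\<close> by blast
        then show ?thesis
          using imageI[OF G.G_minus, of p flip] by (simp only: additive_hom.minus[OF additive_flip])
      qed
    qed
    have "\<exists>w\<in>?G'. \<exists>h\<in>?G'. \<exists>l. joint_orbital w h l (- a) \<and> attracts w (orbital_act l (- a)) \<and> neutral w (mirror (orbital_act l (- a)))"
    proof (rule one_sided_orbital[OF G', of "- b" _ "flip ?u" "- r" "- d"])
      show "pl_homeo u" if "u \<in> ?G'" for u using that pl plh_flip by blast
      show "app u (- b) = - b \<and> app u (- a) = - a" if "u \<in> ?G'" for u using that fixr by auto
      show "\<exists>u\<in>?G'. app u x > y" if xy: "x \<in> {- b<..<- a}" "y \<in> {- b<..<- a}" for x y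
      proof -
        obtain v where v: "v \<in> ?G" "app v (- y) > - x" using trans[of "- y" "- x"] xy by auto
        then have "app (- v) (- x) < - y" by (simp add: app_uminus_less_iff)
        then have "app (flip (- v)) x > y" by simp
        then show ?thesis using G.G_minus[OF v(1)] by blast
      qed
      show "flip ?u \<in> ?G'" using uG by blast
      show "joint_orbital (flip ?u) (flip ?u) (- r) (- a)" using r by (simp add: orb_flip)
      show "- b \<le> - r" using r by simp
      show "- d \<in> {- b<..<- a}" using d by auto
      show "\<forall>x\<in>{- b<..- d}. app (flip ?u) x = x"
      proof
        fix x assume "x \<in> {- b<..- d}"
        then show "app (flip ?u) x = x" using d(2)[rule_format, of "- x"] by auto
      qed
    qed
    then obtain w h l where w: "w \<in> ?G" "h \<in> ?G" "joint_orbital (flip w) (flip h) l (- a)"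
      "attracts (flip w) (orbital_act l (- a))" "neutral (flip w) (mirror (orbital_act l (- a)))"
      by blast
    define r' where "r' = - l"
    have o: "joint_orbital w h a r'" using w(3) orb_flip[of w h r' a] by (simp add: r'_def)
    then have fw: "app w a = a" "app w r' = r'" by (auto simp: joint_orbital_def)
    have fr: "flip (restr a r' w) = restr l (- a) (flip w)" using flip_restr[OF fw] by (simp add: r'_def)
    have "attracts w (mirror (orbital_act a r'))"
      using w(4) unfolding attracts_def mirror_simps orbital_act_simps fr by (simp add: r'_def del: app_flip)
    moreover have "neutral w (mirror (mirror (orbital_act a r')))"
      using w(5) unfolding neutral_def by (simp add: fr[symmetric] r'_def)
    moreover have sub: "gen2 w h \<subseteq> ?G" by (rule G.gen2_subset[OF w(1,2)])
    ultimately have "\<exists>y\<in>gen2 w h. \<exists>z\<in>gen2 w h. F_pair y z \<and> y + z \<noteq> z + y"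
      using F_pair_in_gen2[of w h a r' "mirror (orbital_act a r')"] pl w o by blast
    then show ?thesis using sub by blast
  qed
qed

section \<open>The group presented by the relations of \<open>F\<close>\<close>

abbreviation F_rels :: "(thompson_gen word \<times> thompson_gen word) set" where
  "F_rels \<equiv> {(word_conj g1 (g0 @ g0), word_conj g1 (g0 @ g1)),
      (word_conj g1 (g0 @ g0 @ g0), word_conj g1 (g0 @ g0 @ g1))}"

definition eval_word :: "('g \<Rightarrow> 'a::group_add) \<Rightarrow> 'g word \<Rightarrow> 'a" where
  "eval_word \<phi> w = sum_list (map (\<lambda>(x, e). if e then \<phi> x else - \<phi> x) w)"

lemma ev_simps [simp]:
  "eval_word \<phi> [] = 0" "eval_word \<phi> ((x, e) # w) = (if e then \<phi> x else - \<phi> x) + eval_word \<phi> w"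
  "eval_word \<phi> (v @ w) = eval_word \<phi> v + eval_word \<phi> w"
  by (simp_all add: eval_word_def)

lemma ev_word_inv [simp]: "eval_word \<phi> (word_inv w) = - eval_word \<phi> w"
  by (induction w) (auto simp: word_inv_def minus_add)

lemma ev_word_conj: "eval_word \<phi> (word_conj v w) = cj (eval_word \<phi> v) (eval_word \<phi> w)"
  by (simp add: word_conj_def cj_def add.assoc)

lemma ev_word_eq:
  assumes "word_eq R v w" "\<And>p q. (p, q) \<in> R \<Longrightarrow> eval_word \<phi> p = eval_word \<phi> q"
  shows "eval_word \<phi> v = eval_word \<phi> w"
  using assms by induction auto

lemma ev_F_rels:
  assumes "F_pair (\<phi> Gen0) (\<phi> Gen1)" "word_eq F_rels v w"
  shows "eval_word \<phi> v = eval_word \<phi> w"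
  using assms(2)
proof (rule ev_word_eq)
  show "eval_word \<phi> p = eval_word \<phi> q" if "(p, q) \<in> F_rels" for p q
    using that assms(1) by (auto simp: ev_word_conj g0_def g1_def F_pair_def add.assoc)
qed

text \<open>The group \<open>thompson_F\<close> as a type of class \<open>group_add\<close>, to which the results about pairs with the relations of \<open>F\<close> apply.\<close>

quotient_type thompson = "thompson_gen word" / "word_eq F_rels"
  by (intro equivpI reflpI sympI transpI) (blast intro: word_eq.intros)+

instantiation thompson :: group_add
begin

lift_definition zero_thompson :: thompson is "[]" .
lift_definition plus_thompson :: "thompson \<Rightarrow> thompson \<Rightarrow> thompson" is "(@)"
  by (rule word_eq_append)

lift_definition uminus_thompson :: "thompson \<Rightarrow> thompson" is word_inv
proof -
  fix u v :: "thompson_gen word" assume uv: "word_eq F_rels u v"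
  let ?R = F_rels
  have right: "word_eq ?R (v @ word_inv v) []" for v
    using word_inv_left[of ?R "word_inv v"] by (simp add: word_inv_def rev_map comp_def case_prod_beta)
  have "word_eq ?R (word_inv u @ (v @ word_inv v)) (word_inv u @ [])"
    by (intro word_eq_append word_eq_refl right)
  moreover have "word_eq ?R ((word_inv u @ u) @ word_inv v) ([] @ word_inv v)"
    by (intro word_eq_append word_eq_refl word_inv_left)
  moreover have "word_eq ?R (word_inv u @ (u @ word_inv v)) (word_inv u @ (v @ word_inv v))"
    by (intro word_eq_append word_eq_refl uv)
  ultimately show "word_eq ?R (word_inv u) (word_inv v)"
    by (simp, meson word_eq_sym word_eq_trans)
qed

definition "u - v = u + - (v :: thompson)"

instance
proof
  fix a b c :: thompson
  show "a + b + c = a + (b + c)" by transfer (simp add: word_eq_refl)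
  show "0 + a = a" by transfer (simp add: word_eq_refl)
  show "a + 0 = a" by transfer (simp add: word_eq_refl)
  show "- a + a = 0" by transfer (rule word_inv_left)
  show "a + - b = a - b" by (simp add: minus_thompson_def)
qed

end

definition tgen :: "thompson_gen \<Rightarrow> thompson" where
  "tgen x = abs_thompson [(x, True)]"

lemma ev_tgen: "eval_word tgen w = abs_thompson w"
proof (induction w)
  case Nil
  show ?case by (simp add: zero_thompson.abs_eq)
next
  case (Cons p w)
  obtain x e where p: "p = (x, e)" by (cases p)
  have "(if e then tgen x else - tgen x) = abs_thompson [(x, e)]"
    by (auto simp: tgen_def uminus_thompson.abs_eq word_inv_def)
  then show ?case using Cons by (simp add: p plus_thompson.abs_eq)
qed

lemma F_pair_tgen: "F_pair (tgen Gen0) (tgen Gen1)"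
proof -
  have rel: "eval_word tgen p = eval_word tgen q" if "(p, q) \<in> F_rels" for p q
    unfolding ev_tgen thompson.abs_eq_iff using that by (rule word_eq_rel)
  show ?thesis
    using rel[of "word_conj g1 (g0 @ g0)" "word_conj g1 (g0 @ g1)"]
      rel[of "word_conj g1 (g0 @ g0 @ g0)" "word_conj g1 (g0 @ g0 @ g1)"]
    by (simp add: ev_word_conj g0_def g1_def F_pair_def add.assoc)
qed

lemma ev_tgen_gen2: "eval_word tgen w \<in> gen2 (tgen Gen0) (tgen Gen1)"
proof (induction w)
  case Nil
  show ?case by (simp add: gen2_0)
next
  case (Cons p w)
  obtain x e where p: "p = (x, e)" by (cases p)
  show ?case using Cons by (cases x) (auto simp: p intro: gen2.intros)
qed

text \<open>By \<open>inj_on_F\<close>, evaluation at a noncommuting pair is injective on the presented group.\<close>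

lemma eval_word_eq_imp_word_eq:
  fixes \<phi> :: "thompson_gen \<Rightarrow> 'a::group_add"
  assumes F: "F_pair (\<phi> Gen0) (\<phi> Gen1)" and nc: "\<phi> Gen0 + \<phi> Gen1 \<noteq> \<phi> Gen1 + \<phi> Gen0"
    and eq: "eval_word \<phi> v = eval_word \<phi> w"
  shows "word_eq F_rels v w"
proof -
  define \<theta> where "\<theta> = (\<lambda>a. eval_word \<phi> (rep_thompson a))"
  have \<theta>: "\<theta> (abs_thompson w) = eval_word \<phi> w" for w
  proof -
    have "word_eq F_rels (rep_thompson (abs_thompson w)) w"
      by (rule Quotient3_rep_abs[OF Quotient3_thompson]) (rule word_eq_refl)
    then show ?thesis unfolding \<theta>_def by (rule ev_F_rels[OF F])
  qed
  interpret additive_hom \<theta>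
  proof
    fix a b
    obtain v w where "a = abs_thompson v" "b = abs_thompson w" by (metis Quotient3_abs_rep Quotient3_thompson)
    then show "\<theta> (a + b) = \<theta> a + \<theta> b" by (simp add: plus_thompson.abs_eq \<theta>)
  qed
  have gens: "\<theta> (tgen x) = \<phi> x" for x by (simp add: tgen_def \<theta>)
  let ?w = "eval_word tgen (v @ word_inv w)"
  have "\<theta> ?w = 0" unfolding ev_tgen \<theta> using eq by simp
  then have "?w = 0"
    using inj_on_F[OF F_pair_tgen] nc ev_tgen_gen2 gens by metis
  then have "eval_word tgen v = eval_word tgen w" by (simp add: eq_neg_iff_add_eq_0[symmetric])
  then show ?thesis by (simp add: ev_tgen thompson.abs_eq_iff)
qed

theorem theorem1:
  fixes H :: "(real \<Rightarrow> real) set" and a b :: real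
  assumes "subgroup H PLo"
    and "{a<..<b} \<in> orbitals H"
    and "\<exists>h\<in>H. (approaches_in h a {a<..<b} \<and> \<not> approaches_in h b {a<..<b}) \<or>
               (approaches_in h b {a<..<b} \<and> \<not> approaches_in h a {a<..<b})"
  shows "\<exists>K. subgroup K (PLo\<lparr>carrier := H\<rparr>) \<and> PLo\<lparr>carrier := K\<rparr> \<cong> thompson_F"
proof -
  interpret PLo: group PLo by (rule group_PLo)
  let ?E = ext_homeo
  obtain y z where yz: "y \<in> ?E ` H" "z \<in> ?E ` H" "F_pair y z" "y + z \<noteq> z + y"
    using F_pair_in_PLo[OF assms(1,2)] assms(3) by blast
  interpret G: homeo_group "?E ` H" by (rule homeo_group_ext_homeo[OF assms(1)])
  have HC: "H \<subseteq> carrier PLo" by (rule subgroup.subset[OF assms(1)])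
  define \<phi> where "\<phi> = (\<lambda>x. case x of Gen0 \<Rightarrow> y | Gen1 \<Rightarrow> z)"
  have \<phi>: "\<phi> Gen0 = y" "\<phi> Gen1 = z" by (simp_all add: \<phi>_def)
  have ev_eq: "eval_word \<phi> v = eval_word \<phi> w \<longleftrightarrow> word_eq F_rels v w" for v w
    using ev_F_rels[of \<phi> v w] eval_word_eq_imp_word_eq[of \<phi> v w] yz by (auto simp: \<phi>)
  have ev_in: "eval_word \<phi> w \<in> ?E ` H" for w
  proof (induction w)
    case (Cons p w)
    obtain x e where "p = (x, e)" by (cases p)
    then show ?case using Cons yz by (cases x) (auto simp: \<phi> intro!: G.G_add)
  qed simp
  define K where "K = {k \<in> H. ?E k \<in> range (eval_word \<phi>)}"
  define \<Psi> where "\<Psi> = (\<lambda>w. inv_into H ?E (eval_word \<phi> w))"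
  have inj: "inj_on ?E H" using ext_homeo_inj HC by (rule inj_on_subset)
  have \<Psi>H: "\<Psi> w \<in> H" and E\<Psi>: "?E (\<Psi> w) = eval_word \<phi> w" for w
    unfolding \<Psi>_def by (rule inv_into_into[OF ev_in], rule f_inv_into_f[OF ev_in])
  have \<Psi>_mult: "\<Psi> (v @ w) = \<Psi> v \<otimes>\<^bsub>PLo\<^esub> \<Psi> w" for v w
  proof (rule inj_onD[OF inj])
    show "\<Psi> v \<otimes>\<^bsub>PLo\<^esub> \<Psi> w \<in> H" by (rule subgroup.m_closed[OF assms(1) \<Psi>H \<Psi>H])
    show "?E (\<Psi> (v @ w)) = ?E (\<Psi> v \<otimes>\<^bsub>PLo\<^esub> \<Psi> w)"
      using \<Psi>H HC by (subst ext_homeo_mult) (auto simp: E\<Psi>)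
  qed (rule \<Psi>H)
  have \<Psi>_eq: "\<Psi> v = \<Psi> w \<longleftrightarrow> word_eq F_rels v w" for v w
    unfolding ev_eq[symmetric] by (metis E\<Psi> \<Psi>_def)
  have K: "K = range \<Psi>"
  proof (intro Set.set_eqI iffI)
    fix k assume "k \<in> K"
    then obtain w where "k \<in> H" "?E k = eval_word \<phi> w" by (auto simp: K_def)
    then have "k = \<Psi> w" using inj unfolding \<Psi>_def by (metis inv_into_f_f)
    then show "k \<in> range \<Psi>" by blast
  qed (auto simp: K_def \<Psi>H E\<Psi>)
  have "subgroup K PLo"
  proof (rule PLo.subgroupI)
    show "K \<subseteq> carrier PLo" using HC by (auto simp: K_def)
    show "K \<noteq> {}" by (simp add: K)
    show "inv\<^bsub>PLo\<^esub> k \<in> K" if kK: "k \<in> K" for k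
    proof -
      obtain w where k: "k \<in> H" "?E k = eval_word \<phi> w" using kK by (auto simp: K_def)
      then have "?E (inv\<^bsub>PLo\<^esub> k) = eval_word \<phi> (word_inv w)" using HC by (simp add: ext_homeo_inv subset_iff)
      then have "?E (inv\<^bsub>PLo\<^esub> k) \<in> range (eval_word \<phi>)" by (rule range_eqI)
      then show ?thesis using k subgroup.m_inv_closed[OF assms(1)] by (simp add: K_def)
    qed
    show "k \<otimes>\<^bsub>PLo\<^esub> k' \<in> K" if "k \<in> K" "k' \<in> K" for k k'
    proof -
      obtain v w where "k = \<Psi> v" "k' = \<Psi> w" using \<open>k \<in> K\<close> \<open>k' \<in> K\<close> unfolding K by blast
      then have "k \<otimes>\<^bsub>PLo\<^esub> k' = \<Psi> (v @ w)" by (simp add: \<Psi>_mult)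
      then show ?thesis unfolding K by simp
    qed
  qed
  moreover have "K \<subseteq> H" by (auto simp: K_def)
  ultimately have sub: "subgroup K (PLo\<lparr>carrier := H\<rparr>)"
    using assms(1) by (intro PLo.subgroup_incl)
  define \<Theta> where "\<Theta> = (\<lambda>A. \<Psi> (SOME w. w \<in> A))"
  have \<Theta>: "\<Theta> (word_class F_rels w) = \<Psi> w" for w
  proof -
    have "w \<in> word_class F_rels w" by (simp add: word_class_def word_eq_refl)
    then have "(SOME v. v \<in> word_class F_rels w) \<in> word_class F_rels w" by (rule someI)
    then have "word_eq F_rels w (SOME v. v \<in> word_class F_rels w)" by (simp add: word_class_def)
    then show ?thesis unfolding \<Theta>_def \<Psi>_eq by (rule word_eq_sym)
  qed
  have car: "carrier thompson_F = range (word_class F_rels)"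
    by (simp add: thompson_F_def presented_group_def)
  have "\<Theta> \<in> iso thompson_F (PLo\<lparr>carrier := K\<rparr>)"
  proof (rule isoI)
    show "\<Theta> \<in> hom thompson_F (PLo\<lparr>carrier := K\<rparr>)"
    proof (rule homI)
      show "\<Theta> A \<in> carrier (PLo\<lparr>carrier := K\<rparr>)" if "A \<in> carrier thompson_F" for A
        using that by (auto simp: car \<Theta> K)
      show "\<Theta> (A \<otimes>\<^bsub>thompson_F\<^esub> B) = \<Theta> A \<otimes>\<^bsub>PLo\<lparr>carrier := K\<rparr>\<^esub> \<Theta> B"
        if "A \<in> carrier thompson_F" "B \<in> carrier thompson_F" for A B
      proof -
        obtain v w where "A = word_class F_rels v" "B = word_class F_rels w" using \<open>A \<in> _\<close> \<open>B \<in> _\<close> by (auto simp: car)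
        then show ?thesis by (simp add: thompson_F_def presented_mult \<Theta> \<Psi>_mult)
      qed
    qed
    show "bij_betw \<Theta> (carrier thompson_F) (carrier (PLo\<lparr>carrier := K\<rparr>))"
      unfolding bij_betw_def
    proof
      show "inj_on \<Theta> (carrier thompson_F)"
        unfolding car by (auto simp only: inj_on_def \<Theta> \<Psi>_eq word_class_eqI)
      show "\<Theta> ` carrier thompson_F = carrier (PLo\<lparr>carrier := K\<rparr>)"
        unfolding car image_image \<Theta> by (simp add: K)
    qed
  qed
  then have "thompson_F \<cong> PLo\<lparr>carrier := K\<rparr>" by (rule is_isoI)
  then have "PLo\<lparr>carrier := K\<rparr> \<cong> thompson_F" by (rule group.iso_sym[OF group_thompson_F])
  with sub show ?thesis by blast
qed

end
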